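(* Let $\gamma>1$ and $r\in\mathbb{R}$. The Leray transform $\mathbf{L}$ of $M_\gamma$ is a bounded projection from $L^2(M_\gamma,\mu_r)$ to $L^2(M_\gamma,\mu_r)$ if and only if $r\in\mathcal{I}_0:=(-1,2\gamma-1)$.
   Context: For $\gamma>1$ let $M_\gamma=\{(\zeta_1,\zeta_2)\in\mathbb{C}^2:\operatorname{Im}\zeta_2=|\zeta_1|^\gamma\}$, parametrized up to a null set by $(s,\alpha,\theta)\in\mathbb{R}\times(0,\infty)\times[0,2\pi)$ via $\zeta=(\alpha e^{i\theta},\,s+i\alpha^\gamma)$. For $r\in\mathbb{R}$, $\mu_r$ is the measure $\alpha^{r}\,ds\,d\alpha\,d\theta$ on $M_\gamma$, and $\sigma=\mu_{\gamma-1}$. Each $f\in L^2(M_\gamma,\mu_r)$ has a partial Fourier expansion $f=\sum_{k\in\mathbb{Z}}f_k(s,\alpha)e^{ik\theta}$, and $L^2_k(M_\gamma,\mu_r)$ denotes the closed subspace of functions of the form $f_k(s,\alpha)e^{ik\theta}$; $L^2=\bigoplus_k L^2_k$ orthogonally. The Leray transform of $M_\gamma$ is given by $$\mathbf{L}f(z)=\frac{\gamma^2}{8\pi^2 i}\int_{M_\gamma}f(\zeta)\frac{|\zeta_1|^{\gamma-2}\,d\zeta_2\wedge d\bar\zeta_1\wedge d\zeta_1}{[\gamma\bar\zeta_1|\zeta_1|^{\gamma-2}(\zeta_1-z_1)+i(\zeta_2-z_2)]^2}=\frac{\gamma^2}{4\pi^2}\int_{M_\gamma}\frac{f(\zeta)\,d\sigma(\zeta)}{[A-Be^{i(\theta_z-\theta_\zeta)}]^2},$$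 where, for $z=(\alpha_ze^{i\theta_z},s_z+i\alpha_z^\gamma)\in M_\gamma$ and $\zeta=(\alpha_\zeta e^{i\theta_\zeta},s_\zeta+i\alpha_\zeta^\gamma)$, $A=(\gamma-1)\alpha_\zeta^\gamma+\alpha_z^\gamma+i(s_\zeta-s_z)$ and $B=\gamma\alpha_z\alpha_\zeta^{\gamma-1}$. For $z\in M_\gamma$ the integral is understood by expanding $[A-Be^{i(\theta_z-\theta_\zeta)}]^{-2}=\sum_{k\ge0}(k+1)B^kA^{-k-2}e^{ik(\theta_z-\theta_\zeta)}$ and integrating term by term: $\mathbf{L}f=\sum_{k\ge0}\mathbf{L}_kf$, where $$\mathbf{L}_kf(s_z,\alpha_z,\theta_z)=e^{ik\theta_z}\,\frac{\gamma^2(k+1)}{2\pi}\int_0^\infty\!\int_{-\infty}^\infty\frac{B^k}{A^{k+2}}f_k(s_\zeta,\alpha_\zeta)\,\alpha_\zeta^{\gamma-1}\,ds_\zeta\,d\alpha_\zeta .$$ "Bounded on $L^2(M_\gamma,\mu_r)$" means that these formulas, applied on the dense subspace of bounded functions with compact support in $M_\gamma\setminus\{\zeta_1=0\}$, satisfy $\|\mathbf{L}f\|_{L^2(\mu_r)}\le C\|f\|_{L^2(\mu_r)}$ for some constant $C$; $\mathbf L$ is then identified with its continuous extension. A projection is an operator with $\mathbf{L}\circ\mathbf{L}=\mathbf{L}$. *)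

theory Defs
  imports "HOL-Analysis.Analysis"
begin

text \<open>Elements of \<open>L\<^sup>2(M)\<close> are represented by functions; equality of classes is equality
  almost everywhere.\<close>

definition square_integrable :: "'a measure \<Rightarrow> ('a \<Rightarrow> complex) \<Rightarrow> bool" where
  "square_integrable M f \<longleftrightarrow>
     f \<in> borel_measurable M \<and> integrable M (\<lambda>x. (cmod (f x))\<^sup>2)"

text \<open>Only meaningful for square-integrable arguments: the Bochner integral of a
  non-integrable function is 0.\<close>

definition l2norm :: "'a measure \<Rightarrow> ('a \<Rightarrow> complex) \<Rightarrow> real" where
  "l2norm M f = sqrt (LINT x|M. (cmod (f x))\<^sup>2)"

definition bounded_linear_L2 ::
    "'a measure \<Rightarrow> (('a \<Rightarrow> complex) \<Rightarrow> ('a \<Rightarrow> complex)) \<Rightarrow> bool" where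
  "bounded_linear_L2 M T \<longleftrightarrow>
     (\<forall>f. square_integrable M f \<longrightarrow> square_integrable M (T f)) \<and>
     (\<forall>f g. square_integrable M f \<longrightarrow> square_integrable M g \<longrightarrow>
        (AE x in M. T (\<lambda>y. f y + g y) x = T f x + T g x)) \<and>
     (\<forall>c f. square_integrable M f \<longrightarrow> (AE x in M. T (\<lambda>y. c * f y) x = c * T f x)) \<and>
     (\<exists>C. \<forall>f. square_integrable M f \<longrightarrow> l2norm M (T f) \<le> C * l2norm M f)"

definition hypersurface :: "real \<Rightarrow> (complex \<times> complex) set" where
  "hypersurface \<gamma> = {\<zeta>. Im (snd \<zeta>) = cmod (fst \<zeta>) powr \<gamma>}"

definition hparam :: "real \<Rightarrow> real \<times> real \<times> real \<Rightarrow> complex \<times> complex" where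
  "hparam \<gamma> = (\<lambda>(s, \<alpha>, \<theta>). (of_real \<alpha> * cis \<theta>, Complex s (\<alpha> powr \<gamma>)))"

text \<open>The measure \<open>\<alpha>\<^sup>r ds d\<alpha> d\<theta>\<close>, pushed forward to the Borel sets of the hypersurface.\<close>

definition hmeasure :: "real \<Rightarrow> real \<Rightarrow> (complex \<times> complex) measure" where
  "hmeasure \<gamma> r =
     distr
       (density (restrict_space lborel (UNIV \<times> {0<..} \<times> {0..<2*pi}))
          (\<lambda>(s, \<alpha>, \<theta>). ennreal (\<alpha> powr r)))
       (restrict_space borel (hypersurface \<gamma>))
       (hparam \<gamma>)"

definition fourier_coeff ::
    "real \<Rightarrow> int \<Rightarrow> (complex \<times> complex \<Rightarrow> complex) \<Rightarrow> real \<Rightarrow> real \<Rightarrow> complex" where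
  "fourier_coeff \<gamma> k f s \<alpha> =
     (1 / (2 * of_real pi)) *
     (LINT \<theta>:{0..<2*pi}|lborel. f (hparam \<gamma> (s, \<alpha>, \<theta>)) * cis (- of_int k * \<theta>))"

definition leray_A :: "real \<Rightarrow> real \<Rightarrow> real \<Rightarrow> real \<Rightarrow> real \<Rightarrow> complex" where
  "leray_A \<gamma> s\<^sub>z \<alpha>\<^sub>z s\<^sub>\<zeta> \<alpha>\<^sub>\<zeta> =
     Complex ((\<gamma> - 1) * \<alpha>\<^sub>\<zeta> powr \<gamma> + \<alpha>\<^sub>z powr \<gamma>) (s\<^sub>\<zeta> - s\<^sub>z)"

definition leray_B :: "real \<Rightarrow> real \<Rightarrow> real \<Rightarrow> real" where
  "leray_B \<gamma> \<alpha>\<^sub>z \<alpha>\<^sub>\<zeta> = \<gamma> * \<alpha>\<^sub>z * \<alpha>\<^sub>\<zeta> powr (\<gamma> - 1)"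

text \<open>The \<open>k\<close>-th term obtained by expanding the kernel \<open>(A - B u)\<^sup>-\<^sup>2\<close>, with
  \<open>u = cis (\<theta>\<^sub>z - \<theta>\<^sub>\<zeta>)\<close>, in powers of \<open>u\<close> and integrating out \<open>\<theta>\<^sub>\<zeta>\<close>. The coordinates of a
  point \<open>z\<close> of the hypersurface are \<open>s\<^sub>z = Re (snd z)\<close>, \<open>\<alpha>\<^sub>z = cmod (fst z)\<close> and
  \<open>\<theta>\<^sub>z = Arg2pi (fst z)\<close>.\<close>

definition leray_term ::
    "real \<Rightarrow> nat \<Rightarrow> (complex \<times> complex \<Rightarrow> complex) \<Rightarrow> complex \<times> complex \<Rightarrow> complex" where
  "leray_term \<gamma> k f z =
     cis (real k * Arg2pi (fst z)) * of_real (\<gamma>\<^sup>2 * (real k + 1) / (2 * pi)) *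
     (LINT \<alpha>:{0<..}|lborel. LINT s|lborel.
        of_real (leray_B \<gamma> (cmod (fst z)) \<alpha>) ^ k
          / leray_A \<gamma> (Re (snd z)) (cmod (fst z)) s \<alpha> ^ (k + 2)
        * fourier_coeff \<gamma> (int k) f s \<alpha> * of_real (\<alpha> powr (\<gamma> - 1)))"

definition test_function :: "real \<Rightarrow> (complex \<times> complex \<Rightarrow> complex) \<Rightarrow> bool" where
  "test_function \<gamma> f \<longleftrightarrow>
     f \<in> borel_measurable (restrict_space borel (hypersurface \<gamma>)) \<and>
     bounded (f ` hypersurface \<gamma>) \<and>
     (\<exists>K. compact K \<and> K \<subseteq> hypersurface \<gamma> - {\<zeta>. fst \<zeta> = 0} \<and>
          (\<forall>\<zeta> \<in> hypersurface \<gamma> - K. f \<zeta> = 0))"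

text \<open>\<open>g\<close> represents \<open>L f\<close>. The terms lie in mutually orthogonal subspaces, and their sum is
  the orthogonal sum, that is, it converges in \<open>L\<^sup>2(\<mu>\<^sub>r)\<close>; this determines \<open>g\<close> almost everywhere.\<close>

definition is_leray_transform ::
    "real \<Rightarrow> real \<Rightarrow> (complex \<times> complex \<Rightarrow> complex) \<Rightarrow> (complex \<times> complex \<Rightarrow> complex) \<Rightarrow> bool" where
  "is_leray_transform \<gamma> r f g \<longleftrightarrow>
     (\<forall>k. square_integrable (hmeasure \<gamma> r) (leray_term \<gamma> k f)) \<and>
     square_integrable (hmeasure \<gamma> r) g \<and>
     (\<lambda>n. l2norm (hmeasure \<gamma> r) (\<lambda>z. (\<Sum>k<n. leray_term \<gamma> k f z) - g z)) \<longlonglongrightarrow> 0"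

definition leray_bounded :: "real \<Rightarrow> real \<Rightarrow> bool" where
  "leray_bounded \<gamma> r \<longleftrightarrow>
     (\<exists>C. \<forall>f. test_function \<gamma> f \<longrightarrow>
        (\<exists>g. is_leray_transform \<gamma> r f g \<and>
             l2norm (hmeasure \<gamma> r) g \<le> C * l2norm (hmeasure \<gamma> r) f))"

text \<open>Test functions are dense in \<open>L\<^sup>2(\<mu>\<^sub>r)\<close>, so \<open>T\<close> is unique up to null sets.\<close>

definition is_leray_extension ::
    "real \<Rightarrow> real \<Rightarrow> ((complex \<times> complex \<Rightarrow> complex) \<Rightarrow> (complex \<times> complex \<Rightarrow> complex)) \<Rightarrow> bool" where
  "is_leray_extension \<gamma> r T \<longleftrightarrow>
     bounded_linear_L2 (hmeasure \<gamma> r) T \<and>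
     (\<forall>f. test_function \<gamma> f \<longrightarrow> is_leray_transform \<gamma> r f (T f))"

definition leray_bounded_projection :: "real \<Rightarrow> real \<Rightarrow> bool" where
  "leray_bounded_projection \<gamma> r \<longleftrightarrow>
     leray_bounded \<gamma> r \<and>
     (\<exists>T. is_leray_extension \<gamma> r T \<and>
        (\<forall>f. square_integrable (hmeasure \<gamma> r) f \<longrightarrow>
           (AE z in hmeasure \<gamma> r. T (T f) z = T f z)))"

end

theory Submission
  imports Defs "HOL-Real_Asymp.Real_Asymp"
begin

text \<open>
  In the coordinates \<open>(s, \<alpha>, \<theta>)\<close> the \<open>k\<close>-th term of the Leray transform acts on the \<open>k\<close>-th Fourier
  coefficient in \<open>\<theta>\<close> as an integral operator over the half plane \<open>\<alpha> > 0\<close>, with a kernel \<open>K\<^sub>k\<close>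
  proportional to \<open>(k + 1) B\<^sup>k A\<^sup>-\<^sup>k\<^sup>-\<^sup>2 \<alpha>\<^sub>\<zeta>\<^bsup>\<gamma>-1\<^esup>\<close>. Everything follows from three properties of these kernels.

  \<^bold>\<open>Size.\<close> Write \<open>a = Re A\<close>. Integrating \<open>|K\<^sub>k|\<close> over \<open>s\<close> leaves \<open>\<surd>(k + 1) (B / a)\<^sup>k \<alpha>\<^sub>\<zeta>\<^bsup>\<gamma>-1\<^esup> / a\<close>, up to a
  constant. By the weighted inequality between arithmetic and geometric mean \<open>B \<le> a\<close>, with
  equality for \<open>\<alpha>\<^sub>z = \<alpha>\<^sub>\<zeta>\<close> and a quadratic loss away from it; so the power has width of order \<open>1/\<surd>k\<close>
  in \<open>\<alpha>\<^sub>\<zeta> / \<alpha>\<^sub>z\<close>, which compensates the factor \<open>\<surd>(k + 1)\<close>. What is left is homogeneous of degree \<open>-1\<close>,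
  and Schur's test with the weight \<open>\<alpha>\<^sup>-\<^sup>p\<close> bounds it on \<open>L\<^sup>2(\<alpha>\<^sup>r)\<close> as soon as \<open>0 < p < \<gamma>\<close> and
  \<open>r + 1 - \<gamma> < p < r + 1\<close>. Such a \<open>p\<close> exists if and only if \<open>-1 < r < 2 \<gamma> - 1\<close>
  (\<open>ex_kernel_bound\<close>). As the bound does not depend on \<open>k\<close> and the terms are orthogonal to each other,
  Bessel's inequality sums them (\<open>leray_transform_exists\<close>).

  \<^bold>\<open>Reproduction.\<close> \<open>K\<^sub>k\<close> composed with itself is \<open>K\<^sub>k\<close> (\<open>leray_kernel_reproducing\<close>): the integral over
  \<open>s\<close> is evaluated by partial fractions, the integral over \<open>\<alpha>\<close> is a Beta integral. The size estimate
  justifies Fubini's theorem, so each term is idempotent on all of \<open>L\<^sup>2\<close>, and so is the sum. The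
  defining integrals converge absolutely for every square-integrable function, almost everywhere, so
  that the extension of the transform to \<open>L\<^sup>2\<close> is given by the same formulas.

  \<^bold>\<open>Positivity.\<close> On suitable boxes the real part of \<open>K\<^sub>0\<close> is bounded below. For \<open>r \<le> -1\<close> the
  transform of a fixed bump is then too large where \<open>\<alpha>\<^sub>z\<close> is small (\<open>not_leray_bounded_low\<close>); for
  \<open>r \<ge> 2 \<gamma> - 1\<close> bumps that extend towards \<open>\<alpha>\<^sub>\<zeta> = 0\<close> contradict boundedness, which is the same
  obstruction for the adjoint (\<open>not_leray_bounded_high\<close>).
\<close>

section \<open>Square-integrable functions and Schur's test\<close>

text \<open>With values in \<open>[0, \<infinity>]\<close> the squared norm makes sense before square integrability is known, so
  that an estimate can serve to prove it.\<close>

definition l2sq :: "'a measure \<Rightarrow> ('a \<Rightarrow> complex) \<Rightarrow> ennreal" where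
  "l2sq M f = (\<integral>\<^sup>+x. ennreal ((cmod (f x))\<^sup>2) \<partial>M)"

lemma square_integrable_iff_l2sq:
  "square_integrable M f \<longleftrightarrow> f \<in> borel_measurable M \<and> l2sq M f < \<infinity>"
  unfolding square_integrable_def l2sq_def
  by (auto simp: integrable_iff_bounded)

lemma ennreal_l2norm:
  assumes "square_integrable M f"
  shows "ennreal ((l2norm M f)\<^sup>2) = l2sq M f"
  using assms unfolding square_integrable_def l2sq_def l2norm_def
  by (subst nn_integral_eq_integral) auto

lemma l2norm_nonneg [simp]: "0 \<le> l2norm M f"
  unfolding l2norm_def by simp

lemma l2norm_le:
  assumes "square_integrable M f" "square_integrable M g" "0 \<le> C"
    and "l2sq M f \<le> ennreal (C\<^sup>2) * l2sq M g"
  shows "l2norm M f \<le> C * l2norm M g"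
proof -
  have "ennreal ((l2norm M f)\<^sup>2) \<le> ennreal (C\<^sup>2 * (l2norm M g)\<^sup>2)"
    using assms by (simp add: ennreal_l2norm ennreal_mult)
  then have "(l2norm M f)\<^sup>2 \<le> (C * l2norm M g)\<^sup>2"
    by (simp add: ennreal_le_iff power_mult_distrib)
  then show ?thesis
    using assms(3) by (meson l2norm_nonneg mult_nonneg_nonneg power2_le_imp_le)
qed

lemma l2sq_le_of_l2norm:
  assumes "square_integrable M f" "square_integrable M g" "l2norm M f \<le> C * l2norm M g"
  shows "l2sq M f \<le> ennreal (C\<^sup>2) * l2sq M g"
proof -
  have "(l2norm M f)\<^sup>2 \<le> C\<^sup>2 * (l2norm M g)\<^sup>2"
    using power_mono[OF assms(3), of 2] by (simp add: power_mult_distrib)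
  then have "ennreal ((l2norm M f)\<^sup>2) \<le> ennreal (C\<^sup>2) * ennreal ((l2norm M g)\<^sup>2)"
    by (simp add: ennreal_mult[symmetric] ennreal_leI)
  then show ?thesis
    using assms by (simp add: ennreal_l2norm)
qed

lemma l2norm_tendsto_0_iff:
  assumes "\<And>n. square_integrable M (f n)"
  shows "(\<lambda>n. l2norm M (f n)) \<longlonglongrightarrow> 0 \<longleftrightarrow> (\<lambda>n. l2sq M (f n)) \<longlonglongrightarrow> 0"
proof -
  have "(\<lambda>n. l2sq M (f n)) \<longlonglongrightarrow> 0 \<longleftrightarrow> (\<lambda>n. ennreal ((l2norm M (f n))\<^sup>2)) \<longlonglongrightarrow> ennreal 0"
    using assms by (simp add: ennreal_l2norm)
  also have "\<dots> \<longleftrightarrow> (\<lambda>n. (l2norm M (f n))\<^sup>2) \<longlonglongrightarrow> 0"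
    by (subst tendsto_ennreal_iff) auto
  also have "\<dots> \<longleftrightarrow> (\<lambda>n. l2norm M (f n)) \<longlonglongrightarrow> 0"
    using tendsto_real_sqrt[of "\<lambda>n. (l2norm M (f n))\<^sup>2" 0 sequentially]
      tendsto_power[of "\<lambda>n. l2norm M (f n)" 0 sequentially 2] by auto
  finally show ?thesis by blast
qed

lemma cmod_add_square_le: "(cmod (a + b))\<^sup>2 \<le> 2 * (cmod a)\<^sup>2 + 2 * (cmod b)\<^sup>2"
proof -
  have "(cmod (a + b))\<^sup>2 \<le> (cmod a + cmod b)\<^sup>2"
    by (intro power_mono norm_triangle_ineq) simp
  also have "\<dots> \<le> 2 * (cmod a)\<^sup>2 + 2 * (cmod b)\<^sup>2"
    using sum_squares_bound[of "cmod a" "cmod b"] by (simp add: power2_sum)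
  finally show ?thesis .
qed

text \<open>The quasi-triangle inequality: in \<open>[0, \<infinity>]\<close> it is more convenient than the triangle inequality
  for the norm, and constants do not matter in what follows.\<close>

lemma l2sq_add_le:
  assumes [measurable]: "f \<in> borel_measurable M" "g \<in> borel_measurable M"
  shows "l2sq M (\<lambda>x. f x + g x) \<le> 2 * l2sq M f + 2 * l2sq M g"
proof -
  have "l2sq M (\<lambda>x. f x + g x)
      \<le> (\<integral>\<^sup>+x. 2 * ennreal ((cmod (f x))\<^sup>2) + 2 * ennreal ((cmod (g x))\<^sup>2) \<partial>M)"
    unfolding l2sq_def
  proof (intro nn_integral_mono)
    fix x
    have "ennreal ((cmod (f x + g x))\<^sup>2) \<le> ennreal (2 * (cmod (f x))\<^sup>2 + 2 * (cmod (g x))\<^sup>2)"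
      by (intro ennreal_leI cmod_add_square_le)
    also have "\<dots> = 2 * ennreal ((cmod (f x))\<^sup>2) + 2 * ennreal ((cmod (g x))\<^sup>2)"
      by (simp add: ennreal_plus ennreal_mult)
    finally show "ennreal ((cmod (f x + g x))\<^sup>2) \<le> \<dots>" .
  qed
  also have "\<dots> = 2 * l2sq M f + 2 * l2sq M g"
    unfolding l2sq_def by (simp add: nn_integral_add nn_integral_cmult)
  finally show ?thesis .
qed

lemma l2sq_minus: "l2sq M (\<lambda>x. - f x) = l2sq M f"
  by (simp add: l2sq_def)

lemma l2sq_diff_le:
  assumes [measurable]: "f \<in> borel_measurable M" "g \<in> borel_measurable M"
  shows "l2sq M (\<lambda>x. f x - g x) \<le> 2 * l2sq M f + 2 * l2sq M g"
  using l2sq_add_le[of f M "\<lambda>x. - g x"] by (simp add: l2sq_minus)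

lemma l2sq_diff_commute: "l2sq M (\<lambda>x. f x - g x) = l2sq M (\<lambda>x. g x - f x)"
  by (simp add: l2sq_def norm_minus_commute)

lemma l2sq_cmult:
  assumes "f \<in> borel_measurable M"
  shows "l2sq M (\<lambda>x. c * f x) = ennreal ((cmod c)\<^sup>2) * l2sq M f"
  using assms unfolding l2sq_def
  by (simp add: norm_mult power_mult_distrib ennreal_mult nn_integral_cmult)

lemma l2sq_cong_AE:
  assumes "AE x in M. f x = g x"
  shows "l2sq M f = l2sq M g"
  unfolding l2sq_def using assms by (intro nn_integral_cong_AE) auto

lemma l2sq_eq_0:
  assumes "f \<in> borel_measurable M" "l2sq M f = 0"
  shows "AE x in M. f x = 0"
  using assms unfolding l2sq_def by (subst (asm) nn_integral_0_iff_AE) auto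

lemma square_integrable_measurable:
  "square_integrable M f \<Longrightarrow> f \<in> borel_measurable M"
  by (simp add: square_integrable_def)

lemma square_integrable_add:
  assumes "square_integrable M f" "square_integrable M g"
  shows "square_integrable M (\<lambda>x. f x + g x)"
proof -
  have "2 * l2sq M f + 2 * l2sq M g < \<infinity>"
    using assms by (simp add: square_integrable_iff_l2sq ennreal_mult_less_top)
  then show ?thesis
    using assms le_less_trans[OF l2sq_add_le[of f M g]]
    by (auto simp: square_integrable_iff_l2sq intro!: borel_measurable_add)
qed

lemma square_integrable_cmult:
  assumes "square_integrable M f"
  shows "square_integrable M (\<lambda>x. c * f x)"
  using assms unfolding square_integrable_iff_l2sq
  by (auto simp: l2sq_cmult ennreal_mult_less_top)

lemma square_integrable_diff:
  assumes "square_integrable M f" "square_integrable M g"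
  shows "square_integrable M (\<lambda>x. f x - g x)"
  using square_integrable_add[OF assms(1) square_integrable_cmult[OF assms(2), of "-1"]] by simp

lemma square_integrable_sum:
  assumes "\<And>i. i \<in> I \<Longrightarrow> square_integrable M (f i)"
  shows "square_integrable M (\<lambda>x. \<Sum>i\<in>I. f i x)"
  using assms
proof (induction I rule: infinite_finite_induct)
  case (insert i I)
  then show ?case by (simp add: square_integrable_add)
qed (auto simp: square_integrable_iff_l2sq l2sq_def)

lemma l2sq_limit_unique:
  fixes f g :: "nat \<Rightarrow> 'a \<Rightarrow> complex"
  assumes [measurable]: "\<And>n. f n \<in> borel_measurable M" "u \<in> borel_measurable M" "v \<in> borel_measurable M"
    and "(\<lambda>n. l2sq M (\<lambda>x. f n x - u x)) \<longlonglongrightarrow> 0" "(\<lambda>n. l2sq M (\<lambda>x. f n x - v x)) \<longlonglongrightarrow> 0"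
  shows "AE x in M. u x = v x"
proof -
  have "(\<lambda>n. 2 * l2sq M (\<lambda>x. f n x - u x) + 2 * l2sq M (\<lambda>x. f n x - v x)) \<longlonglongrightarrow> 2 * 0 + 2 * 0"
    using assms(4,5) by (intro tendsto_add ennreal_tendsto_cmult) auto
  moreover have "l2sq M (\<lambda>x. v x - u x) \<le> 2 * l2sq M (\<lambda>x. f n x - u x) + 2 * l2sq M (\<lambda>x. f n x - v x)" for n
    using l2sq_diff_le[of "\<lambda>x. f n x - u x" M "\<lambda>x. f n x - v x"] by simp
  ultimately have "l2sq M (\<lambda>x. v x - u x) \<le> 0"
    by (intro LIMSEQ_le_const) auto
  then have "AE x in M. v x - u x = 0"
    by (intro l2sq_eq_0) auto
  then show ?thesis by auto
qed

text \<open>Riesz and Fischer: a subsequence with \<open>\<parallel>f m - f (n j)\<parallel>\<^sup>2 \<le> 4\<^sup>-\<^sup>j\<close> for \<open>m \<ge> n j\<close> converges almost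
  everywhere, and Fatou's lemma carries this bound to the limit.\<close>

lemma l2sq_complete:
  fixes f :: "nat \<Rightarrow> 'a \<Rightarrow> complex"
  assumes [measurable]: "\<And>n. f n \<in> borel_measurable M"
    and Cauchy: "\<And>e::real. e > 0 \<Longrightarrow> \<exists>N. \<forall>m\<ge>N. \<forall>n\<ge>N. l2sq M (\<lambda>x. f m x - f n x) \<le> ennreal e"
  shows "\<exists>g \<in> borel_measurable M. (\<lambda>n. l2sq M (\<lambda>x. f n x - g x)) \<longlonglongrightarrow> 0"
proof -
  define P where "P j k \<longleftrightarrow> (\<forall>m\<ge>k. \<forall>n\<ge>k. l2sq M (\<lambda>x. f m x - f n x) \<le> ennreal ((1/4)^j))" for j k :: nat
  have pos: "0 < (1/4::real)^j" for j :: nat by simp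
  have "\<exists>k. P j k" for j
    unfolding P_def by (rule Cauchy[OF pos])
  then have P_some: "P j (SOME k. P j k)" for j
    by (rule someI_ex)
  define N where "N j = (SOME k. P j k)" for j
  have N: "l2sq M (\<lambda>x. f m x - f n x) \<le> ennreal ((1/4)^j)"
    if "m \<ge> N j" "n \<ge> N j" for m n and j :: nat
    using P_some[of j] that unfolding P_def N_def by blast
  define n where "n j = (\<Sum>i\<le>j. N i) + j" for j
  have n_ge: "n i \<ge> N j" if "i \<ge> j" for i j
    unfolding n_def using that member_le_sum[of j "{..i}" N] by auto
  define d where "d j x = cmod (f (n (Suc j)) x - f (n j) x)" for j x
  have [measurable]: "d j \<in> borel_measurable M" for j
    unfolding d_def by measurable
  have "(\<integral>\<^sup>+x. (\<Sum>j. ennreal (2^j * (d j x)\<^sup>2)) \<partial>M) = (\<Sum>j. \<integral>\<^sup>+x. ennreal (2^j * (d j x)\<^sup>2) \<partial>M)"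
    by (intro nn_integral_suminf) auto
  also have "\<dots> \<le> (\<Sum>j. ennreal ((1/2)^j))"
  proof (intro suminf_le)
    fix j
    have "(\<integral>\<^sup>+x. ennreal (2^j * (d j x)\<^sup>2) \<partial>M) = ennreal (2^j) * l2sq M (\<lambda>x. f (n (Suc j)) x - f (n j) x)"
      unfolding l2sq_def d_def by (simp add: ennreal_mult nn_integral_cmult)
    also have "\<dots> \<le> ennreal (2^j) * ennreal ((1/4)^j)"
      using n_ge[of j j] n_ge[of j "Suc j"] by (intro mult_left_mono N) auto
    also have "\<dots> = ennreal ((1/2)^j)"
      by (subst ennreal_mult[symmetric]) (auto simp flip: power_mult_distrib)
    finally show "(\<integral>\<^sup>+x. ennreal (2^j * (d j x)\<^sup>2) \<partial>M) \<le> ennreal ((1/2)^j)" .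
  qed auto
  also have "\<dots> < \<infinity>"
  proof -
    have "summable (\<lambda>j. (1/2::real)^j)" by (rule summable_geometric) simp
    then have "(\<Sum>j. ennreal ((1/2)^j)) \<noteq> top"
      by (rule ennreal_suminf_neq_top) simp
    then show ?thesis unfolding less_top infinity_ennreal_def .
  qed
  finally have "AE x in M. (\<Sum>j. ennreal (2^j * (d j x)\<^sup>2)) \<noteq> \<infinity>"
    by (intro nn_integral_PInf_AE) auto
  then have conv: "AE x in M. convergent (\<lambda>j. f (n j) x)"
  proof (rule AE_mp, intro AE_I2 impI)
    fix x assume "(\<Sum>j. ennreal (2^j * (d j x)\<^sup>2)) \<noteq> \<infinity>"
    then have s: "summable (\<lambda>j. 2^j * (d j x)\<^sup>2)"
      by (intro summable_suminf_not_top) auto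
    \<comment> \<open>the weights \<open>2^j\<close>, affordable since \<open>\<parallel>d j\<parallel>\<^sup>2 \<le> 4\<^sup>-\<^sup>j\<close>, turn summability of squares into summability\<close>
    have "d j x \<le> (1/2)^j + 2^j * (d j x)\<^sup>2" for j
    proof -
      have "2 * ((1/2)^j * (2^j * d j x)) \<le> ((1/2)^j)^2 * 2^j + 2^j * (d j x)^2"
        using mult_left_mono[OF sum_squares_bound[of "(1/2)^j" "d j x"], of "2^j"]
        by (simp add: algebra_simps power2_eq_square)
      moreover have "(1/2)^j * (2^j * d j x) = d j x" "((1/2)^j)^2 * 2^j = (1/2::real)^j"
        by (simp_all add: power_divide power2_eq_square)
      ultimately have "2 * d j x \<le> (1/2)^j + 2^j * (d j x)\<^sup>2" by simp
      moreover have "0 \<le> d j x" by (simp add: d_def)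
      ultimately show ?thesis by linarith
    qed
    then have "summable (\<lambda>j. d j x)"
      by (intro summable_comparison_test'[OF summable_add[OF summable_geometric[of "1/2"] s], of 0])
         (auto simp: d_def)
    then have "summable (\<lambda>j. f (n (Suc j)) x - f (n j) x)"
      unfolding d_def by (rule summable_norm_cancel)
    then have "convergent (\<lambda>k. \<Sum>j<k. f (n (Suc j)) x - f (n j) x)"
      by (simp add: summable_iff_convergent)
    then have "convergent (\<lambda>k. (\<Sum>j<k. f (n (Suc j)) x - f (n j) x) + f (n 0) x)"
      by (intro convergent_add convergent_const)
    then show "convergent (\<lambda>j. f (n j) x)"
      using sum_lessThan_telescope[of "\<lambda>j. f (n j) x"] by simp
  qed
  define g where "g x = lim (\<lambda>j. f (n j) x)" for x
  have [measurable]: "g \<in> borel_measurable M"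
    unfolding g_def by measurable
  have bound: "l2sq M (\<lambda>x. f m x - g x) \<le> ennreal ((1/4)^i)" if "m \<ge> N i" for m i
  proof -
    have "l2sq M (\<lambda>x. f m x - g x) = (\<integral>\<^sup>+x. liminf (\<lambda>j. ennreal ((cmod (f m x - f (n j) x))\<^sup>2)) \<partial>M)"
      unfolding l2sq_def
    proof (intro nn_integral_cong_AE, use conv in \<open>rule AE_mp\<close>, intro AE_I2 impI)
      fix x assume "convergent (\<lambda>j. f (n j) x)"
      then have "(\<lambda>j. f (n j) x) \<longlonglongrightarrow> g x"
        unfolding g_def by (simp add: convergent_LIMSEQ_iff)
      then have "(\<lambda>j. ennreal ((cmod (f m x - f (n j) x))\<^sup>2)) \<longlonglongrightarrow> ennreal ((cmod (f m x - g x))\<^sup>2)"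
        by (intro tendsto_intros) auto
      then show "ennreal ((cmod (f m x - g x))\<^sup>2) = liminf (\<lambda>j. ennreal ((cmod (f m x - f (n j) x))\<^sup>2))"
        by (intro lim_imp_Liminf[symmetric]) auto
    qed
    also have "\<dots> \<le> liminf (\<lambda>j. l2sq M (\<lambda>x. f m x - f (n j) x))"
      unfolding l2sq_def by (intro nn_integral_liminf) auto
    also have "\<dots> \<le> limsup (\<lambda>j. l2sq M (\<lambda>x. f m x - f (n j) x))"
      by (intro Liminf_le_Limsup) auto
    also have "\<dots> \<le> ennreal ((1/4)^i)"
      by (intro Limsup_bounded eventually_sequentiallyI[of i] N n_ge that)
    finally show ?thesis .
  qed
  have "(\<lambda>m. l2sq M (\<lambda>x. f m x - g x)) \<longlonglongrightarrow> 0"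
  proof (rule order_tendstoI)
    fix a :: ennreal assume "0 < a"
    have "(\<lambda>i. ennreal ((1/4)^i)) \<longlonglongrightarrow> ennreal 0"
      by (intro tendsto_ennrealI LIMSEQ_realpow_zero) auto
    then have "eventually (\<lambda>i. ennreal ((1/4)^i) < a) sequentially"
      using \<open>0 < a\<close> by (intro order_tendstoD) auto
    then obtain i where "ennreal ((1/4)^i) < a"
      by (auto simp: eventually_sequentially)
    then show "eventually (\<lambda>m. l2sq M (\<lambda>x. f m x - g x) < a) sequentially"
      using bound by (intro eventually_sequentiallyI[of "N i"]) (meson le_less_trans)
  qed auto
  then show ?thesis by (intro bexI[of _ g]) auto
qed

text \<open>The Cauchy-Schwarz inequality for the measure \<open>K x y dM(y)\<close> and the factorization
  \<open>F = \<surd>h \<cdot> (F / \<surd>h)\<close>; the row bound removes the first factor, and after Tonelli the column bound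
  removes the integral over \<open>x\<close>.\<close>

lemma schur_test:
  fixes K :: "'a \<Rightarrow> 'a \<Rightarrow> ennreal" and w F :: "'a \<Rightarrow> ennreal" and h :: "'a \<Rightarrow> real"
  assumes "sigma_finite_measure M"
    and K[measurable]: "case_prod K \<in> borel_measurable (M \<Otimes>\<^sub>M M)"
    and [measurable]: "h \<in> borel_measurable M" "w \<in> borel_measurable M" "F \<in> borel_measurable M"
    and h: "\<And>x. x \<in> space M \<Longrightarrow> h x > 0"
    and row: "\<And>x. x \<in> space M \<Longrightarrow> (\<integral>\<^sup>+y. K x y * ennreal (h y) \<partial>M) \<le> C * ennreal (h x)"
    and col: "\<And>y. y \<in> space M \<Longrightarrow>
      (\<integral>\<^sup>+x. K x y * (ennreal (h x) * w x) \<partial>M) \<le> C * (ennreal (h y) * w y)"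
  shows "(\<integral>\<^sup>+x. (\<integral>\<^sup>+y. K x y * F y \<partial>M)\<^sup>2 * w x \<partial>M) \<le> C\<^sup>2 * (\<integral>\<^sup>+y. (F y)\<^sup>2 * w y \<partial>M)"
proof -
  interpret sigma_finite_measure M by fact
  interpret P: pair_sigma_finite M M ..
  define G where "G y = (F y)\<^sup>2 * ennreal (1 / h y)" for y
  have [measurable]: "G \<in> borel_measurable M" unfolding G_def by measurable
  have cs: "(\<integral>\<^sup>+y. K x y * F y \<partial>M)\<^sup>2 \<le> (C * ennreal (h x)) * (\<integral>\<^sup>+y. K x y * G y \<partial>M)"
    if x: "x \<in> space M" for x
  proof -
    have [measurable]: "K x \<in> borel_measurable M"
      using measurable_Pair2[OF K x] by simp
    define N where "N = density M (K x)"
    have [measurable]: "(\<lambda>y. ennreal (sqrt (h y))) \<in> borel_measurable N"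
      "(\<lambda>y. F y * ennreal (1 / sqrt (h y))) \<in> borel_measurable N" "F \<in> borel_measurable N"
      "(\<lambda>y. ennreal (h y)) \<in> borel_measurable N" "G \<in> borel_measurable N"
      unfolding N_def by measurable
    have sp: "space N = space M" by (simp add: N_def)
    have "(\<integral>\<^sup>+y. K x y * F y \<partial>M) = (\<integral>\<^sup>+y. F y \<partial>N)"
      unfolding N_def by (simp add: nn_integral_density)
    also have "\<dots> = (\<integral>\<^sup>+y. ennreal (sqrt (h y)) * (F y * ennreal (1 / sqrt (h y))) \<partial>N)"
    proof (intro nn_integral_cong)
      fix y assume "y \<in> space N"
      then have "ennreal (sqrt (h y)) * ennreal (1 / sqrt (h y)) = 1"
        using h[of y] sp by (simp flip: ennreal_mult')
      then show "F y = ennreal (sqrt (h y)) * (F y * ennreal (1 / sqrt (h y)))"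
        by (simp add: mult.left_commute)
    qed
    also have "\<dots>\<^sup>2 \<le> (\<integral>\<^sup>+y. (ennreal (sqrt (h y)))\<^sup>2 \<partial>N) * (\<integral>\<^sup>+y. (F y * ennreal (1 / sqrt (h y)))\<^sup>2 \<partial>N)"
      by (intro Cauchy_Schwarz_nn_integral) measurable
    also have "(\<integral>\<^sup>+y. (ennreal (sqrt (h y)))\<^sup>2 \<partial>N) = (\<integral>\<^sup>+y. ennreal (h y) \<partial>N)"
      using h sp by (intro nn_integral_cong) (simp add: ennreal_power less_imp_le)
    also have "\<dots> = (\<integral>\<^sup>+y. K x y * ennreal (h y) \<partial>M)"
      unfolding N_def by (simp add: nn_integral_density)
    also have "(\<integral>\<^sup>+y. (F y * ennreal (1 / sqrt (h y)))\<^sup>2 \<partial>N) = (\<integral>\<^sup>+y. G y \<partial>N)"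
    proof (intro nn_integral_cong)
      fix y assume "y \<in> space N"
      then have "h y > 0" using h[of y] sp by simp
      then have "(ennreal (1 / sqrt (h y)))\<^sup>2 = ennreal (1 / h y)"
        by (subst ennreal_power) (auto simp: power_divide)
      then show "(F y * ennreal (1 / sqrt (h y)))\<^sup>2 = G y"
        by (simp add: G_def power_mult_distrib)
    qed
    also have "\<dots> = (\<integral>\<^sup>+y. K x y * G y \<partial>M)"
      unfolding N_def by (simp add: nn_integral_density)
    finally show ?thesis
      using mult_right_mono[OF row[OF x], of "\<integral>\<^sup>+y. K x y * G y \<partial>M"] order_trans by fastforce
  qed
  have "(\<integral>\<^sup>+x. (\<integral>\<^sup>+y. K x y * F y \<partial>M)\<^sup>2 * w x \<partial>M)
      \<le> (\<integral>\<^sup>+x. (\<integral>\<^sup>+y. (C * (ennreal (h x) * w x)) * (K x y * G y) \<partial>M) \<partial>M)"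
  proof (intro nn_integral_mono)
    fix x assume x: "x \<in> space M"
    have [measurable]: "K x \<in> borel_measurable M"
      using measurable_Pair2[OF K x] by simp
    have "(\<integral>\<^sup>+y. K x y * F y \<partial>M)\<^sup>2 * w x \<le> (C * ennreal (h x)) * (\<integral>\<^sup>+y. K x y * G y \<partial>M) * w x"
      by (intro mult_right_mono cs x) auto
    also have "\<dots> = (C * (ennreal (h x) * w x)) * (\<integral>\<^sup>+y. K x y * G y \<partial>M)"
      by (simp add: algebra_simps)
    also have "\<dots> = (\<integral>\<^sup>+y. (C * (ennreal (h x) * w x)) * (K x y * G y) \<partial>M)"
      by (intro nn_integral_cmult[symmetric]) measurable
    finally show "(\<integral>\<^sup>+y. K x y * F y \<partial>M)\<^sup>2 * w x \<le> \<dots>" .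
  qed
  also have "\<dots> = (\<integral>\<^sup>+y. (\<integral>\<^sup>+x. (C * (ennreal (h x) * w x)) * (K x y * G y) \<partial>M) \<partial>M)"
    by (rule P.Fubini'[symmetric]) measurable
  also have "\<dots> \<le> (\<integral>\<^sup>+y. C\<^sup>2 * ((F y)\<^sup>2 * w y) \<partial>M)"
  proof (intro nn_integral_mono)
    fix y assume y: "y \<in> space M"
    have [measurable]: "(\<lambda>x. K x y) \<in> borel_measurable M"
      using measurable_Pair1[OF K y] by simp
    have "(\<integral>\<^sup>+x. (C * (ennreal (h x) * w x)) * (K x y * G y) \<partial>M)
        = (\<integral>\<^sup>+x. C * G y * (K x y * (ennreal (h x) * w x)) \<partial>M)"
      by (simp add: algebra_simps)
    also have "\<dots> = C * G y * (\<integral>\<^sup>+x. K x y * (ennreal (h x) * w x) \<partial>M)"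
      by (intro nn_integral_cmult) measurable
    also have "\<dots> \<le> C * G y * (C * (ennreal (h y) * w y))"
      by (intro mult_left_mono col y) auto
    also have "\<dots> = C\<^sup>2 * ((F y)\<^sup>2 * w y) * (ennreal (1 / h y) * ennreal (h y))"
      by (simp add: G_def algebra_simps power2_eq_square)
    also have "ennreal (1 / h y) * ennreal (h y) = 1"
      using h[OF y] by (simp flip: ennreal_mult')
    finally show "(\<integral>\<^sup>+x. (C * (ennreal (h x) * w x)) * (K x y * G y) \<partial>M) \<le> C\<^sup>2 * ((F y)\<^sup>2 * w y)"
      by simp
  qed
  also have "\<dots> = C\<^sup>2 * (\<integral>\<^sup>+y. (F y)\<^sup>2 * w y \<partial>M)"
    by (intro nn_integral_cmult) measurable
  finally show ?thesis .
qed

section \<open>One-dimensional integrals\<close>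

definition rays :: "real measure" where
  "rays = restrict_space lborel {0<..}"

lemma space_rays [simp]: "space rays = {0<..}"
  by (simp add: rays_def space_restrict_space)

lemma borel_measurable_raysI: "f \<in> borel_measurable borel \<Longrightarrow> f \<in> borel_measurable rays"
  unfolding rays_def by (intro measurable_restrict_space1) simp

lemma sigma_finite_rays: "sigma_finite_measure rays"
  unfolding rays_def by (intro sigma_finite_measure_restrict_space) (auto intro: sigma_finite_lborel)

lemma nn_integral_rays: "(\<integral>\<^sup>+x. f x \<partial>rays) = (\<integral>\<^sup>+x. f x * indicator {0<..} x \<partial>lborel)"
  unfolding rays_def by (subst nn_integral_restrict_space) auto

lemma nn_integral_rays_scale:
  fixes f :: "real \<Rightarrow> ennreal"
  assumes "t > 0" and [measurable]: "f \<in> borel_measurable borel"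
  shows "(\<integral>\<^sup>+x. f x \<partial>rays) = (\<integral>\<^sup>+x. ennreal t * f (t * x) \<partial>rays)"
proof -
  have "(\<integral>\<^sup>+x. f x \<partial>rays) = ennreal t * (\<integral>\<^sup>+x. f (t * x) * indicator {0<..} (t * x) \<partial>lborel)"
    unfolding nn_integral_rays using assms by (subst nn_integral_real_affine[of _ t 0]) auto
  also have "\<dots> = ennreal t * (\<integral>\<^sup>+x. f (t * x) * indicator {0<..} x \<partial>lborel)"
    using assms(1) by (auto intro!: arg_cong[of _ _ "(*) _"] nn_integral_cong simp: indicator_def
        zero_less_mult_iff)
  also have "\<dots> = (\<integral>\<^sup>+x. ennreal t * (f (t * x) * indicator {0<..} x) \<partial>lborel)"
    by (intro nn_integral_cmult[symmetric]) measurable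
  finally show ?thesis
    unfolding nn_integral_rays by (simp add: mult.assoc)
qed

lemma nn_integral_inverse_1_plus_square:
  "(\<integral>\<^sup>+x. ennreal (1 / (1 + x\<^sup>2)) \<partial>(lborel :: real measure)) = ennreal pi"
proof -
  have I: "set_integrable lborel (einterval (-\<infinity>) \<infinity>) (\<lambda>x::real. 1 / (1 + x\<^sup>2))"
    "(LBINT x=-\<infinity>..\<infinity>. 1 / (1 + x\<^sup>2)) = pi / 2 - (- (pi / 2))"
  proof -
    have 1: "((arctan \<circ> real_of_ereal) \<longlongrightarrow> - (pi / 2)) (at_right (-\<infinity>))"
      unfolding at_right_MInf filterlim_filtermap[symmetric] comp_def
      by (simp add: filterlim_filtermap tendsto_arctan_at_bot)
    have 2: "((arctan \<circ> real_of_ereal) \<longlongrightarrow> pi / 2) (at_left \<infinity>)"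
      unfolding at_left_PInf comp_def
      by (simp add: filterlim_filtermap tendsto_arctan_at_top)
    have ne: "1 + x\<^sup>2 \<noteq> 0" for x :: real
      by (metis add_nonneg_eq_0_iff zero_le_one zero_le_power2 zero_neq_one)
    note * = interval_integral_FTC_nonneg[OF _ _ _ _ 1 2, of "\<lambda>x. 1 / (1 + x\<^sup>2)"]
    show "set_integrable lborel (einterval (-\<infinity>) \<infinity>) (\<lambda>x::real. 1 / (1 + x\<^sup>2))"
      by (rule *(1)) (auto intro!: derivative_eq_intros continuous_intros simp: ne divide_inverse)
    show "(LBINT x=-\<infinity>..\<infinity>. 1 / (1 + x\<^sup>2)) = pi / 2 - (- (pi / 2))"
      by (rule *(2)) (auto intro!: derivative_eq_intros continuous_intros simp: ne divide_inverse)
  qed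
  have int: "integrable lborel (\<lambda>x::real. 1 / (1 + x\<^sup>2))"
    using I(1) by (simp add: set_integrable_def)
  have "(LBINT x. 1 / (1 + x\<^sup>2)) = pi"
    using I(2) by (simp add: interval_lebesgue_integral_def set_lebesgue_integral_def)
  then show ?thesis
    using nn_integral_eq_integral[OF int] by simp
qed

lemma nn_integral_cauchy_density:
  fixes q t :: real
  assumes "q > 0"
  shows "(\<integral>\<^sup>+x. ennreal (1 / (1 + q * (x - t)\<^sup>2)) \<partial>lborel) = ennreal (pi / sqrt q)"
proof -
  have "(\<integral>\<^sup>+x. ennreal (1 / (1 + q * (x - t)\<^sup>2)) \<partial>lborel)
      = ennreal (1 / sqrt q) * (\<integral>\<^sup>+x. ennreal (1 / (1 + q * (t + 1 / sqrt q * x - t)\<^sup>2)) \<partial>lborel)"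
    using assms by (subst nn_integral_real_affine[of _ "1 / sqrt q" t]) auto
  also have "(\<lambda>x. 1 / (1 + q * (t + 1 / sqrt q * x - t)\<^sup>2)) = (\<lambda>x. 1 / (1 + x\<^sup>2))"
    using assms by (auto simp: power_divide)
  also have "ennreal (1 / sqrt q) * (\<integral>\<^sup>+x. ennreal (1 / (1 + x\<^sup>2)) \<partial>lborel) = ennreal (pi / sqrt q)"
    using assms by (subst nn_integral_inverse_1_plus_square) (simp flip: ennreal_mult')
  finally show ?thesis .
qed

text \<open>Here \<open>\<beta>\<close> stands for a function with a nondegenerate maximum \<open>1\<close> at \<open>1\<close>, so \<open>\<beta>\<^sup>k\<close> has width of order
  \<open>1/\<surd>k\<close> and the factor \<open>\<surd>(k + 1)\<close> keeps the integral bounded. Bernoulli's inequality makes this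
  elementary: \<open>\<beta>\<^sup>k\<close> lies below \<open>2 / (1 + (k + 1) c (x - 1)\<^sup>2)\<close> near \<open>1\<close>, whose integral is a multiple of
  \<open>1 / \<surd>(k + 1)\<close>, and below \<open>2 / (1 + (k + 1) c)\<close> elsewhere.\<close>

lemma nn_integral_concentrated:
  fixes \<beta> w :: "real \<Rightarrow> real" and c W I :: real and k :: nat
  assumes c: "0 < c" "c \<le> 1" and W: "0 \<le> W" and I: "0 \<le> I"
    and [measurable]: "w \<in> borel_measurable borel"
    and near: "\<And>x. x \<in> {1/2..2} \<Longrightarrow> \<beta> x \<le> 1 / (1 + c * (x - 1)\<^sup>2)"
    and far: "\<And>x. x > 0 \<Longrightarrow> x \<notin> {1/2..2} \<Longrightarrow> \<beta> x \<le> 1 / (1 + c)"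
    and \<beta>_nonneg: "\<And>x. x > 0 \<Longrightarrow> 0 \<le> \<beta> x"
    and w_nonneg: "\<And>x. x > 0 \<Longrightarrow> 0 \<le> w x"
    and w_le: "\<And>x. x \<in> {1/2..2} \<Longrightarrow> w x \<le> W"
    and w_int: "(\<integral>\<^sup>+x. ennreal (w x) \<partial>rays) \<le> ennreal I"
  shows "(\<integral>\<^sup>+x. ennreal (sqrt (real k + 1) * \<beta> x ^ k * w x) \<partial>rays)
    \<le> ennreal (2 * W * pi / sqrt c + I / sqrt c)"
proof -
  define n where "n = real k + 1"
  have n: "n > 0" by (simp add: n_def)
  have pow: "\<beta> x ^ k \<le> 2 / (1 + n * c * v)"
    if "0 \<le> \<beta> x" "\<beta> x \<le> 1 / (1 + c * v)" "0 \<le> v" "v \<le> 1" for x v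
  proof -
    have cv: "0 \<le> c * v" "c * v \<le> 1"
      using c that mult_mono[of c 1 v 1] by auto
    have "\<beta> x ^ k \<le> (1 / (1 + c * v)) ^ k"
      using that by (intro power_mono) auto
    also have "\<dots> = 1 / (1 + c * v) ^ k"
      by (simp add: power_divide)
    also have "\<dots> \<le> 1 / (1 + real k * (c * v))"
      using Bernoulli_inequality[of "c * v" k] cv
      by (intro divide_left_mono mult_pos_pos) (auto intro!: add_pos_nonneg)
    also have "\<dots> = 2 / (2 + 2 * real k * (c * v))"
      by (metis distrib_left mult.assoc mult.right_neutral mult_divide_mult_cancel_left_if zero_neq_numeral)
    also have "\<dots> \<le> 2 / (1 + n * c * v)"
    proof (intro divide_left_mono mult_pos_pos)
      have "1 + n * c * v \<le> 2 + real k * (c * v)"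
        using cv by (simp add: n_def algebra_simps)
      also have "\<dots> \<le> 2 + 2 * real k * (c * v)"
        using mult_nonneg_nonneg[of "real k" "c * v"] cv(1) by linarith
      finally show "1 + n * c * v \<le> 2 + 2 * real k * (c * v)" .
      show "0 < 2 + 2 * real k * (c * v)" "0 < 1 + n * c * v"
        using cv n c that by (auto intro!: add_pos_nonneg)
    qed auto
    finally show ?thesis .
  qed
  have "(\<integral>\<^sup>+x. ennreal (sqrt (real k + 1) * \<beta> x ^ k * w x) \<partial>rays)
      \<le> (\<integral>\<^sup>+x. ennreal (2 * W * sqrt n) * ennreal (1 / (1 + n * c * (x - 1)\<^sup>2)) + ennreal (1 / sqrt c)
          * ennreal (w x) \<partial>rays)"
  proof (intro nn_integral_mono)
    fix x assume "x \<in> space rays"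
    then have x: "x > 0" by simp
    have "sqrt n * \<beta> x ^ k * w x \<le> 2 * W * sqrt n * (1 / (1 + n * c * (x - 1)\<^sup>2)) + 1 / sqrt c * w x"
    proof (cases "x \<in> {1/2..2}")
      case True
      then have "\<bar>x - 1\<bar> \<le> 1" by auto
      then have "(x - 1)\<^sup>2 \<le> 1" by (simp add: abs_square_le_1)
      then have "sqrt n * \<beta> x ^ k * w x \<le> sqrt n * (2 / (1 + n * c * (x - 1)\<^sup>2)) * W"
        using True x n near \<beta>_nonneg w_nonneg w_le c
        by (intro mult_mono pow mult_nonneg_nonneg) auto
      also have "\<dots> \<le> \<dots> + 1 / sqrt c * w x"
        using w_nonneg[OF x] c by simp
      finally show ?thesis by (simp add: mult_ac)
    next
      case False
      have "sqrt n * \<beta> x ^ k * w x \<le> sqrt n * (2 / (1 + n * c * 1)) * w x"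
        using False x n far[of x] \<beta>_nonneg[of x] w_nonneg[of x] mult_pos_pos[OF n c(1)]
        by (intro mult_mono pow mult_nonneg_nonneg) auto
      also have "sqrt n * (2 / (1 + n * c * 1)) \<le> 1 / sqrt c"
      proof -
        have "(sqrt (n * c))\<^sup>2 = n * c"
          using n c by simp
        then have "2 * (sqrt n * sqrt c) \<le> 1 + n * c"
          using sum_squares_bound[of 1 "sqrt (n * c)"] by (simp add: real_sqrt_mult)
        then show ?thesis
          using n c by (simp add: field_simps add_pos_pos)
      qed
      then have "sqrt n * (2 / (1 + n * c * 1)) * w x \<le> 1 / sqrt c * w x"
        using w_nonneg[OF x] by (intro mult_right_mono)
      also have "1 / sqrt c * w x \<le> 2 * W * sqrt n * (1 / (1 + n * c * (x - 1)\<^sup>2)) + 1 / sqrt c * w x"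
        using W n c by (simp add: add_nonneg_nonneg)
      finally show ?thesis .
    qed
    then show "ennreal (sqrt (real k + 1) * \<beta> x ^ k * w x)
        \<le> ennreal (2 * W * sqrt n) * ennreal (1 / (1 + n * c * (x - 1)\<^sup>2)) + ennreal (1 / sqrt c)
            * ennreal (w x)"
      using W n c w_nonneg[OF x]
      by (simp add: n_def ennreal_leI flip: ennreal_mult ennreal_plus)
  qed
  also have "\<dots> = ennreal (2 * W * sqrt n) * (\<integral>\<^sup>+x. ennreal (1 / (1 + n * c * (x - 1)\<^sup>2)) \<partial>rays)
      + ennreal (1 / sqrt c) * (\<integral>\<^sup>+x. ennreal (w x) \<partial>rays)"
    by (simp add: nn_integral_add nn_integral_cmult borel_measurable_raysI)
  also have "\<dots> \<le> ennreal (2 * W * sqrt n) * ennreal (pi / sqrt (n * c)) + ennreal (1 / sqrt c) * ennreal I"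
  proof (intro add_mono mult_left_mono w_int)
    have "(\<integral>\<^sup>+x. ennreal (1 / (1 + n * c * (x - 1)\<^sup>2)) \<partial>rays)
        \<le> (\<integral>\<^sup>+x. ennreal (1 / (1 + n * c * (x - 1)\<^sup>2)) \<partial>lborel)"
      unfolding nn_integral_rays by (intro nn_integral_mono) (auto simp: indicator_def)
    then show "(\<integral>\<^sup>+x. ennreal (1 / (1 + n * c * (x - 1)\<^sup>2)) \<partial>rays) \<le> ennreal (pi / sqrt (n * c))"
      using n c by (simp add: nn_integral_cauchy_density)
  qed auto
  also have "\<dots> = ennreal (2 * W * sqrt n * (pi / sqrt (n * c)) + 1 / sqrt c * I)"
    using n c W I by (simp flip: ennreal_mult ennreal_plus)
  also have "2 * W * sqrt n * (pi / sqrt (n * c)) + 1 / sqrt c * I = 2 * W * pi / sqrt c + I / sqrt c"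
    using n c by (simp add: real_sqrt_mult field_simps)
  finally show ?thesis .
qed

text \<open>For \<open>x = \<alpha>\<^sub>\<zeta> / \<alpha>\<^sub>z\<close> the right-hand side is the ratio \<open>Re A / B\<close>. It has its minimum \<open>1\<close> at
  \<open>x = 1\<close>, by the weighted inequality between the means; comparing derivatives shows that it grows
  quadratically away from \<open>1\<close>.\<close>

lemma profile_lower_bound:
  fixes \<gamma> x :: real
  assumes \<gamma>: "\<gamma> > 1" and x: "x > 0"
  defines "c \<equiv> (\<gamma> - 1) / (4 * \<gamma>)"
  shows "x \<le> 2 \<Longrightarrow> 1 + c * (x - 1)\<^sup>2 \<le> ((\<gamma> - 1) * x + x powr (1 - \<gamma>)) / \<gamma>"
    and "x \<ge> 2 \<Longrightarrow> 1 + c \<le> ((\<gamma> - 1) * x + x powr (1 - \<gamma>)) / \<gamma>"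
proof -
  define e where "e x = ((\<gamma> - 1) * x + x powr (1 - \<gamma>)) / \<gamma> - 1" for x :: real
  have c: "c > 0" using \<gamma> by (simp add: c_def)
  have de: "(e has_real_derivative (4 * c) * (1 - y powr - \<gamma>)) (at y)" if "y > 0" for y
    unfolding e_def c_def using that \<gamma>
    by (auto intro!: derivative_eq_intros simp: field_simps)
  have pge: "y powr - \<gamma> \<ge> 1 / y" if "0 < y" "y \<le> 1" for y
    using powr_mono'[of 1 \<gamma> y] that \<gamma>
    by (auto simp: powr_minus_divide divide_simps)
  have ple: "y powr - \<gamma> \<le> 1 / y" if "1 \<le> y" for y
    using powr_mono[of 1 \<gamma> y] that \<gamma> by (auto simp: powr_minus_divide divide_simps)
  define g where "g y = e y - c * (y - 1)\<^sup>2" for y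
  have dg: "(g has_real_derivative (4 * c) * (1 - y powr - \<gamma>) - 2 * c * (y - 1)) (at y)" if "y > 0" for y
    unfolding g_def by (rule derivative_eq_intros de that refl | simp)+
  have g1: "g 1 = 0" using \<gamma> by (simp add: g_def e_def)
  have g_nonneg: "g x \<ge> 0" if "0 < x" "x \<le> 2" for x
  proof (cases "x \<ge> 1")
    case True
    have "g 1 \<le> g x"
    proof (rule DERIV_nonneg_imp_nondecreasing[OF True])
      fix y assume y: "1 \<le> y" "y \<le> x"
      have "(y - 1) / 2 \<le> 1 - 1 / y"
        using y that mult_nonneg_nonneg[of "y - 1" "2 - y"] by (simp add: field_simps)
      then have "(y - 1) / 2 \<le> 1 - y powr - \<gamma>" using ple[of y] y by linarith
      then have "4 * c * ((y - 1) / 2) \<le> 4 * c * (1 - y powr - \<gamma>)"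
        using c by (intro mult_left_mono) auto
      then show "\<exists>d. (g has_real_derivative d) (at y) \<and> 0 \<le> d"
        using dg[of y] y by (intro exI conjI) auto
    qed
    then show ?thesis by (simp add: g1)
  next
    case False
    have "g 1 \<le> g x"
    proof (rule DERIV_nonpos_imp_nonincreasing[of x 1 g])
      fix y assume y: "x \<le> y" "y \<le> 1"
      have "1 - 1 / y \<le> (y - 1)"
        using y that mult_nonneg_nonneg[of "1 - y" "1 - y"] by (simp add: field_simps)
      then have "1 - y powr - \<gamma> \<le> y - 1" using pge[of y] y that by linarith
      then have "4 * c * (1 - y powr - \<gamma>) \<le> 4 * c * (y - 1)"
        using c by (intro mult_left_mono) auto
      moreover have "4 * c * (y - 1) \<le> 2 * c * (y - 1)"
        using mult_nonneg_nonpos[of c "y - 1"] c y by linarith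
      ultimately have "4 * c * (1 - y powr - \<gamma>) \<le> 2 * c * (y - 1)" by linarith
      then show "\<exists>d. (g has_real_derivative d) (at y) \<and> d \<le> 0"
        using dg[of y] y that by (intro exI conjI) auto
    qed (use False in auto)
    then show ?thesis by (simp add: g1)
  qed
  show "1 + c * (x - 1)\<^sup>2 \<le> ((\<gamma> - 1) * x + x powr (1 - \<gamma>)) / \<gamma>" if "x \<le> 2"
    using g_nonneg[of x] that x by (simp add: g_def e_def)
  show "1 + c \<le> ((\<gamma> - 1) * x + x powr (1 - \<gamma>)) / \<gamma>" if "x \<ge> 2"
  proof -
    have "e 2 \<le> e x"
    proof (rule DERIV_nonneg_imp_nondecreasing[OF that])
      fix y assume y: "2 \<le> y" "y \<le> x"
      have "1 / y \<le> 1" using y by simp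
      then have "y powr - \<gamma> \<le> 1" using ple[of y] y by linarith
      then show "\<exists>d. (e has_real_derivative d) (at y) \<and> 0 \<le> d"
        using de[of y] y c by (intro exI conjI) auto
    qed
    then show ?thesis
      using g_nonneg[of 2] by (simp add: g_def e_def)
  qed
qed

text \<open>The two integrals of the Schur test run over \<open>x = \<alpha>\<^sub>\<zeta> / \<alpha>\<^sub>z\<close> and over its inverse, so the growth
  is needed in both variables. The constant is a quarter of the previous one because
  \<open>(1/x - 1)\<^sup>2 \<le> 4 (x - 1)\<^sup>2\<close> on \<open>[1/2, 2]\<close> and \<open>(x - 1)\<^sup>2 \<ge> 1/4\<close> below \<open>1/2\<close>.\<close>

lemma profile_near_far:
  fixes \<gamma> x :: real
  assumes \<gamma>: "\<gamma> > 1" and x: "x > 0"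
  defines "c \<equiv> (\<gamma> - 1) / (16 * \<gamma>)"
    and "b \<equiv> \<gamma> * x powr (\<gamma> - 1) / ((\<gamma> - 1) * x powr \<gamma> + 1)"
  shows "x \<in> {1/2..2} \<Longrightarrow> b \<le> 1 / (1 + c * (x - 1)\<^sup>2)"
    and "x \<in> {1/2..2} \<Longrightarrow> b \<le> 1 / (1 + c * (1 / x - 1)\<^sup>2)"
    and "x \<notin> {1/2..2} \<Longrightarrow> b \<le> 1 / (1 + c)"
proof -
  define E where "E = ((\<gamma> - 1) * x + x powr (1 - \<gamma>)) / \<gamma>"
  define c0 where "c0 = (\<gamma> - 1) / (4 * \<gamma>)"
  have c: "c = c0 / 4" "c0 > 0" using \<gamma> by (auto simp: c_def c0_def)
  have Epos: "E > 0" unfolding E_def using \<gamma> x by (auto intro!: divide_pos_pos add_pos_pos)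
  have b: "b = 1 / E"
  proof -
    have "x powr (\<gamma> - 1) * x powr (1 - \<gamma>) = 1" "x powr (\<gamma> - 1) * x = x powr \<gamma>"
      using x by (simp_all add: powr_add[symmetric] powr_mult_base mult.commute)
    then have "x powr (\<gamma> - 1) * ((\<gamma> - 1) * x + x powr (1 - \<gamma>)) = (\<gamma> - 1) * x powr \<gamma> + 1"
      by (metis (no_types, opaque_lifting) distrib_left mult.left_commute)
    moreover have "\<gamma> * E = (\<gamma> - 1) * x + x powr (1 - \<gamma>)"
      unfolding E_def using \<gamma> by simp
    ultimately have "(\<gamma> - 1) * x powr \<gamma> + 1 = \<gamma> * x powr (\<gamma> - 1) * E"
      by (metis mult.assoc mult.commute)
    then show ?thesis unfolding b_def using \<gamma> x Epos by simp
  qed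
  have bl: "b \<le> 1 / q" if "q > 0" "q \<le> E" for q
    unfolding b using that by (intro divide_left_mono) auto
  note lb = profile_lower_bound[OF \<gamma> x, folded E_def c0_def]
  show "b \<le> 1 / (1 + c * (x - 1)\<^sup>2)" if "x \<in> {1/2..2}"
  proof (rule bl)
    have "c * (x - 1)\<^sup>2 \<le> c0 * (x - 1)\<^sup>2" using c by (intro mult_right_mono) auto
    then show "1 + c * (x - 1)\<^sup>2 \<le> E" using lb(1) that by auto
  qed (use c in \<open>auto intro!: add_pos_nonneg\<close>)
  show "b \<le> 1 / (1 + c * (1 / x - 1)\<^sup>2)" if "x \<in> {1/2..2}"
  proof (rule bl)
    have "(1 / x - 1)\<^sup>2 = (1 / x)\<^sup>2 * (x - 1)\<^sup>2"
      using x by (simp add: field_simps power2_eq_square)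
    also have "\<dots> \<le> 2\<^sup>2 * (x - 1)\<^sup>2"
      using that x by (intro mult_right_mono power_mono) (auto simp: field_simps)
    finally have "c * (1 / x - 1)\<^sup>2 \<le> c * (2\<^sup>2 * (x - 1)\<^sup>2)"
      using c by (intro mult_left_mono) auto
    also have "\<dots> = c0 * (x - 1)\<^sup>2" unfolding c by simp
    finally have "c * (1 / x - 1)\<^sup>2 \<le> c0 * (x - 1)\<^sup>2" .
    then show "1 + c * (1 / x - 1)\<^sup>2 \<le> E" using lb(1) that by auto
  qed (use c in \<open>auto intro!: add_pos_nonneg\<close>)
  show "b \<le> 1 / (1 + c)" if "x \<notin> {1/2..2}"
  proof (rule bl)
    show "1 + c \<le> E"
    proof (cases "x > 2")
      case True
      then show ?thesis using lb(2) c by auto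
    next
      case False
      then have "x < 1/2" using that by auto
      then have "(1/2)\<^sup>2 \<le> (1 - x)\<^sup>2" by (intro power_mono) auto
      then have "1/4 \<le> (x - 1)\<^sup>2" by (simp add: power2_commute power_divide)
      then have "c0 * (1/4) \<le> c0 * (x - 1)\<^sup>2" using c by (intro mult_left_mono) auto
      then have "c \<le> c0 * (x - 1)\<^sup>2" using c by linarith
      then show ?thesis using lb(1) False by auto
    qed
  qed (use c in auto)
qed

lemma powr_le_endpoints:
  fixes a b p x :: real
  assumes "0 < a" "x \<in> {a..b}"
  shows "x powr p \<le> a powr p + b powr p"
proof (cases "p \<ge> 0")
  case True
  then have "x powr p \<le> b powr p" using assms by (intro powr_mono2) auto
  then show ?thesis by (simp add: add_increasing)
next
  case False
  then have "x powr p \<le> a powr p" using assms by (intro powr_mono2') auto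
  then show ?thesis by (simp add: add_increasing2)
qed

text \<open>The two hypotheses are convergence at \<open>0\<close> and at \<open>\<infinity>\<close>. Through them the
  exponent of the measure enters the proof of boundedness.\<close>

lemma nn_integral_two_powers:
  fixes a \<gamma> :: real
  assumes "-1 < a" "a < \<gamma> - 1"
  obtains I where "0 \<le> I"
    "(\<integral>\<^sup>+x. ennreal (if x \<le> 1 then x powr a else x powr (a - \<gamma>)) \<partial>rays) \<le> ennreal I"
proof -
  have 1: "(\<integral>\<^sup>+x. ennreal (x powr a) * indicator {0..1} x \<partial>lborel) = ennreal (1 / (a + 1))"
    using nn_integral_has_integral_lebesgue'[OF _ has_integral_powr_from_0[of a 1]] assms by simp
  have 2: "(\<integral>\<^sup>+x. ennreal (x powr (a - \<gamma>)) * indicator {1..} x \<partial>lborel) = ennreal (- 1 / (a - \<gamma> + 1))"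
    using nn_integral_has_integral_lebesgue'[OF _ has_integral_powr_to_inf[of "a - \<gamma>" 1]] assms by simp
  have "(\<integral>\<^sup>+x. ennreal (if x \<le> 1 then x powr a else x powr (a - \<gamma>)) \<partial>rays)
      \<le> (\<integral>\<^sup>+x. ennreal (x powr a) * indicator {0..1} x + ennreal (x powr (a - \<gamma>)) * indicator {1..} x \<partial>lborel)"
    unfolding nn_integral_rays by (intro nn_integral_mono) (auto simp: indicator_def)
  also have "\<dots> = ennreal (1 / (a + 1)) + ennreal (- 1 / (a - \<gamma> + 1))"
    by (subst nn_integral_add) (auto simp: 1 2)
  also have "\<dots> = ennreal (1 / (a + 1) + - 1 / (a - \<gamma> + 1))"
    using assms by (intro ennreal_plus[symmetric]) (auto simp: zero_le_divide_iff)
  finally show ?thesis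
    using assms by (intro that[of "1 / (a + 1) + - 1 / (a - \<gamma> + 1)"] add_nonneg_nonneg)
      (simp_all only: zero_le_divide_iff, auto)
qed

section \<open>The radial kernels and their bound\<close>

definition halfplane :: "(real \<times> real) measure" where
  "halfplane = lborel \<Otimes>\<^sub>M rays"

lemma space_halfplane [simp]: "space halfplane = UNIV \<times> {0<..}"
  by (simp add: halfplane_def space_pair_measure)

lemma pair_sigma_finite_lborel_rays: "pair_sigma_finite (lborel :: real measure) rays"
  by (intro pair_sigma_finite.intro sigma_finite_rays sigma_finite_lborel)

lemma sigma_finite_halfplane: "sigma_finite_measure halfplane"
proof -
  interpret pair_sigma_finite "lborel :: real measure" rays
    by (rule pair_sigma_finite_lborel_rays)
  show ?thesis unfolding halfplane_def by unfold_locales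
qed

lemma measurable_fst_halfplane [measurable (raw)]:
  "f \<in> M \<rightarrow>\<^sub>M halfplane \<Longrightarrow> (\<lambda>x. fst (f x)) \<in> borel_measurable M"
  unfolding halfplane_def
  using measurable_compose[OF _ measurable_fst, of f M lborel rays] by simp

lemma measurable_snd_halfplane [measurable (raw)]:
  "f \<in> M \<rightarrow>\<^sub>M halfplane \<Longrightarrow> (\<lambda>x. snd (f x)) \<in> borel_measurable M"
  unfolding halfplane_def
  by (rule measurable_compose[OF measurable_compose[OF _ measurable_snd] borel_measurable_raysI[of "\<lambda>x. x"]])
     auto

lemma nn_integral_halfplane:
  assumes "f \<in> borel_measurable halfplane"
  shows "(\<integral>\<^sup>+x. f x \<partial>halfplane) = (\<integral>\<^sup>+\<alpha>. \<integral>\<^sup>+s. f (s, \<alpha>) \<partial>lborel \<partial>rays)"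
proof -
  interpret pair_sigma_finite "lborel :: real measure" rays
    by (rule pair_sigma_finite_lborel_rays)
  show ?thesis using nn_integral_snd[of f] assms unfolding halfplane_def by simp
qed

text \<open>The kernel of the \<open>k\<close>-th term with respect to \<open>ds d\<alpha>\<close>, normalizing factor and density of \<open>\<sigma>\<close>
  included; a point of the half plane is a pair \<open>(s, \<alpha>)\<close>.\<close>

definition leray_kernel :: "real \<Rightarrow> nat \<Rightarrow> real \<times> real \<Rightarrow> real \<times> real \<Rightarrow> complex" where
  "leray_kernel \<gamma> k z \<zeta> =
     of_real (\<gamma>\<^sup>2 * (real k + 1) / (2 * pi)) *
     (of_real (leray_B \<gamma> (snd z) (snd \<zeta>)) ^ k / leray_A \<gamma> (fst z) (snd z) (fst \<zeta>) (snd \<zeta>) ^ (k + 2)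
      * of_real (snd \<zeta> powr (\<gamma> - 1)))"

lemma measurable_Complex [measurable (raw)]:
  assumes [measurable]: "f \<in> borel_measurable M" "g \<in> borel_measurable M"
  shows "(\<lambda>x. Complex (f x) (g x)) \<in> borel_measurable M"
  unfolding Complex_eq by measurable

lemma measurable_leray_kernel [measurable (raw)]:
  assumes [measurable]: "f \<in> M \<rightarrow>\<^sub>M halfplane" "g \<in> M \<rightarrow>\<^sub>M halfplane"
  shows "(\<lambda>x. leray_kernel \<gamma> k (f x) (g x)) \<in> borel_measurable M"
  unfolding leray_kernel_def leray_A_def leray_B_def by measurable

lemma measurable_leray_kernel_Pair [measurable (raw)]:
  assumes [measurable]: "a \<in> borel_measurable M" "b \<in> borel_measurable M" "c \<in> borel_measurable M" "d
      \<in> borel_measurable M"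
  shows "(\<lambda>x. leray_kernel \<gamma> k (a x, b x) (c x, d x)) \<in> borel_measurable M"
  unfolding leray_kernel_def leray_A_def leray_B_def fst_conv snd_conv by measurable

text \<open>By Bernoulli's inequality, \<open>(1 + v)\<^bsup>(k+2)/2\<^esup> \<ge> 1 + v (k + 1) / 2\<close>, which reduces the integral to
  that of a Cauchy density without losing the decay \<open>1 / \<surd>(k + 1)\<close>.\<close>

lemma nn_integral_inverse_cmod_power:
  fixes a t :: real
  assumes a: "a > 0"
  shows "(\<integral>\<^sup>+s. ennreal (1 / cmod (Complex a (s - t)) ^ (k + 2)) \<partial>lborel)
    \<le> ennreal (pi * sqrt 2 / (sqrt (real k + 1) * a ^ (k + 1)))"
proof -
  define q where "q = (real k + 1) / (2 * a\<^sup>2)"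
  have q: "q > 0" using a by (simp add: q_def)
  have "(\<integral>\<^sup>+s. ennreal (1 / cmod (Complex a (s - t)) ^ (k + 2)) \<partial>lborel)
      \<le> (\<integral>\<^sup>+s. ennreal (1 / a ^ (k + 2)) * ennreal (1 / (1 + q * (s - t)\<^sup>2)) \<partial>lborel)"
  proof (intro nn_integral_mono)
    fix s :: real
    define v where "v = ((s - t) / a)\<^sup>2"
    define y where "y = sqrt (1 + v)"
    have v: "v \<ge> 0" by (simp add: v_def)
    have "cmod (Complex a (s - t)) = sqrt (a\<^sup>2 * (1 + v))"
      using a by (simp add: cmod_def v_def algebra_simps power_divide)
    also have "\<dots> = a * y"
      using a by (simp add: y_def real_sqrt_mult)
    finally have cm: "cmod (Complex a (s - t)) = a * y" .
    have "1 + q * (s - t)\<^sup>2 = 1 + (real k + 1) / 2 * v"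
      by (simp add: q_def v_def power_divide)
    \<comment> \<open>rounding the exponent \<open>(k + 2) / 2\<close> down to an integer keeps at least \<open>(k + 1) / 2\<close>\<close>
    also have "\<dots> \<le> 1 + real ((k + 2) div 2) * v"
    proof -
      have "k + 1 \<le> 2 * ((k + 2) div 2)" by simp
      then have "real (k + 1) \<le> real (2 * ((k + 2) div 2))" by (rule of_nat_mono)
      then show ?thesis using v by (intro add_left_mono mult_right_mono) auto
    qed
    also have "\<dots> \<le> (1 + v) ^ ((k + 2) div 2)"
      using v by (intro Bernoulli_inequality) auto
    also have "\<dots> = y ^ (2 * ((k + 2) div 2))"
      using v by (simp add: y_def power_mult)
    also have "\<dots> \<le> y ^ (k + 2)"
      using v by (intro power_increasing) (auto simp: y_def)
    finally have "a ^ (k + 2) * (1 + q * (s - t)\<^sup>2) \<le> cmod (Complex a (s - t)) ^ (k + 2)"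
      unfolding cm power_mult_distrib using a by (intro mult_left_mono) auto
    moreover have "0 < a ^ (k + 2) * (1 + q * (s - t)\<^sup>2)"
      using a q by (intro mult_pos_pos add_pos_nonneg) auto
    moreover from calculation have "0 < cmod (Complex a (s - t)) ^ (k + 2)" by linarith
    ultimately have "1 / cmod (Complex a (s - t)) ^ (k + 2) \<le> 1 / (a ^ (k + 2) * (1 + q * (s - t)\<^sup>2))"
      by (intro divide_left_mono mult_pos_pos[of _ "cmod _ ^ _"]) auto
    then show "ennreal (1 / cmod (Complex a (s - t)) ^ (k + 2))
        \<le> ennreal (1 / a ^ (k + 2)) * ennreal (1 / (1 + q * (s - t)\<^sup>2))"
      using a q by (subst ennreal_mult[symmetric]) (auto intro!: ennreal_leI)
  qed
  also have "\<dots> = ennreal (1 / a ^ (k + 2)) * ennreal (pi / sqrt q)"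
    by (subst nn_integral_cmult) (auto simp: nn_integral_cauchy_density q)
  also have "\<dots> = ennreal (1 / a ^ (k + 2) * (pi / sqrt q))"
    using a q by (subst ennreal_mult[symmetric]) auto
  also have "1 / a ^ (k + 2) * (pi / sqrt q) = pi * sqrt 2 / (sqrt (real k + 1) * a ^ (k + 1))"
    using a by (simp add: q_def real_sqrt_divide real_sqrt_mult field_simps)
  finally show ?thesis .
qed

text \<open>An upper bound for \<open>|K|\<close> integrated over \<open>s\<close>. It is homogeneous of degree \<open>-1\<close> in the two radii,
  the degree at which a kernel on the ray can be bounded between equally weighted \<open>L\<^sup>2\<close> spaces.\<close>

definition kernel_profile :: "real \<Rightarrow> nat \<Rightarrow> real \<Rightarrow> real \<Rightarrow> real" where
  "kernel_profile \<gamma> k \<alpha>\<^sub>z \<alpha>\<^sub>\<zeta> =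
     \<gamma>\<^sup>2 / sqrt 2 * sqrt (real k + 1) *
       (leray_B \<gamma> \<alpha>\<^sub>z \<alpha>\<^sub>\<zeta> / ((\<gamma> - 1) * \<alpha>\<^sub>\<zeta> powr \<gamma> + \<alpha>\<^sub>z powr \<gamma>)) ^ k
       * \<alpha>\<^sub>\<zeta> powr (\<gamma> - 1) / ((\<gamma> - 1) * \<alpha>\<^sub>\<zeta> powr \<gamma> + \<alpha>\<^sub>z powr \<gamma>)"

lemma nn_integral_leray_kernel_s:
  assumes \<gamma>: "\<gamma> > 1" and pos: "\<alpha>\<^sub>z > 0" "\<alpha>\<^sub>\<zeta> > 0"
  shows "(\<integral>\<^sup>+s. ennreal (cmod (leray_kernel \<gamma> k (t, \<alpha>\<^sub>z) (s, \<alpha>\<^sub>\<zeta>))) \<partial>lborel)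
      \<le> ennreal (kernel_profile \<gamma> k \<alpha>\<^sub>z \<alpha>\<^sub>\<zeta>)"
    and "(\<integral>\<^sup>+s. ennreal (cmod (leray_kernel \<gamma> k (s, \<alpha>\<^sub>z) (t, \<alpha>\<^sub>\<zeta>))) \<partial>lborel)
        \<le> ennreal (kernel_profile \<gamma> k \<alpha>\<^sub>z \<alpha>\<^sub>\<zeta>)"
proof -
  define a where "a = (\<gamma> - 1) * \<alpha>\<^sub>\<zeta> powr \<gamma> + \<alpha>\<^sub>z powr \<gamma>"
  define B where "B = leray_B \<gamma> \<alpha>\<^sub>z \<alpha>\<^sub>\<zeta>"
  define D where "D = \<gamma>\<^sup>2 * (real k + 1) / (2 * pi) * B ^ k * \<alpha>\<^sub>\<zeta> powr (\<gamma> - 1)"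
  have a: "a > 0" unfolding a_def using \<gamma> pos by (intro add_pos_pos mult_pos_pos) auto
  have B: "B \<ge> 0" unfolding B_def leray_B_def using \<gamma> pos by simp
  have D: "D \<ge> 0" unfolding D_def using \<gamma> pos B by simp
  have bound: "(\<integral>\<^sup>+s. ennreal (D * (1 / cmod (Complex a (s - t)) ^ (k + 2))) \<partial>lborel)
      \<le> ennreal (kernel_profile \<gamma> k \<alpha>\<^sub>z \<alpha>\<^sub>\<zeta>)"
  proof -
    have "(\<integral>\<^sup>+s. ennreal (D * (1 / cmod (Complex a (s - t)) ^ (k + 2))) \<partial>lborel)
       = (\<integral>\<^sup>+s. ennreal D * ennreal (1 / cmod (Complex a (s - t)) ^ (k + 2)) \<partial>lborel)"
      using D by (intro nn_integral_cong ennreal_mult) auto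
    also have "\<dots> = ennreal D * (\<integral>\<^sup>+s. ennreal (1 / cmod (Complex a (s - t)) ^ (k + 2)) \<partial>lborel)"
      by (intro nn_integral_cmult) measurable
    also have "\<dots> \<le> ennreal D * ennreal (pi * sqrt 2 / (sqrt (real k + 1) * a ^ (k + 1)))"
      by (intro mult_left_mono nn_integral_inverse_cmod_power a) auto
    also have "\<dots> = ennreal (D * (pi * sqrt 2 / (sqrt (real k + 1) * a ^ (k + 1))))"
      using D a by (intro ennreal_mult[symmetric]) auto
    also have "D * (pi * sqrt 2 / (sqrt (real k + 1) * a ^ (k + 1))) = kernel_profile \<gamma> k \<alpha>\<^sub>z \<alpha>\<^sub>\<zeta>"
    proof -
      define n where "n = real k + 1"
      have n: "n > 0" by (simp add: n_def)
      have 1: "n / sqrt n = sqrt n" using n by (simp add: real_div_sqrt)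
      have 2: "sqrt 2 / 2 = 1 / sqrt (2::real)" by (simp add: field_simps)
      have "D * (pi * sqrt 2 / (sqrt n * a ^ (k + 1)))
          = \<gamma>\<^sup>2 * (sqrt 2 / 2) * (n / sqrt n) * (B ^ k / a ^ k) * \<alpha>\<^sub>\<zeta> powr (\<gamma> - 1) / a"
        unfolding D_def n_def[symmetric] using a by (simp add: field_simps)
      also have "\<dots> = \<gamma>\<^sup>2 / sqrt 2 * sqrt n * (B / a) ^ k * \<alpha>\<^sub>\<zeta> powr (\<gamma> - 1) / a"
        unfolding 1 2 by (simp add: power_divide)
      finally show ?thesis
        by (simp add: kernel_profile_def a_def B_def n_def)
    qed
    finally show ?thesis .
  qed
  have "cmod (leray_kernel \<gamma> k (t, \<alpha>\<^sub>z) (s, \<alpha>\<^sub>\<zeta>)) = D * (1 / cmod (Complex a (s - t)) ^ (k + 2))" for s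
    unfolding leray_kernel_def leray_A_def D_def a_def[symmetric] B_def[symmetric] fst_conv snd_conv
    using \<gamma> B by (simp only: norm_mult norm_divide norm_power norm_of_real) simp
  then show "(\<integral>\<^sup>+s. ennreal (cmod (leray_kernel \<gamma> k (t, \<alpha>\<^sub>z) (s, \<alpha>\<^sub>\<zeta>))) \<partial>lborel)
      \<le> ennreal (kernel_profile \<gamma> k \<alpha>\<^sub>z \<alpha>\<^sub>\<zeta>)"
    using bound by simp
  have "cmod (Complex a (t - s)) = cmod (Complex a (s - t))" for s
    by (simp add: cmod_def power2_commute)
  then have "cmod (leray_kernel \<gamma> k (s, \<alpha>\<^sub>z) (t, \<alpha>\<^sub>\<zeta>)) = D * (1 / cmod (Complex a (s - t)) ^ (k + 2))" for s
    unfolding leray_kernel_def leray_A_def D_def a_def[symmetric] B_def[symmetric] fst_conv snd_conv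
    using \<gamma> B by (simp only: norm_mult norm_divide norm_power norm_of_real) simp
  then show "(\<integral>\<^sup>+s. ennreal (cmod (leray_kernel \<gamma> k (s, \<alpha>\<^sub>z) (t, \<alpha>\<^sub>\<zeta>))) \<partial>lborel)
      \<le> ennreal (kernel_profile \<gamma> k \<alpha>\<^sub>z \<alpha>\<^sub>\<zeta>)"
    using bound by simp
qed

lemma kernel_profile_nonneg:
  assumes "\<gamma> > 1" "\<alpha>\<^sub>z > 0" "\<alpha>\<^sub>\<zeta> > 0"
  shows "kernel_profile \<gamma> k \<alpha>\<^sub>z \<alpha>\<^sub>\<zeta> \<ge> 0"
  using assms unfolding kernel_profile_def leray_B_def by (auto intro!: mult_nonneg_nonneg
      divide_nonneg_nonneg add_nonneg_nonneg)

lemma kernel_profile_scale: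
  assumes \<gamma>: "\<gamma> > 1" and pos: "t > 0" "x > 0"
  shows "t * (kernel_profile \<gamma> k t (t * x) * (t * x) powr - p)
      = \<gamma>\<^sup>2 / sqrt 2 * t powr - p *
        (sqrt (real k + 1) * (\<gamma> * x powr (\<gamma> - 1) / ((\<gamma> - 1) * x powr \<gamma> + 1)) ^ k
         * (x powr (\<gamma> - 1 - p) / ((\<gamma> - 1) * x powr \<gamma> + 1)))"
    and "t * (kernel_profile \<gamma> k (t * x) t * (t * x) powr q)
      = \<gamma>\<^sup>2 / sqrt 2 * t powr q *
        (sqrt (real k + 1) * (\<gamma> * x / ((\<gamma> - 1) + x powr \<gamma>)) ^ k
         * (x powr q / ((\<gamma> - 1) + x powr \<gamma>)))"
proof -
  have tt: "t * t powr (\<gamma> - 1) = t powr \<gamma>"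
    using pos by (simp add: powr_mult_base)
  define d where "d = (\<gamma> - 1) * x powr \<gamma> + 1"
  have d: "(\<gamma> - 1) * (t * x) powr \<gamma> + t powr \<gamma> = t powr \<gamma> * d"
    using pos by (simp add: d_def powr_mult algebra_simps)
  have B: "leray_B \<gamma> t (t * x) = t powr \<gamma> * (\<gamma> * x powr (\<gamma> - 1))"
    using pos tt by (simp add: leray_B_def powr_mult algebra_simps)
  have x: "x powr (\<gamma> - 1) * x powr - p = x powr (\<gamma> - 1 - p)"
    by (simp add: powr_add[symmetric])
  have "t * (kernel_profile \<gamma> k t (t * x) * (t * x) powr - p)
      = \<gamma>\<^sup>2 / sqrt 2 * sqrt (real k + 1) * (\<gamma> * x powr (\<gamma> - 1) / d) ^ k *
        ((t * t powr (\<gamma> - 1)) * (x powr (\<gamma> - 1) * x powr - p) * t powr - p / (t powr \<gamma> * d))"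
    unfolding kernel_profile_def d B using pos by (simp add: powr_mult mult_ac)
  then show "t * (kernel_profile \<gamma> k t (t * x) * (t * x) powr - p)
      = \<gamma>\<^sup>2 / sqrt 2 * t powr - p *
        (sqrt (real k + 1) * (\<gamma> * x powr (\<gamma> - 1) / ((\<gamma> - 1) * x powr \<gamma> + 1)) ^ k
         * (x powr (\<gamma> - 1 - p) / ((\<gamma> - 1) * x powr \<gamma> + 1)))"
    unfolding x tt d_def[symmetric] using pos by (simp add: mult_ac)
  define d' where "d' = (\<gamma> - 1) + x powr \<gamma>"
  have d': "(\<gamma> - 1) * t powr \<gamma> + (t * x) powr \<gamma> = t powr \<gamma> * d'"
    using pos by (simp add: d'_def powr_mult algebra_simps)
  have B': "leray_B \<gamma> (t * x) t = t powr \<gamma> * (\<gamma> * x)"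
    using pos tt by (simp add: leray_B_def powr_mult algebra_simps)
  have "t * (kernel_profile \<gamma> k (t * x) t * (t * x) powr q)
      = \<gamma>\<^sup>2 / sqrt 2 * sqrt (real k + 1) * (\<gamma> * x / d') ^ k *
        ((t * t powr (\<gamma> - 1)) * x powr q * t powr q / (t powr \<gamma> * d'))"
    unfolding kernel_profile_def d' B' using pos by (simp add: powr_mult mult_ac)
  then show "t * (kernel_profile \<gamma> k (t * x) t * (t * x) powr q)
      = \<gamma>\<^sup>2 / sqrt 2 * t powr q *
        (sqrt (real k + 1) * (\<gamma> * x / ((\<gamma> - 1) + x powr \<gamma>)) ^ k
         * (x powr q / ((\<gamma> - 1) + x powr \<gamma>)))"
    unfolding tt d'_def[symmetric] using pos by (simp add: mult_ac)
qed

text \<open>The first alternative is the integral over \<open>\<alpha>\<^sub>\<zeta>\<close> in units of \<open>\<alpha>\<^sub>z\<close>, the second the integral over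
  \<open>\<alpha>\<^sub>z\<close> in units of \<open>\<alpha>\<^sub>\<zeta>\<close>; the substitution \<open>x \<mapsto> 1/x\<close> turns one \<open>\<beta>\<close> into the other.\<close>

lemma profile_integral_bounded:
  fixes \<gamma> a :: real and \<beta> w :: "real \<Rightarrow> real"
  assumes \<gamma>: "\<gamma> > 1" and a: "-1 < a" "a < \<gamma> - 1"
    and \<beta>w: "\<beta> = (\<lambda>x. \<gamma> * x powr (\<gamma> - 1) / ((\<gamma> - 1) * x powr \<gamma> + 1)) \<and>
            w = (\<lambda>x. x powr a / ((\<gamma> - 1) * x powr \<gamma> + 1))
        \<or> \<beta> = (\<lambda>x. \<gamma> * x / ((\<gamma> - 1) + x powr \<gamma>)) \<and>
            w = (\<lambda>x. x powr a / ((\<gamma> - 1) + x powr \<gamma>))"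
  obtains C :: real where "0 \<le> C"
    "\<And>k. (\<integral>\<^sup>+x. ennreal (sqrt (real k + 1) * \<beta> x ^ k * w x) \<partial>rays) \<le> ennreal C"
proof -
  define c where "c = (\<gamma> - 1) / (16 * \<gamma>)"
  have c: "0 < c" "c \<le> 1" using \<gamma> by (auto simp: c_def field_simps)
  \<comment> \<open>the denominators of \<open>w\<close> are sums of a constant and a power; either may be dropped at the cost of
      a factor \<open>1\<close> or \<open>1 / (\<gamma> - 1)\<close>\<close>
  define M where "M = 1 + 1 / (\<gamma> - 1)"
  have M: "M \<ge> 1" "M \<ge> 1 / (\<gamma> - 1)" using \<gamma> by (auto simp: M_def)
  obtain I where I: "0 \<le> I"
    "(\<integral>\<^sup>+x. ennreal (if x \<le> 1 then x powr a else x powr (a - \<gamma>)) \<partial>rays) \<le> ennreal I"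
    using nn_integral_two_powers[OF a] by blast
  have inv: "\<gamma> * x / ((\<gamma> - 1) + x powr \<gamma>)
      = \<gamma> * (1 / x) powr (\<gamma> - 1) / ((\<gamma> - 1) * (1 / x) powr \<gamma> + 1)" if "x > 0" for x
  proof -
    have "(1 / x) powr \<gamma> = 1 / x powr \<gamma>" "(1 / x) powr (\<gamma> - 1) = x / x powr \<gamma>"
      using that by (simp_all add: powr_divide powr_diff)
    moreover have "(\<gamma> - 1) * (1 / x powr \<gamma>) + 1 = ((\<gamma> - 1) + x powr \<gamma>) / x powr \<gamma>"
      using that by (simp add: add_divide_distrib)
    ultimately show ?thesis using that by simp
  qed
  have near: "\<beta> x \<le> 1 / (1 + c * (x - 1)\<^sup>2)" if "x \<in> {1/2..2}" for x
    using \<beta>w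
  proof
    assume "\<beta> = (\<lambda>x. \<gamma> * x powr (\<gamma> - 1) / ((\<gamma> - 1) * x powr \<gamma> + 1)) \<and>
            w = (\<lambda>x. x powr a / ((\<gamma> - 1) * x powr \<gamma> + 1))"
    then show ?thesis
      using profile_near_far(1)[OF \<gamma>, of x] that by (simp add: c_def)
  next
    assume *: "\<beta> = (\<lambda>x. \<gamma> * x / ((\<gamma> - 1) + x powr \<gamma>)) \<and>
            w = (\<lambda>x. x powr a / ((\<gamma> - 1) + x powr \<gamma>))"
    have "1 / x \<in> {1/2..2}" "x > 0" using that by (auto simp: field_simps)
    then show ?thesis
      using profile_near_far(2)[OF \<gamma>, of "1 / x"] * inv[of x] by (simp add: c_def)
  qed
  have far: "\<beta> x \<le> 1 / (1 + c)" if "x > 0" "x \<notin> {1/2..2}" for x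
    using \<beta>w
  proof
    assume "\<beta> = (\<lambda>x. \<gamma> * x powr (\<gamma> - 1) / ((\<gamma> - 1) * x powr \<gamma> + 1)) \<and>
            w = (\<lambda>x. x powr a / ((\<gamma> - 1) * x powr \<gamma> + 1))"
    then show ?thesis
      using profile_near_far(3)[OF \<gamma> that] by (simp add: c_def)
  next
    assume *: "\<beta> = (\<lambda>x. \<gamma> * x / ((\<gamma> - 1) + x powr \<gamma>)) \<and>
            w = (\<lambda>x. x powr a / ((\<gamma> - 1) + x powr \<gamma>))"
    have "1 / x \<notin> {1/2..2}" "1 / x > 0" using that by (auto simp: field_simps)
    then show ?thesis
      using profile_near_far(3)[OF \<gamma>, of "1 / x"] * inv[of x] that by (simp add: c_def)
  qed
  have \<beta>0: "\<beta> x \<ge> 0" if "x > 0" for x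
    using \<beta>w \<gamma> that by (auto intro!: divide_nonneg_nonneg add_nonneg_nonneg)
  have w0: "w x \<ge> 0" if "x > 0" for x
    using \<beta>w \<gamma> that by (auto intro!: divide_nonneg_nonneg add_nonneg_nonneg)
  have w1: "w x \<le> M * x powr a \<and> w x \<le> M * x powr (a - \<gamma>)" if "x > 0" for x
  proof -
    have d: "x powr a / d \<le> M * x powr a \<and> x powr a / d \<le> M * x powr (a - \<gamma>)"
      if d: "e1 \<le> d" "e2 * x powr \<gamma> \<le> d" "0 < e1" "0 < e2" "1 / e1 \<le> M" "1 / e2 \<le> M" for d e1 e2
    proof
      have "x powr a / d \<le> x powr a / e1"
        using d \<open>x > 0\<close> by (intro divide_left_mono mult_pos_pos) auto
      also have "\<dots> \<le> M * x powr a"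
        using mult_right_mono[OF d(5), of "x powr a"] by simp
      finally show "x powr a / d \<le> M * x powr a" .
      have "x powr a / d \<le> x powr a / (e2 * x powr \<gamma>)"
        using d \<open>x > 0\<close> by (intro divide_left_mono mult_pos_pos) auto
      also have "\<dots> = 1 / e2 * x powr (a - \<gamma>)"
        by (simp add: powr_diff)
      also have "\<dots> \<le> M * x powr (a - \<gamma>)"
        using d(6) by (intro mult_right_mono) auto
      finally show "x powr a / d \<le> M * x powr (a - \<gamma>)" .
    qed
    show ?thesis
      using \<beta>w d[of 1 "(\<gamma> - 1) * x powr \<gamma> + 1" "\<gamma> - 1"] d[of "\<gamma> - 1" "(\<gamma> - 1) + x powr \<gamma>" 1] M \<gamma>
      by auto
  qed
  have wm [measurable]: "w \<in> borel_measurable borel"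
    using \<beta>w by (auto simp del: )
  have "(\<integral>\<^sup>+x. ennreal (w x) \<partial>rays) \<le> (\<integral>\<^sup>+x. ennreal M * ennreal (if x
      \<le> 1 then x powr a else x powr (a - \<gamma>)) \<partial>rays)"
    using w1 M \<gamma> by (intro nn_integral_mono) (auto simp: ennreal_mult[symmetric] intro!: ennreal_leI)
  also have "\<dots> \<le> ennreal (M * I)"
    using I M by (subst nn_integral_cmult) (auto intro!: borel_measurable_raysI mult_left_mono simp:
        ennreal_mult)
  finally have wI: "(\<integral>\<^sup>+x. ennreal (w x) \<partial>rays) \<le> ennreal (M * I)" .
  have wW: "w x \<le> M * ((1/2) powr a + 2 powr a)" if x: "x \<in> {1/2..2}" for x
  proof -
    have "w x \<le> M * x powr a" using w1[of x] x by auto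
    also have "\<dots> \<le> M * ((1/2) powr a + 2 powr a)"
      using x M by (intro mult_left_mono powr_le_endpoints) auto
    finally show ?thesis .
  qed
  show ?thesis
  proof (rule that)
    show "0 \<le> 2 * (M * ((1/2) powr a + 2 powr a)) * pi / sqrt c + M * I / sqrt c"
      using M I c by auto
    show "(\<integral>\<^sup>+x. ennreal (sqrt (real k + 1) * \<beta> x ^ k * w x) \<partial>rays)
        \<le> ennreal (2 * (M * ((1/2) powr a + 2 powr a)) * pi / sqrt c + M * I / sqrt c)" for k
      using c M I near far \<beta>0 w0 wW wI
      by (intro nn_integral_concentrated) auto
  qed
qed

lemma nn_integral_halfplane_profile:
  fixes f :: "real \<times> real \<Rightarrow> real" and P G :: "real \<Rightarrow> real" and c e u M :: real
  assumes [measurable]: "f \<in> borel_measurable halfplane" "P \<in> borel_measurable borel" "G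
      \<in> borel_measurable borel"
    and line: "\<And>\<alpha>. \<alpha> > 0 \<Longrightarrow> (\<integral>\<^sup>+s. ennreal (f (s, \<alpha>)) \<partial>lborel) \<le> ennreal (P \<alpha>)"
    and P0: "\<And>\<alpha>. \<alpha> > 0 \<Longrightarrow> 0 \<le> P \<alpha>" and u: "u > 0" and "0 \<le> c" "0 \<le> M"
    and scale: "\<And>x. x > 0 \<Longrightarrow> u * (P (u * x) * (u * x) powr e) = M * u powr e * G x"
    and G: "(\<integral>\<^sup>+x. ennreal (G x) \<partial>rays) \<le> ennreal c"
  shows "(\<integral>\<^sup>+x. ennreal (f x) * ennreal (snd x powr e) \<partial>halfplane) \<le> ennreal (M * c) * ennreal (u powr e)"
proof -
  have "(\<integral>\<^sup>+x. ennreal (f x) * ennreal (snd x powr e) \<partial>halfplane)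
      = (\<integral>\<^sup>+\<alpha>. \<integral>\<^sup>+s. ennreal (f (s, \<alpha>)) * ennreal (\<alpha> powr e) \<partial>lborel \<partial>rays)"
    by (subst nn_integral_halfplane) auto
  also have "\<dots> \<le> (\<integral>\<^sup>+\<alpha>. ennreal (P \<alpha> * \<alpha> powr e) \<partial>rays)"
  proof (intro nn_integral_mono)
    fix \<alpha> assume "\<alpha> \<in> space rays"
    then have \<alpha>: "\<alpha> > 0" by simp
    have "(\<lambda>s. f (s, \<alpha>)) \<in> borel_measurable lborel"
      using measurable_Pair1[of f lborel rays borel \<alpha>] assms(1) \<alpha> by (simp add: halfplane_def)
    then have "(\<integral>\<^sup>+s. ennreal (f (s, \<alpha>)) * ennreal (\<alpha> powr e) \<partial>lborel)
        = (\<integral>\<^sup>+s. ennreal (f (s, \<alpha>)) \<partial>lborel) * ennreal (\<alpha> powr e)"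
      by (intro nn_integral_multc) simp
    also have "\<dots> \<le> ennreal (P \<alpha>) * ennreal (\<alpha> powr e)"
      by (intro mult_right_mono line \<alpha>) auto
    also have "\<dots> = ennreal (P \<alpha> * \<alpha> powr e)"
      using P0[OF \<alpha>] by (simp add: ennreal_mult)
    finally show "(\<integral>\<^sup>+s. ennreal (f (s, \<alpha>)) * ennreal (\<alpha> powr e) \<partial>lborel) \<le> \<dots>" .
  qed
  also have "\<dots> = (\<integral>\<^sup>+x. ennreal u * ennreal (P (u * x) * (u * x) powr e) \<partial>rays)"
    using u by (intro nn_integral_rays_scale) auto
  also have "\<dots> = (\<integral>\<^sup>+x. ennreal (M * u powr e) * ennreal (G x) \<partial>rays)"
    using u \<open>0 \<le> M\<close> by (intro nn_integral_cong) (simp add: ennreal_mult'[symmetric] scale)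
  also have "\<dots> \<le> ennreal (M * u powr e) * ennreal c"
    by (subst nn_integral_cmult, intro borel_measurable_raysI, measurable, intro mult_left_mono G) auto
  also have "\<dots> = ennreal (M * c) * ennreal (u powr e)"
    using \<open>0 \<le> M\<close> \<open>0 \<le> c\<close> by (simp add: ennreal_mult[symmetric] mult_ac)
  finally show ?thesis .
qed

text \<open>The Schur test with the weight \<open>\<alpha>\<^sup>-\<^sup>p\<close>. By homogeneity the two integrals reduce to the exponents
  \<open>\<gamma> - 1 - p\<close> and \<open>r - p\<close>, which have to lie between \<open>-1\<close> and \<open>\<gamma> - 1\<close>: these are the four
  conditions on \<open>p\<close>.\<close>

lemma leray_kernel_schur_bounds:
  fixes \<gamma> r p :: real
  assumes \<gamma>: "\<gamma> > 1" and p: "0 < p" "p < \<gamma>" "r + 1 - \<gamma> < p" "p < r + 1"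
  obtains C :: real where "0 \<le> C"
    "\<And>k z. z \<in> space halfplane \<Longrightarrow>
       (\<integral>\<^sup>+\<zeta>. ennreal (cmod (leray_kernel \<gamma> k z \<zeta>)) * ennreal (snd \<zeta> powr - p) \<partial>halfplane)
         \<le> ennreal C * ennreal (snd z powr - p)"
    "\<And>k \<zeta>. \<zeta> \<in> space halfplane \<Longrightarrow>
       (\<integral>\<^sup>+z. ennreal (cmod (leray_kernel \<gamma> k z \<zeta>)) * ennreal (snd z powr (r - p)) \<partial>halfplane)
         \<le> ennreal C * ennreal (snd \<zeta> powr (r - p))"
proof -
  let ?G1 = "\<lambda>k x. sqrt (real k + 1) * (\<gamma> * x powr (\<gamma> - 1) / ((\<gamma> - 1) * x powr \<gamma> + 1)) ^ k
    * (x powr (\<gamma> - 1 - p) / ((\<gamma> - 1) * x powr \<gamma> + 1))"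
  let ?G2 = "\<lambda>k x. sqrt (real k + 1) * (\<gamma> * x / ((\<gamma> - 1) + x powr \<gamma>)) ^ k
    * (x powr (r - p) / ((\<gamma> - 1) + x powr \<gamma>))"
  obtain C1 where C1: "0 \<le> C1" "\<And>k. (\<integral>\<^sup>+x. ennreal (?G1 k x) \<partial>rays) \<le> ennreal C1"
    using profile_integral_bounded[OF \<gamma>, of "\<gamma> - 1 - p", OF _ _ disjI1, OF _ _ conjI, OF _ _ refl refl] p
        by auto
  obtain C2 where C2: "0 \<le> C2" "\<And>k. (\<integral>\<^sup>+x. ennreal (?G2 k x) \<partial>rays) \<le> ennreal C2"
    using profile_integral_bounded[OF \<gamma>, of "r - p", OF _ _ disjI2, OF _ _ conjI, OF _ _ refl refl] p by auto
  define M where "M = \<gamma>\<^sup>2 / sqrt 2"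
  have M: "M \<ge> 0" by (simp add: M_def)
  have [measurable]: "(\<lambda>x. kernel_profile \<gamma> k (f x) (g x)) \<in> borel_measurable borel"
    if [measurable]: "f \<in> borel_measurable borel" "g \<in> borel_measurable borel" for f g k
    unfolding kernel_profile_def leray_B_def by measurable
  show ?thesis
  proof (rule that[of "M * (C1 + C2)"])
    show "0 \<le> M * (C1 + C2)" using M C1(1) C2(1) by simp
    fix k z assume z: "z \<in> space halfplane"
    obtain t u where zt: "z = (t, u)" "u > 0" using z by (cases z) auto
    have [measurable]: "(\<lambda>_. z) \<in> M \<rightarrow>\<^sub>M halfplane" for M :: "(real \<times> real) measure"
      using z by (rule measurable_const)
    have "(\<integral>\<^sup>+\<zeta>. ennreal (cmod (leray_kernel \<gamma> k z \<zeta>)) * ennreal (snd \<zeta> powr - p) \<partial>halfplane)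
        \<le> ennreal (M * C1) * ennreal (u powr - p)"
      unfolding M_def
      by (rule nn_integral_halfplane_profile[where P = "\<lambda>\<alpha>. kernel_profile \<gamma> k u \<alpha>" and G = "?G1 k"])
         (use zt \<gamma> C1 nn_integral_leray_kernel_s(1)[OF \<gamma> zt(2), where t = t] in
           \<open>auto simp: kernel_profile_nonneg kernel_profile_scale(1)\<close>)
    also have "\<dots> \<le> ennreal (M * (C1 + C2)) * ennreal (u powr - p)"
      using M C1(1) C2(1) by (intro mult_right_mono ennreal_leI mult_left_mono) auto
    finally show "(\<integral>\<^sup>+\<zeta>. ennreal (cmod (leray_kernel \<gamma> k z \<zeta>)) * ennreal (snd \<zeta> powr - p) \<partial>halfplane)
        \<le> ennreal (M * (C1 + C2)) * ennreal (snd z powr - p)" by (simp add: zt)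
  next
    fix k \<zeta> assume \<zeta>: "\<zeta> \<in> space halfplane"
    obtain t u where \<zeta>t: "\<zeta> = (t, u)" "u > 0" using \<zeta> by (cases \<zeta>) auto
    have [measurable]: "(\<lambda>_. \<zeta>) \<in> M \<rightarrow>\<^sub>M halfplane" for M :: "(real \<times> real) measure"
      using \<zeta> by (rule measurable_const)
    have "(\<integral>\<^sup>+z. ennreal (cmod (leray_kernel \<gamma> k z \<zeta>)) * ennreal (snd z powr (r - p)) \<partial>halfplane)
        \<le> ennreal (M * C2) * ennreal (u powr (r - p))"
      unfolding M_def
      by (rule nn_integral_halfplane_profile[where P = "\<lambda>\<alpha>. kernel_profile \<gamma> k \<alpha> u" and G = "?G2 k"])
         (use \<zeta>t \<gamma> C2 nn_integral_leray_kernel_s(2)[OF \<gamma> _ \<zeta>t(2), where t = t] in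
           \<open>auto simp: kernel_profile_nonneg kernel_profile_scale(2)\<close>)
    also have "\<dots> \<le> ennreal (M * (C1 + C2)) * ennreal (u powr (r - p))"
      using M C1(1) C2(1) by (intro mult_right_mono ennreal_leI mult_left_mono) auto
    finally show "(\<integral>\<^sup>+z. ennreal (cmod (leray_kernel \<gamma> k z \<zeta>)) * ennreal (snd z powr (r - p)) \<partial>halfplane)
        \<le> ennreal (M * (C1 + C2)) * ennreal (snd \<zeta> powr (r - p))" by (simp add: \<zeta>t)
  qed
qed

abbreviation abs_leray :: "real \<Rightarrow> nat \<Rightarrow> (real \<times> real \<Rightarrow> ennreal) \<Rightarrow> real \<times> real \<Rightarrow> ennreal" where
  "abs_leray \<gamma> k F z \<equiv> (\<integral>\<^sup>+\<zeta>. ennreal (cmod (leray_kernel \<gamma> k z \<zeta>)) * F \<zeta> \<partial>halfplane)"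

text \<open>One constant for all \<open>k\<close>, and for the operator with kernel \<open>|K|\<close>: the latter also gives the
  absolute convergence that Fubini's theorem asks for.\<close>

definition kernel_bound :: "real \<Rightarrow> real \<Rightarrow> real \<Rightarrow> bool" where
  "kernel_bound \<gamma> r C \<longleftrightarrow> 0 \<le> C \<and> (\<forall>k. \<forall>F \<in> borel_measurable halfplane.
     (\<integral>\<^sup>+z. (abs_leray \<gamma> k F z)\<^sup>2 * ennreal (snd z powr r) \<partial>halfplane)
       \<le> ennreal C * (\<integral>\<^sup>+\<zeta>. (F \<zeta>)\<^sup>2 * ennreal (snd \<zeta> powr r) \<partial>halfplane))"

text \<open>An admissible \<open>p\<close> exists since \<open>max 0 (r + 1 - \<gamma>) < min \<gamma> (r + 1)\<close> says exactly that
  \<open>-1 < r < 2 \<gamma> - 1\<close>.\<close>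

lemma ex_kernel_bound:
  fixes \<gamma> r :: real
  assumes \<gamma>: "\<gamma> > 1" and r: "-1 < r" "r < 2 * \<gamma> - 1"
  shows "\<exists>C. kernel_bound \<gamma> r C"
proof -
  define p where "p = (max 0 (r + 1 - \<gamma>) + min \<gamma> (r + 1)) / 2"
  have p: "0 < p" "p < \<gamma>" "r + 1 - \<gamma> < p" "p < r + 1"
    using \<gamma> r by (auto simp: p_def max_def min_def)
  from leray_kernel_schur_bounds[OF \<gamma> p] obtain C where C: "0 \<le> C"
    "\<And>k z. z \<in> space halfplane \<Longrightarrow>
       (\<integral>\<^sup>+\<zeta>. ennreal (cmod (leray_kernel \<gamma> k z \<zeta>)) * ennreal (snd \<zeta> powr - p) \<partial>halfplane)
         \<le> ennreal C * ennreal (snd z powr - p)"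
    "\<And>k \<zeta>. \<zeta> \<in> space halfplane \<Longrightarrow>
       (\<integral>\<^sup>+z. ennreal (cmod (leray_kernel \<gamma> k z \<zeta>)) * ennreal (snd z powr (r - p)) \<partial>halfplane)
         \<le> ennreal C * ennreal (snd \<zeta> powr (r - p))"
    by blast
  have pw: "ennreal (x powr - p) * ennreal (x powr r) = ennreal (x powr (r - p))" for x
    by (simp add: ennreal_mult[symmetric] powr_add[symmetric])
  show ?thesis
  proof (intro exI[of _ "C\<^sup>2"], unfold kernel_bound_def, intro conjI allI ballI)
    fix k and F :: "real \<times> real \<Rightarrow> ennreal" assume [measurable]: "F \<in> borel_measurable halfplane"
    have "(\<integral>\<^sup>+z. (abs_leray \<gamma> k F z)\<^sup>2 * ennreal (snd z powr r) \<partial>halfplane)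
         \<le> (ennreal C)\<^sup>2 * (\<integral>\<^sup>+\<zeta>. (F \<zeta>)\<^sup>2 * ennreal (snd \<zeta> powr r) \<partial>halfplane)"
      by (rule schur_test[where h = "\<lambda>x. snd x powr - p"])
         (use C in \<open>auto simp: pw sigma_finite_halfplane\<close>)
    then show "(\<integral>\<^sup>+z. (abs_leray \<gamma> k F z)\<^sup>2 * ennreal (snd z powr r) \<partial>halfplane)
         \<le> ennreal (C\<^sup>2) * (\<integral>\<^sup>+\<zeta>. (F \<zeta>)\<^sup>2 * ennreal (snd \<zeta> powr r) \<partial>halfplane)"
      using C(1) by (simp add: ennreal_power)
  qed auto
qed

section \<open>The reproducing identity\<close>

lemma line_integral_FTC:
  fixes F f :: "real \<Rightarrow> complex"
  assumes "\<And>s. (F has_vector_derivative f s) (at s)" "\<And>s. isCont f s" "integrable lborel f"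
    and F: "(F \<longlongrightarrow> A) at_bot" "(F \<longlongrightarrow> B) at_top"
  shows "(LINT s|lborel. f s) = B - A"
proof -
  have "(LBINT s=-\<infinity>..\<infinity>. f s) = B - A"
  proof (rule interval_integral_FTC_integrable)
    show "((F \<circ> real_of_ereal) \<longlongrightarrow> A) (at_right (-\<infinity>))" "((F \<circ> real_of_ereal) \<longlongrightarrow> B) (at_left \<infinity>)"
      unfolding at_right_MInf at_left_PInf comp_def using F by (simp_all add: filterlim_filtermap)
  qed (use assms in \<open>auto simp: set_integrable_def\<close>)
  then show ?thesis
    by (simp add: interval_lebesgue_integral_def set_lebesgue_integral_def)
qed

lemma integrable_inverse_cmod_square:
  fixes a t :: real
  assumes "a > 0"
  shows "integrable lborel (\<lambda>s. 1 / (cmod (Complex a (s - t)))\<^sup>2)"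
proof (rule integrableI_bounded)
  have "(\<integral>\<^sup>+s. ennreal (norm (1 / (cmod (Complex a (s - t)))\<^sup>2)) \<partial>lborel)
      \<le> ennreal (pi * sqrt 2 / (sqrt (real 0 + 1) * a ^ (0 + 1)))"
    using nn_integral_inverse_cmod_power[OF assms, of t 0] by (simp add: power2_eq_square norm_divide norm_mult)
  then show "(\<integral>\<^sup>+s. ennreal (norm (1 / (cmod (Complex a (s - t)))\<^sup>2)) \<partial>lborel) < \<infinity>"
    using le_less_trans by fastforce
qed measurable

text \<open>The inverses of both factors are bounded, so at least one of the three products \<open>|X|\<^sup>-\<^sup>2\<close>, \<open>|Y|\<^sup>-\<^sup>2\<close>,
  \<open>|X|\<^sup>-\<^sup>1 |Y|\<^sup>-\<^sup>1\<close> dominates the integrand.\<close>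

lemma integrable_inverse_powers:
  fixes a b p q :: real
  assumes ab: "a > 0" "b > 0" and mn: "m + n \<ge> 2"
  shows "integrable lborel (\<lambda>s. 1 / (Complex a (s - p) ^ m * Complex b (q - s) ^ n))"
proof -
  define x where "x s = 1 / cmod (Complex a (s - p))" for s
  define y where "y s = 1 / cmod (Complex b (q - s))" for s
  have "cmod (Complex a (s - p)) \<ge> a" "cmod (Complex b (q - s)) \<ge> b" for s
    using complex_Re_le_cmod[of "Complex a (s - p)"] complex_Re_le_cmod[of "Complex b (q - s)"] by auto
  then have xy: "0 \<le> x s" "x s \<le> 1 / a" "0 \<le> y s" "y s \<le> 1 / b" for s
    using ab by (auto simp: x_def y_def intro!: divide_left_mono mult_pos_pos elim: less_le_trans)
  have "integrable lborel (\<lambda>s. (x s)\<^sup>2)"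
    using integrable_inverse_cmod_square[OF ab(1), of p] by (simp add: x_def power_divide)
  moreover have "integrable lborel (\<lambda>s. (y s)\<^sup>2)"
  proof -
    have "cmod (Complex b (q - s)) = cmod (Complex b (s - q))" for s
      by (simp add: cmod_def power2_commute)
    then show ?thesis
      using integrable_inverse_cmod_square[OF ab(2), of q] by (simp add: y_def power_divide)
  qed
  ultimately have int: "integrable lborel (\<lambda>s. c * ((x s)\<^sup>2 + (y s)\<^sup>2))" for c
    by simp
  have "\<exists>c. \<forall>s. x s ^ m * y s ^ n \<le> c * ((x s)\<^sup>2 + (y s)\<^sup>2)"
  proof -
    consider k where "m = k + 2" | k where "n = k + 2" | "m = 1" "n = 1"
    proof -
      have "m = (m - 2) + 2 \<or> n = (n - 2) + 2 \<or> m = 1 \<and> n = 1" using mn by arith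
      then show thesis using that by blast
    qed
    then show ?thesis
    proof cases
      case 1
      have "x s ^ m * y s ^ n \<le> (1 / a) ^ k * (1 / b) ^ n * ((x s)\<^sup>2 + (y s)\<^sup>2)" for s
      proof -
        have "x s ^ k * y s ^ n * (x s)\<^sup>2 \<le> (1 / a) ^ k * (1 / b) ^ n * ((x s)\<^sup>2 + (y s)\<^sup>2)"
          using xy[of s] ab by (intro mult_mono power_mono mult_nonneg_nonneg) auto
        then show ?thesis by (simp add: 1 power_add power2_eq_square mult_ac)
      qed
      then show ?thesis by blast
    next
      case 2
      have "x s ^ m * y s ^ n \<le> (1 / a) ^ m * (1 / b) ^ k * ((x s)\<^sup>2 + (y s)\<^sup>2)" for s
      proof -
        have "x s ^ m * y s ^ k * (y s)\<^sup>2 \<le> (1 / a) ^ m * (1 / b) ^ k * ((x s)\<^sup>2 + (y s)\<^sup>2)"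
          using xy[of s] ab by (intro mult_mono power_mono mult_nonneg_nonneg) auto
        then show ?thesis by (simp add: 2 power_add power2_eq_square mult_ac)
      qed
      then show ?thesis by blast
    next
      case 3
      have "x s ^ m * y s ^ n \<le> 1 * ((x s)\<^sup>2 + (y s)\<^sup>2)" for s
      proof -
        have "0 \<le> x s * y s" using xy[of s] by simp
        then show ?thesis using sum_squares_bound[of "x s" "y s"] unfolding 3 by simp
      qed
      then show ?thesis by blast
    qed
  qed
  then obtain c where c: "\<And>s. x s ^ m * y s ^ n \<le> c * ((x s)\<^sup>2 + (y s)\<^sup>2)" by blast
  show ?thesis
  proof (rule Bochner_Integration.integrable_bound[OF int[of c]])
    show "AE s in lborel. norm (1 / (Complex a (s - p) ^ m * Complex b (q - s) ^ n))
        \<le> norm (c * ((x s)\<^sup>2 + (y s)\<^sup>2))"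
    proof (rule AE_I2)
      fix s
      have "norm (1 / (Complex a (s - p) ^ m * Complex b (q - s) ^ n)) = x s ^ m * y s ^ n"
        by (simp add: x_def y_def norm_divide norm_mult norm_power power_divide)
      then show "norm (1 / (Complex a (s - p) ^ m * Complex b (q - s) ^ n)) \<le> norm (c * ((x s)\<^sup>2 + (y s)\<^sup>2))"
        using c[of s] by simp
    qed
  qed measurable
qed

lemma inverse_powers_partial_fractions:
  fixes x y :: complex
  assumes "x \<noteq> 0" "y \<noteq> 0" "x + y \<noteq> 0"
  shows "1 / (x ^ (m + 1) * y ^ (n + 1)) = (1 / (x ^ m * y ^ (n + 1)) + 1 / (x ^ (m + 1) * y ^ n)) / (x + y)"
proof -
  have "1 / (x ^ m * y ^ (n + 1)) + 1 / (x ^ (m + 1) * y ^ n) = (x + y) / (x ^ (m + 1) * y ^ (n + 1))"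
    using assms(1,2) by (simp add: divide_simps)
  then show ?thesis using assms(3) by simp
qed

text \<open>With \<open>X\<close>, \<open>Y\<close> the two factors and \<open>S = X + Y\<close>, an antiderivative is
  \<open>(\<i> Log Y - \<i> Log X) / S\<close>; writing it in terms of \<open>arctan\<close> and \<open>ln\<close> avoids branches of the logarithm.\<close>

lemma line_integral_inverse_product:
  fixes a b p q :: real
  assumes ab: "a > 0" "b > 0"
  shows "(LINT s|lborel. 1 / (Complex a (s - p) * Complex b (q - s))) = 2 * pi / Complex (a + b) (q - p)"
proof -
  define X where "X s = Complex a (s - p)" for s
  define Y where "Y s = Complex b (q - s)" for s
  define S where "S = Complex (a + b) (q - p)"
  have S: "S = X s + Y s" for s by (simp add: S_def X_def Y_def complex_eq_iff)
  have nz: "X s \<noteq> 0" "Y s \<noteq> 0" "X s + Y s \<noteq> 0" for s using ab by (auto simp: X_def Y_def complex_eq_iff)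
  define R where "R s = arctan ((s - p) / a) + arctan ((s - q) / b)" for s
  define L where "L s = (ln (b\<^sup>2 + (s - q)\<^sup>2) - ln (a\<^sup>2 + (s - p)\<^sup>2)) / 2" for s
  define F where "F s = Complex (R s) (L s) / S" for s
  have pos: "a\<^sup>2 + (s - p)\<^sup>2 > 0" "b\<^sup>2 + (s - q)\<^sup>2 > 0" for s
    using ab by (auto intro!: add_pos_nonneg)
  have dR: "(R has_real_derivative a / (a\<^sup>2 + (s - p)\<^sup>2) + b / (b\<^sup>2 + (s - q)\<^sup>2)) (at s)" for s
  proof -
    have "1 / a / (1 + ((s - p) / a)\<^sup>2) = a / (a\<^sup>2 + (s - p)\<^sup>2)"
      using ab by (simp add: field_simps power2_eq_square)
    moreover have "1 / b / (1 + ((s - q) / b)\<^sup>2) = b / (b\<^sup>2 + (s - q)\<^sup>2)"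
      using ab by (simp add: field_simps power2_eq_square)
    moreover have "(R has_real_derivative 1 / a / (1 + ((s - p) / a)\<^sup>2) + 1 / b / (1 + ((s - q) / b)\<^sup>2)) (at s)"
      unfolding R_def using ab by (auto intro!: derivative_eq_intros simp: field_simps)
    ultimately show ?thesis by simp
  qed
  have dL: "(L has_real_derivative (s - q) / (b\<^sup>2 + (s - q)\<^sup>2) - (s - p) / (a\<^sup>2 + (s - p)\<^sup>2)) (at s)" for s
  proof -
    have "(L has_real_derivative (2 * (s - q) / (b\<^sup>2 + (s - q)\<^sup>2) - 2 * (s - p) / (a\<^sup>2
        + (s - p)\<^sup>2)) / 2) (at s)"
      unfolding L_def using pos[of s] by (auto intro!: derivative_eq_intros)
    moreover have "(2 * u / x - 2 * v / y) / 2 = u / x - v / y" for u v x y :: real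
      by (simp add: diff_divide_distrib)
    ultimately show ?thesis by (simp only:)
  qed
  have sq: "(cmod (X s))\<^sup>2 = a\<^sup>2 + (s - p)\<^sup>2" "(cmod (Y s))\<^sup>2 = b\<^sup>2 + (s - q)\<^sup>2" for s
    by (simp_all add: X_def Y_def cmod_def power2_commute)
  have inv: "1 / X s = Complex (a / (a\<^sup>2 + (s - p)\<^sup>2)) (- (s - p) / (a\<^sup>2 + (s - p)\<^sup>2))"
    "1 / Y s = Complex (b / (b\<^sup>2 + (s - q)\<^sup>2)) ((s - q) / (b\<^sup>2 + (s - q)\<^sup>2))" for s
    by (simp_all add: X_def Y_def complex_eq_iff Re_divide Im_divide power2_commute[of q s])
  have dF: "(F has_vector_derivative 1 / (X s * Y s)) (at s)" for s
  proof -
    have "((\<lambda>s. Complex (R s) (L s)) has_vector_derivative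
        Complex (a / (a\<^sup>2 + (s - p)\<^sup>2) + b / (b\<^sup>2 + (s - q)\<^sup>2)) ((s - q) / (b\<^sup>2
            + (s - q)\<^sup>2) - (s - p) / (a\<^sup>2 + (s - p)\<^sup>2))) (at s)"
      using dR[of s] dL[of s]
      by (auto simp: has_vector_derivative_complex_iff has_real_derivative_iff_has_vector_derivative)
    also have "Complex (a / (a\<^sup>2 + (s - p)\<^sup>2) + b / (b\<^sup>2 + (s - q)\<^sup>2)) ((s - q) / (b\<^sup>2
        + (s - q)\<^sup>2) - (s - p) / (a\<^sup>2 + (s - p)\<^sup>2))
        = 1 / X s + 1 / Y s"
      unfolding inv by (simp add: complex_eq_iff diff_divide_distrib)
    finally have "(F has_vector_derivative (1 / X s + 1 / Y s) / S) (at s)"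
      unfolding F_def divide_inverse by (intro has_vector_derivative_mult_left)
    moreover have "(1 / X s + 1 / Y s) / S = 1 / (X s * Y s)"
      using inverse_powers_partial_fractions[of "X s" "Y s" 0 0] nz[of s] unfolding S[of s]
          by (simp add: add.commute)
    ultimately show ?thesis by simp
  qed
  have int: "integrable lborel (\<lambda>s. 1 / (X s * Y s))"
    using integrable_inverse_powers[OF ab, of 1 1 p q] by (simp add: X_def Y_def)
  have R_top: "(R \<longlongrightarrow> pi) at_top"
  proof -
    have "filterlim (\<lambda>s. (s - p) / a) at_top at_top" "filterlim (\<lambda>s. (s - q) / b) at_top at_top"
      using ab by real_asymp+
    then have "(R \<longlongrightarrow> pi / 2 + pi / 2) at_top"
      unfolding R_def by (intro tendsto_add filterlim_compose[OF tendsto_arctan_at_top])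
    then show ?thesis by simp
  qed
  have R_bot: "(R \<longlongrightarrow> - pi) at_bot"
  proof -
    have "filterlim (\<lambda>s. (s - p) / a) at_bot at_bot" "filterlim (\<lambda>s. (s - q) / b) at_bot at_bot"
      using ab by real_asymp+
    then have "(R \<longlongrightarrow> - (pi / 2) + - (pi / 2)) at_bot"
      unfolding R_def by (intro tendsto_add filterlim_compose[OF tendsto_arctan_at_bot])
    then show ?thesis by simp
  qed
  have L_top: "(L \<longlongrightarrow> 0) at_top"
    unfolding L_def by real_asymp
  have L_bot: "(L \<longlongrightarrow> 0) at_bot"
    unfolding L_def by real_asymp
  have F_top: "(F \<longlongrightarrow> Complex pi 0 / S) at_top" and F_bot: "(F \<longlongrightarrow> Complex (- pi) 0 / S) at_bot"
    unfolding F_def using R_top L_top R_bot L_bot nz(3) S by (auto intro!: tendsto_intros)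
  have "(LINT s|lborel. 1 / (X s * Y s)) = Complex pi 0 / S - Complex (- pi) 0 / S"
  proof (rule line_integral_FTC[OF dF _ int F_bot F_top])
    show "isCont (\<lambda>s. 1 / (X s * Y s)) s" for s
      using nz[of s] unfolding X_def Y_def Complex_eq by (intro continuous_intros) (auto simp: Complex_eq)
  qed
  also have "Complex pi 0 / S - Complex (- pi) 0 / S = 2 * pi / S"
    by (simp add: diff_divide_distrib[symmetric] complex_eq_iff[of "Complex pi 0 - Complex (-pi) 0"] flip:
        complex_of_real_def)
  finally show ?thesis by (simp add: X_def Y_def S_def)
qed

lemma line_integral_inverse_power_eq_0:
  fixes a p :: real
  assumes a: "a > 0"
  shows "(LINT s|lborel. 1 / Complex a (s - p) ^ (m + 2)) = 0"
    and "(LINT s|lborel. 1 / Complex a (p - s) ^ (m + 2)) = 0"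
proof -
  have main: "(LINT s|lborel. 1 / Complex a (s - p) ^ (m + 2)) = 0" for p
  proof -
    define X where "X s = Complex a (s - p)" for s
    have nz: "X s \<noteq> 0" for s using a by (auto simp: X_def complex_eq_iff)
    define F where "F s = (\<i> / (of_nat m + 1)) * inverse (X s) ^ (m + 1)" for s
    have m1: "of_nat m + 1 \<noteq> (0::complex)"
      by (metis of_nat_1 of_nat_add of_nat_eq_0_iff add_eq_0_iff_both_eq_0 zero_neq_one)
    have dX: "(X has_vector_derivative \<i>) (at s)" for s
      unfolding X_def
      by (auto simp: has_vector_derivative_complex_iff intro!: derivative_eq_intros)
    have dF: "(F has_vector_derivative 1 / X s ^ (m + 2)) (at s)" for s
    proof -
      have "((\<lambda>z. (\<i> / (of_nat m + 1)) * inverse z ^ (m + 1)) has_field_derivative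
          (\<i> / (of_nat m + 1)) * (of_nat (m + 1) * inverse (X s) ^ m * (- (inverse (X s) ^ 2)))) (at (X s))"
        using DERIV_cmult[OF DERIV_power_Suc[OF DERIV_inverse[OF nz[of s]], of m], of "\<i> / (of_nat m + 1)"]
        by (simp add: power2_eq_square mult_ac numeral_2_eq_2)
      from field_vector_diff_chain_at[OF dX this]
      have "(F has_vector_derivative \<i> * ((\<i> / (of_nat m + 1)) * (of_nat (m + 1) * inverse (X s) ^ m
          * (- (inverse (X s) ^ 2))))) (at s)"
        by (simp only: F_def[abs_def] o_def)
      also have "\<i> * ((\<i> / (of_nat m + 1)) * (of_nat (m + 1) * inverse (X s) ^ m
          * (- (inverse (X s) ^ 2)))) = 1 / X s ^ (m + 2)"
      proof -
        have "\<i> * ((\<i> / (of_nat m + 1)) * (of_nat (m + 1) * inverse (X s) ^ m * (- (inverse (X s) ^ 2))))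
            = (of_nat m + 1) / (of_nat m + 1) * (inverse (X s) ^ m * inverse (X s) ^ 2)"
          by (simp add: add.commute)
        also have "\<dots> = 1 / X s ^ (m + 2)"
          using m1 by (simp add: divide_inverse power_inverse power2_eq_square)
        finally show ?thesis .
      qed
      finally show ?thesis .
    qed
    have tend: "(F \<longlongrightarrow> 0) G" if "filterlim (\<lambda>s. \<bar>s - p\<bar>) at_top G" for G
    proof -
      have "filterlim (\<lambda>s. norm (X s)) at_top G"
        using that by (rule filterlim_at_top_mono) (use abs_Im_le_cmod[of "Complex a (_ - p)"] in \<open>auto
            simp: X_def intro!: always_eventually\<close>)
      then have "((\<lambda>s. inverse (X s)) \<longlongrightarrow> 0) G"
        by (intro filterlim_compose[OF tendsto_inverse_0] filterlim_at_infinity_conv_norm_at_top[THEN iffD2])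
      then have "(F \<longlongrightarrow> (\<i> / (of_nat m + 1)) * 0 ^ (m + 1)) G"
        unfolding F_def by (intro tendsto_intros)
      then show ?thesis by simp
    qed
    have int: "integrable lborel (\<lambda>s. 1 / X s ^ (m + 2))"
      using integrable_inverse_powers[OF a a, of "m + 2" 0 p p] by (simp add: X_def)
    have "(LINT s|lborel. 1 / X s ^ (m + 2)) = 0 - 0"
    proof (rule line_integral_FTC[OF dF _ int])
      show "(F \<longlongrightarrow> 0) at_bot" "(F \<longlongrightarrow> 0) at_top"
        by (rule tend, real_asymp)+
      show "isCont (\<lambda>s. 1 / X s ^ (m + 2)) s" for s
        using nz[of s] unfolding X_def Complex_eq by (intro continuous_intros) (auto simp: Complex_eq)
    qed
    then show ?thesis by (simp add: X_def)
  qed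
  show "(LINT s|lborel. 1 / Complex a (s - p) ^ (m + 2)) = 0" by (rule main)
  have "(LINT s|lborel. 1 / Complex a (p - s) ^ (m + 2)) = (LINT s|lborel. 1 / Complex a (s - (- p)) ^ (m + 2))"
    using lborel_integral_real_affine[of "-1" "\<lambda>s. 1 / Complex a (s - (- p)) ^ (m + 2)" 0] by simp
  then show "(LINT s|lborel. 1 / Complex a (p - s) ^ (m + 2)) = 0" using main[of "-p"] by simp
qed

text \<open>The partial fractions turn the double sequence of integrals into Pascal's triangle, scaled by
  powers of \<open>1 / S\<close>; the integral of a single factor to a power below \<open>-1\<close> vanishes.\<close>

lemma line_integral_inverse_powers:
  fixes a b p q :: real
  assumes ab: "a > 0" "b > 0"
  shows "(LINT s|lborel. 1 / (Complex a (s - p) ^ (m + 1) * Complex b (q - s) ^ (n + 1)))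
    = 2 * pi * of_nat ((m + n) choose m) / Complex (a + b) (q - p) ^ (m + n + 1)"
proof (induction d \<equiv> "m + n" arbitrary: m n)
  case 0
  then show ?case using line_integral_inverse_product[OF ab] by simp
next
  case (Suc d)
  define X where "X s = Complex a (s - p)" for s
  define Y where "Y s = Complex b (q - s)" for s
  define S where "S = Complex (a + b) (q - p)"
  have S: "S = X s + Y s" for s by (simp add: S_def X_def Y_def complex_eq_iff)
  have nz: "X s \<noteq> 0" "Y s \<noteq> 0" "X s + Y s \<noteq> 0" for s using ab by (auto simp: X_def Y_def complex_eq_iff)
  note int = integrable_inverse_powers[OF ab, of _ _ p q, folded X_def Y_def]
  note IH = Suc.hyps(1)
  \<comment> \<open>since \<open>X + Y = S\<close> is constant, one factor can be traded for \<open>1 / S\<close>\<close>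
  have split: "1 / (X s ^ (m + 1) * Y s ^ (n + 1))
      = (1 / (X s ^ m * Y s ^ (n + 1)) + 1 / (X s ^ (m + 1) * Y s ^ n)) / S" for s
    using inverse_powers_partial_fractions nz[of s] unfolding S[of s] by blast
  have "(LINT s|lborel. 1 / (X s ^ (m + 1) * Y s ^ (n + 1)))
     = ((LINT s|lborel. 1 / (X s ^ m * Y s ^ (n + 1))) + (LINT s|lborel. 1 / (X s ^ (m + 1) * Y s ^ n))) / S"
    unfolding split using Suc.hyps(2) by (simp add: Bochner_Integration.integral_add int del: power_Suc)
  also have "(LINT s|lborel. 1 / (X s ^ m * Y s ^ (n + 1)))
     = (if m = 0 then 0 else 2 * pi * of_nat ((m - 1 + n) choose (m - 1)) / S ^ (m + n))"
  proof (cases m)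
    case 0
    then obtain n' where "n = n' + 1" using Suc.hyps(2) by (cases n) auto
    then show ?thesis using 0 line_integral_inverse_power_eq_0(2)[OF ab(2), of q n'] by (simp add: Y_def)
  next
    case (Suc m')
    then show ?thesis using IH[of m' n] \<open>Suc d = m + n\<close> by (simp add: X_def Y_def S_def)
  qed
  also have "(LINT s|lborel. 1 / (X s ^ (m + 1) * Y s ^ n))
     = (if n = 0 then 0 else 2 * pi * of_nat ((m + (n - 1)) choose m) / S ^ (m + n))"
  proof (cases n)
    case 0
    then obtain m' where "m = m' + 1" using Suc.hyps(2) by (cases m) auto
    then show ?thesis using 0 line_integral_inverse_power_eq_0(1)[OF ab(1), of p m'] by (simp add: X_def)
  next
    case (Suc n')
    then show ?thesis using IH[of m n'] \<open>Suc d = m + n\<close> by (simp add: X_def Y_def S_def)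
  qed
  finally have "(LINT s|lborel. 1 / (X s ^ (m + 1) * Y s ^ (n + 1)))
      = 2 * pi * of_nat ((m + n) choose m) / S ^ (m + n + 1)"
    using nz(3) S Suc.hyps(2) by (cases m; cases n) (auto simp: add_divide_distrib[symmetric]
        distrib_left[symmetric])
  then show ?case by (simp add: X_def Y_def S_def)
qed

text \<open>The Beta integral in a form that does not depend on the path from \<open>0\<close> to \<open>1\<close>: it will be used along
  the curve \<open>v = u / (u + D)\<close>, which leaves the real axis.\<close>

lemma beta_antiderivative:
  "\<exists>P :: complex \<Rightarrow> complex. (\<forall>v. (P has_field_derivative v ^ m * (1 - v) ^ n) (at v)) \<and> P 0 = 0
     \<and> P 1 = fact m * fact n / fact (m + n + 1)"
proof (induction n arbitrary: m)
  case 0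
  have "((\<lambda>v. v ^ (m + 1) / of_nat (m + 1)) has_field_derivative v ^ m * (1 - v) ^ 0) (at v)" for v :: complex
  proof -
    have 1: "1 + of_nat m \<noteq> (0::complex)"
      by (metis of_nat_Suc of_nat_eq_0_iff nat.distinct(1))
    have "((\<lambda>v. v ^ Suc m / of_nat (m + 1)) has_field_derivative (1 + of_nat m) * (1 * v ^ m) / of_nat (m
        + 1)) (at v)"
      by (rule DERIV_cdivide[OF DERIV_power_Suc[OF DERIV_ident]])
    also have "(1 + of_nat m) * (1 * v ^ m) / of_nat (m + 1) = v ^ m * (1 - v) ^ 0"
      using 1 by (simp add: add.commute)
    finally show ?thesis by simp
  qed
  then show ?case
    by (intro exI[of _ "\<lambda>v. v ^ (m + 1) / of_nat (m + 1)"]) (auto simp: divide_simps)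
next
  case (Suc n)
  obtain P :: "complex \<Rightarrow> complex" where P: "\<And>v. (P has_field_derivative v ^ Suc m
      * (1 - v) ^ n) (at v)" "P 0 = 0"
    "P 1 = fact (Suc m) * fact n / fact (Suc m + n + 1)"
    using Suc[of "Suc m"] by blast
  define M :: complex where "M = of_nat (Suc m)"
  have M: "M \<noteq> 0" unfolding M_def by (simp del: of_nat_Suc)
  define Q where "Q v = v ^ Suc m * (1 - v) ^ Suc n / M + of_nat (Suc n) / M * P v" for v
  have "(Q has_field_derivative v ^ m * (1 - v) ^ Suc n) (at v)" for v
  proof -
    have "(Q has_field_derivative (M * v ^ m * (1 - v) ^ Suc n + v ^ Suc m * (of_nat (Suc n) * (1 - v) ^ n
        * -1)) / M
        + of_nat (Suc n) / M * (v ^ Suc m * (1 - v) ^ n)) (at v)"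
      unfolding Q_def M_def by (auto intro!: derivative_eq_intros P simp del: of_nat_Suc power_Suc simp:
          divide_inverse)
    also have "(M * v ^ m * (1 - v) ^ Suc n + v ^ Suc m * (of_nat (Suc n) * (1 - v) ^ n * -1)) / M
        + of_nat (Suc n) / M * (v ^ Suc m * (1 - v) ^ n) = v ^ m * (1 - v) ^ Suc n"
      using M by (simp add: field_simps del: of_nat_Suc power_Suc)
    finally show ?thesis .
  qed
  moreover have "Q 1 = fact m * fact (Suc n) / fact (m + Suc n + 1)"
    using M unfolding Q_def P(3) by (simp add: M_def[symmetric] fact_Suc[of m] del: of_nat_Suc fact_Suc)
        (simp add: M_def)
  moreover have "Q 0 = 0" by (simp add: Q_def P(2))
  ultimately show ?case by blast
qed

text \<open>With \<open>u = \<gamma> \<alpha>\<^sup>\<gamma>\<close> and \<open>v = u / (u + D)\<close> the integrand becomes a multiple of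
  \<open>v\<^sup>k (1 - v)\<^sup>k\<^sup>+\<^sup>1 dv\<close>, with \<open>v\<close> running from \<open>0\<close> to \<open>1\<close>.\<close>

lemma ray_integral_beta:
  fixes D :: complex
  assumes \<gamma>: "\<gamma> > 1" and D: "Re D > 0"
    and int: "set_integrable lborel (einterval 0 \<infinity>)
      (\<lambda>\<alpha>. of_real (\<alpha> powr \<gamma>) ^ k * of_real (\<alpha> powr (\<gamma> - 1)) / (of_real (\<gamma> * \<alpha> powr \<gamma>) + D) ^ (2 * k + 3))"
  shows "(LBINT \<alpha>=0..\<infinity>. of_real (\<alpha> powr \<gamma>) ^ k * of_real (\<alpha> powr (\<gamma> - 1)) / (of_real (\<gamma> * \<alpha> powr \<gamma>)
      + D) ^ (2 * k + 3))
    = (fact k * fact (k + 1) / fact (2 * k + 2)) / (of_real \<gamma> ^ (k + 2) * D ^ (k + 2))"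
proof -
  have k: "k + (k + 1) + 1 = 2 * k + 2" by simp
  obtain P :: "complex \<Rightarrow> complex" where P: "\<And>v. (P has_field_derivative v ^ k * (1 - v) ^ (k
      + 1)) (at v)" "P 0 = 0"
    "P 1 = fact k * fact (k + 1) / fact (2 * k + 2)"
    using beta_antiderivative[of k "k + 1"] unfolding k by blast
  define u where "u \<alpha> = complex_of_real (\<gamma> * \<alpha> powr \<gamma>)" for \<alpha>
  define h where "h \<alpha> = of_real (\<alpha> powr \<gamma>) ^ k * of_real (\<alpha> powr (\<gamma> - 1)) / (u \<alpha> + D) ^ (2 * k + 3)" for \<alpha>
  define v where "v \<alpha> = u \<alpha> / (u \<alpha> + D)" for \<alpha>
  define c where "c = of_real \<gamma> ^ (k + 2) * D ^ (k + 2)"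
  define F where "F \<alpha> = P (v \<alpha>) / c" for \<alpha>
  have D0: "D \<noteq> 0" using D by auto
  have g0: "complex_of_real \<gamma> \<noteq> 0" using \<gamma> by auto
  have c0: "c \<noteq> 0" using \<gamma> D0 by (simp add: c_def)
  have nz: "u \<alpha> + D \<noteq> 0" for \<alpha>
  proof -
    have "Re (u \<alpha> + D) > 0" using D \<gamma> by (simp add: u_def add_nonneg_pos)
    then show ?thesis by (metis less_irrefl zero_complex.sel(1))
  qed
  have P_cont: "isCont P w" for w using P(1) by (rule DERIV_isCont)
  have dF: "(F has_vector_derivative h \<alpha>) (at \<alpha>)" if "\<alpha> > 0" for \<alpha>
  proof -
    have du: "(u has_vector_derivative of_real \<gamma> ^ 2 * of_real (\<alpha> powr (\<gamma> - 1))) (at \<alpha>)"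
    proof -
      have "((\<lambda>\<alpha>. \<gamma> * \<alpha> powr \<gamma>) has_real_derivative \<gamma>\<^sup>2 * \<alpha> powr (\<gamma> - 1)) (at \<alpha>)"
        using that by (auto intro!: derivative_eq_intros simp: power2_eq_square)
      then have "(u has_vector_derivative of_real (\<gamma>\<^sup>2 * \<alpha> powr (\<gamma> - 1))) (at \<alpha>)"
        unfolding u_def by (intro has_vector_derivative_of_real) (simp add:
            has_real_derivative_iff_has_vector_derivative)
      then show ?thesis by simp
    qed
    have "((\<lambda>w. P (w / (w + D)) / c) has_field_derivative
       ((v \<alpha>) ^ k * (1 - v \<alpha>) ^ (k + 1)) * (D / (u \<alpha> + D) ^ 2) / c) (at (u \<alpha>))"
    proof (rule DERIV_cdivide, rule DERIV_chain2[where f = P and g = "\<lambda>w. w / (w + D)"])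
      show "(P has_field_derivative (v \<alpha>) ^ k * (1 - v \<alpha>) ^ (k + 1)) (at (u \<alpha> / (u \<alpha> + D)))"
        using P(1)[of "v \<alpha>"] by (simp add: v_def)
      show "((\<lambda>w. w / (w + D)) has_field_derivative D / (u \<alpha> + D)\<^sup>2) (at (u \<alpha>))"
        using nz[of \<alpha>] by (auto intro!: derivative_eq_intros simp: power2_eq_square)
    qed
    from field_vector_diff_chain_at[OF du this]
    have "(F has_vector_derivative (of_real \<gamma> ^ 2 * of_real (\<alpha> powr (\<gamma> - 1))) *
       (((v \<alpha>) ^ k * (1 - v \<alpha>) ^ (k + 1)) * (D / (u \<alpha> + D) ^ 2) / c)) (at \<alpha>)"
      by (simp only: F_def[abs_def] o_def v_def)
    also have "(of_real \<gamma> ^ 2 * of_real (\<alpha> powr (\<gamma> - 1))) *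
       (((v \<alpha>) ^ k * (1 - v \<alpha>) ^ (k + 1)) * (D / (u \<alpha> + D) ^ 2) / c) = h \<alpha>"
    proof -
      define w where "w = u \<alpha> + D"
      define x where "x = complex_of_real (\<alpha> powr \<gamma>)"
      define y where "y = complex_of_real (\<alpha> powr (\<gamma> - 1))"
      define g where "g = complex_of_real \<gamma>"
      have w: "w \<noteq> 0" using nz by (simp add: w_def)
      have gn: "g \<noteq> 0" using g0 by (simp add: g_def)
      have v1: "1 - v \<alpha> = D / w"
        using w by (simp add: v_def w_def diff_divide_eq_iff)
      have v2: "v \<alpha> = g * x / w"
        by (simp add: v_def w_def u_def x_def g_def)
      have "(g ^ 2 * y) * (((g * x / w) ^ k * (D / w) ^ (k + 1)) * (D / w ^ 2) / (g ^ (k + 2) * D ^ (k + 2)))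
         = x ^ k * y / w ^ (2 * k + 3)"
      proof -
        have "w ^ (2 * k + 3) = w ^ k * w ^ (k + 1) * w ^ 2"
          unfolding power_add[symmetric] by (rule arg_cong[of _ _ "(^) w"]) simp
        moreover have "g ^ (k + 2) = g ^ k * g ^ 2" "D ^ (k + 2) = D ^ (k + 1) * D"
          by (simp_all add: power_add power2_eq_square)
        ultimately show ?thesis
          using w gn D0 by (simp add: power_divide power_mult_distrib divide_simps)
      qed
      then show ?thesis
        unfolding h_def c_def v1 unfolding v2 w_def[symmetric] x_def[symmetric] y_def[symmetric]
            g_def[symmetric] .
    qed
    finally show ?thesis .
  qed
  have "(LBINT \<alpha>=0..\<infinity>. h \<alpha>) = P 1 / c - P 0 / c"
  proof (rule interval_integral_FTC_integrable)
    have "((\<lambda>\<alpha>. \<gamma> * \<alpha> powr \<gamma>) \<longlongrightarrow> 0) (at_right 0)"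
      using \<gamma> by real_asymp
    then have "(u \<longlongrightarrow> of_real 0) (at_right 0)"
      unfolding u_def by (rule tendsto_of_real)
    then have "(v \<longlongrightarrow> 0 / (0 + D)) (at_right 0)"
      unfolding v_def using D0 by (intro tendsto_intros) auto
    then have "((\<lambda>\<alpha>. P (v \<alpha>)) \<longlongrightarrow> P 0) (at_right 0)"
      by (intro isCont_tendsto_compose[OF P_cont]) simp
    then have "(F \<longlongrightarrow> P 0 / c) (at_right 0)"
      unfolding F_def using c0 by (intro tendsto_intros)
    then show "((F \<circ> real_of_ereal) \<longlongrightarrow> P 0 / c) (at_right 0)"
      unfolding zero_ereal_def ereal_tendsto_simps1 .
    have "((\<lambda>\<alpha>. 1 / (\<gamma> * \<alpha> powr \<gamma>)) \<longlongrightarrow> 0) at_top"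
      using \<gamma> by real_asymp
    then have lim: "((\<lambda>\<alpha>. of_real (1 / (\<gamma> * \<alpha> powr \<gamma>)) :: complex) \<longlongrightarrow> of_real 0) at_top"
      by (rule tendsto_of_real)
    have "((\<lambda>\<alpha>. 1 / (1 + D * of_real (1 / (\<gamma> * \<alpha> powr \<gamma>)))) \<longlongrightarrow> 1 / (1 + D * of_real 0)) at_top"
      by (intro tendsto_divide tendsto_add tendsto_mult lim tendsto_const) simp
    moreover have "eventually (\<lambda>\<alpha>. 1 / (1 + D * of_real (1 / (\<gamma> * \<alpha> powr \<gamma>))) = v \<alpha>) at_top"
    proof (rule eventually_at_top_linorderI[of 1])
      fix \<alpha> :: real assume "\<alpha> \<ge> 1"
      then have "u \<alpha> \<noteq> 0" using \<gamma> by (simp add: u_def)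
      then have 1: "1 + D * (1 / u \<alpha>) = (u \<alpha> + D) / u \<alpha>" by (simp add: add_divide_distrib)
      have 2: "of_real (1 / (\<gamma> * \<alpha> powr \<gamma>)) = 1 / u \<alpha>" by (simp add: u_def)
      show "1 / (1 + D * of_real (1 / (\<gamma> * \<alpha> powr \<gamma>))) = v \<alpha>"
        unfolding 2 1 v_def by simp
    qed
    ultimately have "(v \<longlongrightarrow> 1) at_top"
      by (subst (asm) filterlim_cong[OF refl refl]) auto
    then have "((\<lambda>\<alpha>. P (v \<alpha>)) \<longlongrightarrow> P 1) at_top"
      by (intro isCont_tendsto_compose[OF P_cont])
    then have "(F \<longlongrightarrow> P 1 / c) at_top"
      unfolding F_def using c0 by (intro tendsto_intros)
    then show "((F \<circ> real_of_ereal) \<longlongrightarrow> P 1 / c) (at_left \<infinity>)"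
      unfolding ereal_tendsto_simps1 .
    show "isCont h \<alpha>" if "0 < ereal \<alpha>" for \<alpha>
      unfolding h_def u_def using that nz[of \<alpha>] by (intro continuous_intros) (auto simp: u_def)
    show "set_integrable lborel (einterval 0 \<infinity>) h"
      using int by (simp add: h_def[abs_def] u_def)
  qed (auto intro: dF)
  then show ?thesis by (simp add: h_def u_def P c_def)
qed

lemma rays_as_einterval:
  fixes f :: "real \<Rightarrow> complex"
  shows "integrable rays f \<longleftrightarrow> set_integrable lborel (einterval 0 \<infinity>) f"
    and "(LINT \<alpha>|rays. f \<alpha>) = (LBINT \<alpha>=0..\<infinity>. f \<alpha>)"
proof -
  have e: "einterval 0 \<infinity> = {0<..}" by (auto simp: einterval_def)
  show "integrable rays f \<longleftrightarrow> set_integrable lborel (einterval 0 \<infinity>) f"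
    unfolding rays_def set_integrable_def e by (subst integrable_restrict_space) auto
  show "(LINT \<alpha>|rays. f \<alpha>) = (LBINT \<alpha>=0..\<infinity>. f \<alpha>)"
    unfolding rays_def interval_lebesgue_integral_def set_lebesgue_integral_def e
    by (subst integral_restrict_space) auto
qed

text \<open>This is why the transform is a projection. The product of the two factors \<open>B\<close> is
  \<open>B(z, w) \<gamma> \<alpha>\<^sup>\<gamma>\<close>, and the two factors \<open>A\<close> add up to \<open>A(z, w) + \<gamma> \<alpha>\<^sup>\<gamma>\<close> for every \<open>s\<close>. Hence the
  integral over \<open>s\<close> gives a binomial coefficient, the integral over \<open>\<alpha>\<close> a Beta value, and their
  product is inverse to the normalizing factor of the kernel.\<close>

lemma leray_kernel_reproducing:
  assumes \<gamma>: "\<gamma> > 1" and z: "z \<in> space halfplane" and w: "w \<in> space halfplane"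
    and int: "integrable halfplane (\<lambda>\<zeta>. leray_kernel \<gamma> k z \<zeta> * leray_kernel \<gamma> k \<zeta> w)"
  shows "(LINT \<zeta>|halfplane. leray_kernel \<gamma> k z \<zeta> * leray_kernel \<gamma> k \<zeta> w) = leray_kernel \<gamma> k z w"
proof -
  interpret pair_sigma_finite "lborel :: real measure" rays
    by (rule pair_sigma_finite_lborel_rays)
  obtain sz az where z': "z = (sz, az)" "az > 0" using z by (cases z) auto
  obtain sw aw where w': "w = (sw, aw)" "aw > 0" using w by (cases w) auto
  define D where "D = leray_A \<gamma> sz az sw aw"
  define B where "B = complex_of_real (leray_B \<gamma> az aw)"
  define c where "c = complex_of_real (\<gamma>\<^sup>2 * (real k + 1) / (2 * pi))"
  define Cb where "Cb = (of_nat ((2 * k + 2) choose (k + 1)) :: complex)"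
  define g where "g = complex_of_real \<gamma>"
  define h where "h \<alpha> = of_real (\<alpha> powr \<gamma>) ^ k * of_real (\<alpha> powr (\<gamma> - 1)) / (of_real (\<gamma> * \<alpha> powr \<gamma>)
      + D) ^ (2 * k + 3)" for \<alpha>
  define E where "E = c\<^sup>2 * B ^ k * g ^ k * of_real (aw powr (\<gamma> - 1)) * (2 * pi * Cb)"
  have ReD: "Re D > 0"
    using \<gamma> z' w' by (simp add: D_def leray_A_def add_nonneg_pos)
  have g0: "g \<noteq> 0" using \<gamma> by (simp add: g_def)
  have D0: "D \<noteq> 0" using ReD by auto
  have inner: "(LINT s|lborel. leray_kernel \<gamma> k z (s, \<alpha>) * leray_kernel \<gamma> k (s, \<alpha>) w)
      = E * h \<alpha>" if \<alpha>: "\<alpha> > 0" for \<alpha>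
  proof -
    define a1 where "a1 = (\<gamma> - 1) * \<alpha> powr \<gamma> + az powr \<gamma>"
    define a2 where "a2 = (\<gamma> - 1) * aw powr \<gamma> + \<alpha> powr \<gamma>"
    have a: "a1 > 0" "a2 > 0" using \<gamma> \<alpha> z' w' by (auto simp: a1_def a2_def intro!: add_nonneg_pos)
    have BB: "complex_of_real (leray_B \<gamma> az \<alpha>) * of_real (leray_B \<gamma> \<alpha> aw) = B * g * of_real (\<alpha> powr \<gamma>)"
    proof -
      have "\<alpha> * \<alpha> powr (\<gamma> - 1) = \<alpha> powr \<gamma>" using \<alpha> by (simp add: powr_mult_base)
      then have "leray_B \<gamma> az \<alpha> * leray_B \<gamma> \<alpha> aw = leray_B \<gamma> az aw * \<gamma> * \<alpha> powr \<gamma>"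
        by (simp add: leray_B_def mult_ac)
      then show ?thesis unfolding B_def g_def by (metis of_real_mult)
    qed
    have "leray_kernel \<gamma> k z (s, \<alpha>) * leray_kernel \<gamma> k (s, \<alpha>) w
      = c\<^sup>2 * (B * g * of_real (\<alpha> powr \<gamma>)) ^ k * of_real (\<alpha> powr (\<gamma> - 1)) * of_real (aw powr (\<gamma> - 1))
        * (1 / (Complex a1 (s - sz) ^ (k + 1 + 1) * Complex a2 (sw - s) ^ (k + 1 + 1)))" for s
      unfolding leray_kernel_def leray_A_def z' w' fst_conv snd_conv a1_def[symmetric] a2_def[symmetric]
        c_def[symmetric] BB[symmetric] by (simp add: power_mult_distrib power2_eq_square)
    then have "(LINT s|lborel. leray_kernel \<gamma> k z (s, \<alpha>) * leray_kernel \<gamma> k (s, \<alpha>) w)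
      = c\<^sup>2 * (B * g * of_real (\<alpha> powr \<gamma>)) ^ k * of_real (\<alpha> powr (\<gamma> - 1)) * of_real (aw powr (\<gamma> - 1))
        * (LINT s|lborel. 1 / (Complex a1 (s - sz) ^ (k + 1 + 1) * Complex a2 (sw - s) ^ (k + 1 + 1)))"
      by (simp only: integral_mult_right_zero)
    also have "(LINT s|lborel. 1 / (Complex a1 (s - sz) ^ (k + 1 + 1) * Complex a2 (sw - s) ^ (k + 1 + 1)))
      = 2 * pi * of_nat ((k + 1 + (k + 1)) choose (k + 1)) / Complex (a1 + a2) (sw - sz) ^ (k + 1 + (k
          + 1) + 1)"
      by (rule line_integral_inverse_powers[OF a])
    also have "\<dots> = 2 * pi * Cb / (of_real (\<gamma> * \<alpha> powr \<gamma>) + D) ^ (2 * k + 3)"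
    proof -
      have "Complex (a1 + a2) (sw - sz) = of_real (\<gamma> * \<alpha> powr \<gamma>) + D"
        by (simp add: D_def leray_A_def complex_eq_iff a1_def a2_def algebra_simps)
      moreover have "k + 1 + (k + 1) = 2 * k + 2" "k + 1 + (k + 1) + 1 = 2 * k + 3" by auto
      ultimately show ?thesis unfolding Cb_def by (simp only: of_real_mult of_real_of_nat_eq)
    qed
    finally show ?thesis
      by (simp add: E_def h_def power_mult_distrib mult_ac)
  qed
  have int': "integrable (lborel \<Otimes>\<^sub>M rays) (case_prod (\<lambda>s \<alpha>. leray_kernel \<gamma> k z (s, \<alpha>)
      * leray_kernel \<gamma> k (s, \<alpha>) w))"
    using int by (simp add: halfplane_def case_prod_unfold)
  have "(LINT \<zeta>|halfplane. leray_kernel \<gamma> k z \<zeta> * leray_kernel \<gamma> k \<zeta> w)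
     = (LINT \<alpha>|rays. LINT s|lborel. leray_kernel \<gamma> k z (s, \<alpha>) * leray_kernel \<gamma> k (s, \<alpha>) w)"
    using integral_snd[OF int'] by (simp add: halfplane_def case_prod_unfold)
  also have "\<dots> = (LINT \<alpha>|rays. E * h \<alpha>)"
    by (intro Bochner_Integration.integral_cong) (auto simp: inner)
  finally have 1: "(LINT \<zeta>|halfplane. leray_kernel \<gamma> k z \<zeta> * leray_kernel \<gamma> k \<zeta> w) = (LINT \<alpha>|rays. E * h \<alpha>)" .
  have c0: "c \<noteq> 0" unfolding c_def of_real_eq_0_iff using \<gamma> by simp
  have B0: "B \<noteq> 0" using \<gamma> z' w' by (simp add: B_def leray_B_def)
  have Cb0: "Cb \<noteq> 0"
    unfolding Cb_def of_nat_eq_0_iff using zero_less_binomial[of "k + 1" "2 * k + 2"] by linarith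
  have E0: "E \<noteq> 0" using c0 B0 g0 Cb0 w' by (simp add: E_def)
  have "integrable rays (\<lambda>\<alpha>. LINT s|lborel. leray_kernel \<gamma> k z (s, \<alpha>) * leray_kernel \<gamma> k (s, \<alpha>) w)"
    by (rule integrable_snd[OF int'])
  then have "integrable rays (\<lambda>\<alpha>. E * h \<alpha>)"
    by (rule Bochner_Integration.integrable_cong[THEN iffD1, rotated 2]) (auto simp: inner)
  then have "integrable rays (\<lambda>\<alpha>. 1 / E * (E * h \<alpha>))"
    by - (rule integrable_mult_right)
  moreover have "1 / E * (E * h \<alpha>) = h \<alpha>" for \<alpha> using E0 by simp
  ultimately have "integrable rays h" by (simp only:)
  then have "(LINT \<alpha>|rays. h \<alpha>) = (fact k * fact (k + 1) / fact (2 * k + 2)) / (g ^ (k + 2) * D ^ (k + 2))"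
    using ray_integral_beta[OF \<gamma> ReD, of k] unfolding rays_as_einterval h_def g_def by blast
  then have 2: "(LINT \<alpha>|rays. E * h \<alpha>) = E * ((fact k * fact (k + 1) / fact (2 * k + 2)) / (g ^ (k + 2)
      * D ^ (k + 2)))"
    by simp
  have const: "c * (2 * pi * Cb) * (fact k * fact (k + 1) / fact (2 * k + 2)) = g\<^sup>2"
  proof -
    have "Cb = fact (2 * k + 2) / (fact (k + 1) * fact (k + 1))"
    proof -
      have le: "k + 1 \<le> 2 * k + 2" and diff: "2 * k + 2 - (k + 1) = k + 1" by simp_all
      from binomial_fact[OF le] show ?thesis unfolding Cb_def diff .
    qed
    moreover have "x / (y * y) * (v * y / x) = v / y" if "x \<noteq> 0" "y \<noteq> 0" for x y v :: complex
      using that by simp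
    ultimately have "Cb * (fact k * fact (k + 1) / fact (2 * k + 2)) = fact k / fact (k + 1)"
      by (simp only: fact_nonzero not_False_eq_True)
    also have "\<dots> = 1 / (of_nat k + 1)"
      by (simp add: add.commute)
    finally have "c * (2 * pi) * (Cb * (fact k * fact (k + 1) / fact (2 * k + 2)))
        = c * (2 * pi) * (1 / (of_nat k + 1))"
      by (simp only:)
    also have "\<dots> = complex_of_real (\<gamma>\<^sup>2 * (real k + 1) / (2 * pi) * (2 * pi) * (1 / (real k + 1)))"
      by (simp only: c_def of_real_mult of_real_divide of_real_add of_real_1 of_real_of_nat_eq of_real_numeral)
    also have "\<gamma>\<^sup>2 * (real k + 1) / (2 * pi) * (2 * pi) * (1 / (real k + 1)) = \<gamma>\<^sup>2"
      by simp
    finally show ?thesis by (simp add: g_def mult_ac)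
  qed
  define q :: complex where "q = fact k * fact (k + 1) / fact (2 * k + 2)"
  have "E * (q / (g ^ (k + 2) * D ^ (k + 2)))
     = c * B ^ k * of_real (aw powr (\<gamma> - 1)) * (c * (2 * pi * Cb) * q) * g ^ k / (g ^ (k + 2) * D ^ (k + 2))"
    by (simp add: E_def power2_eq_square mult_ac)
  also have "\<dots> = c * B ^ k * of_real (aw powr (\<gamma> - 1)) / D ^ (k + 2)"
    unfolding const[folded q_def] using g0 by (simp add: power_add power2_eq_square)
  also have "\<dots> = leray_kernel \<gamma> k z w"
    unfolding leray_kernel_def z' w' fst_conv snd_conv c_def[symmetric] B_def[symmetric] D_def[symmetric]
        by simp
  finally show ?thesis using 1 2[folded q_def] by simp
qed

section \<open>The radial operators\<close>

definition weighted_halfplane :: "real \<Rightarrow> (real \<times> real) measure" where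
  "weighted_halfplane r = density halfplane (\<lambda>x. ennreal (snd x powr r))"

lemma borel_measurable_weighted_halfplane [simp]:
  "borel_measurable (weighted_halfplane r) = borel_measurable halfplane"
  unfolding weighted_halfplane_def by (simp add: measurable_def)

lemma space_weighted_halfplane [simp]: "space (weighted_halfplane r) = space halfplane"
  by (simp add: weighted_halfplane_def)

lemma AE_weighted_halfplane: "(AE x in weighted_halfplane r. P x) \<longleftrightarrow> (AE x in halfplane. P x)"
  unfolding weighted_halfplane_def
  by (subst AE_density) (auto intro!: AE_cong simp: ennreal_less_zero_iff)

lemma nn_integral_weighted_halfplane:
  assumes "f \<in> borel_measurable halfplane"
  shows "(\<integral>\<^sup>+x. f x \<partial>weighted_halfplane r) = (\<integral>\<^sup>+x. f x * ennreal (snd x powr r) \<partial>halfplane)"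
  unfolding weighted_halfplane_def using assms by (subst nn_integral_density) (auto simp: mult.commute)

definition leray_op :: "real \<Rightarrow> nat \<Rightarrow> (real \<times> real \<Rightarrow> complex) \<Rightarrow> real \<times> real \<Rightarrow> complex" where
  "leray_op \<gamma> k u z = (LINT \<zeta>|halfplane. leray_kernel \<gamma> k z \<zeta> * u \<zeta>)"

lemma measurable_leray_op [measurable]:
  assumes [measurable]: "u \<in> borel_measurable halfplane"
  shows "leray_op \<gamma> k u \<in> borel_measurable halfplane"
proof -
  interpret sigma_finite_measure halfplane by (rule sigma_finite_halfplane)
  show ?thesis unfolding leray_op_def[abs_def] by measurable
qed

lemma leray_op_cong_AE:
  assumes z: "z \<in> space halfplane"
    and [measurable]: "u \<in> borel_measurable halfplane" "v \<in> borel_measurable halfplane"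
    and "AE x in halfplane. u x = v x"
  shows "leray_op \<gamma> k u z = leray_op \<gamma> k v z"
proof -
  have [measurable]: "(\<lambda>_. z) \<in> halfplane \<rightarrow>\<^sub>M halfplane" using z by (rule measurable_const)
  show ?thesis unfolding leray_op_def
    using assms(4) by (intro integral_cong_AE) auto
qed

lemma leray_op_add:
  assumes "integrable halfplane (\<lambda>\<zeta>. leray_kernel \<gamma> k z \<zeta> * u \<zeta>)"
    and "integrable halfplane (\<lambda>\<zeta>. leray_kernel \<gamma> k z \<zeta> * v \<zeta>)"
  shows "leray_op \<gamma> k (\<lambda>x. u x + v x) z = leray_op \<gamma> k u z + leray_op \<gamma> k v z"
  unfolding leray_op_def using assms by (simp add: distrib_left)

lemma leray_op_cmult: "leray_op \<gamma> k (\<lambda>x. c * u x) z = c * leray_op \<gamma> k u z"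
  unfolding leray_op_def by (simp add: mult.left_commute)

lemma kernel_bound_AE_finite:
  assumes C: "kernel_bound \<gamma> r C"
    and F[measurable]: "F \<in> borel_measurable halfplane"
    and fin: "(\<integral>\<^sup>+\<zeta>. (F \<zeta>)\<^sup>2 * ennreal (snd \<zeta> powr r) \<partial>halfplane) < \<infinity>"
  shows "AE z in halfplane. (abs_leray \<gamma> k F z) < \<infinity>"
proof -
  interpret sigma_finite_measure halfplane by (rule sigma_finite_halfplane)
  have "(\<integral>\<^sup>+z. (abs_leray \<gamma> k F z)\<^sup>2 * ennreal (snd z powr r) \<partial>halfplane)
       \<le> ennreal C * (\<integral>\<^sup>+\<zeta>. (F \<zeta>)\<^sup>2 * ennreal (snd \<zeta> powr r) \<partial>halfplane)"
    using C F by (simp add: kernel_bound_def)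
  also have "\<dots> < \<infinity>" using fin by (simp add: ennreal_mult_less_top)
  finally have "AE z in halfplane. (abs_leray \<gamma> k F z)\<^sup>2 * ennreal (snd z powr r) \<noteq> \<infinity>"
    by (intro nn_integral_PInf_AE) auto
  then show ?thesis
  proof (rule AE_mp, intro AE_I2 impI)
    fix z assume "z \<in> space halfplane"
      and "(abs_leray \<gamma> k F z)\<^sup>2 * ennreal (snd z powr r) \<noteq> \<infinity>"
    then show "(abs_leray \<gamma> k F z) < \<infinity>"
      by (auto simp: ennreal_mult_eq_top_iff power_eq_top_ennreal less_top)
  qed
qed

lemma l2sq_weighted_halfplane:
  assumes [measurable]: "u \<in> borel_measurable halfplane"
  shows "l2sq (weighted_halfplane r) u = (\<integral>\<^sup>+x. (ennreal (cmod (u x)))\<^sup>2 * ennreal (snd x powr r) \<partial>halfplane)"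
  unfolding l2sq_def by (subst nn_integral_weighted_halfplane) (auto simp: ennreal_power)

lemma AE_integrable_leray_kernel:
  assumes C: "kernel_bound \<gamma> r C" and u: "square_integrable (weighted_halfplane r) u"
  shows "AE z in halfplane. integrable halfplane (\<lambda>\<zeta>. leray_kernel \<gamma> k z \<zeta> * u \<zeta>)"
proof -
  have [measurable]: "u \<in> borel_measurable halfplane"
    using square_integrable_measurable[OF u] by simp
  have "(\<integral>\<^sup>+\<zeta>. (ennreal (cmod (u \<zeta>)))\<^sup>2 * ennreal (snd \<zeta> powr r) \<partial>halfplane) < \<infinity>"
    using u by (simp add: square_integrable_iff_l2sq l2sq_weighted_halfplane)
  then have "AE z in halfplane. (abs_leray \<gamma> k (\<lambda>\<zeta>. ennreal (cmod (u \<zeta>))) z) < \<infinity>"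
    by (intro kernel_bound_AE_finite[OF C]) auto
  then show ?thesis
  proof (rule AE_mp, intro AE_I2 impI integrableI_bounded)
    fix z assume z: "z \<in> space halfplane"
    have [measurable]: "(\<lambda>_. z) \<in> halfplane \<rightarrow>\<^sub>M halfplane" using z by (rule measurable_const)
    show "(\<lambda>\<zeta>. leray_kernel \<gamma> k z \<zeta> * u \<zeta>) \<in> borel_measurable halfplane" by measurable
    assume "(abs_leray \<gamma> k (\<lambda>\<zeta>. ennreal (cmod (u \<zeta>))) z) < \<infinity>"
    then show "(\<integral>\<^sup>+\<zeta>. ennreal (norm (leray_kernel \<gamma> k z \<zeta> * u \<zeta>)) \<partial>halfplane) < \<infinity>"
      by (simp add: norm_mult ennreal_mult)
  qed
qed

lemma norm_integral_le_nn_integral: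
  fixes f :: "'a \<Rightarrow> complex"
  shows "ennreal (cmod (LINT x|M. f x)) \<le> (\<integral>\<^sup>+x. ennreal (cmod (f x)) \<partial>M)"
  by (cases "integrable M f") (auto simp: not_integrable_integral_eq integral_norm_bound_ennreal)

lemma leray_op_bounded:
  assumes C: "kernel_bound \<gamma> r C" and [measurable]: "u \<in> borel_measurable halfplane"
  shows "l2sq (weighted_halfplane r) (leray_op \<gamma> k u) \<le> ennreal C * l2sq (weighted_halfplane r) u"
proof -
  have "l2sq (weighted_halfplane r) (leray_op \<gamma> k u)
      \<le> (\<integral>\<^sup>+z. (abs_leray \<gamma> k (\<lambda>\<zeta>. ennreal (cmod (u \<zeta>))) z)\<^sup>2
           * ennreal (snd z powr r) \<partial>halfplane)"
  proof (subst l2sq_weighted_halfplane, measurable, intro nn_integral_mono mult_right_mono power_mono)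
    fix z
    show "ennreal (cmod (leray_op \<gamma> k u z)) \<le> (abs_leray \<gamma> k (\<lambda>\<zeta>. ennreal (cmod (u \<zeta>))) z)"
      unfolding leray_op_def using norm_integral_le_nn_integral[of halfplane "\<lambda>\<zeta>. leray_kernel \<gamma> k z \<zeta> * u \<zeta>"]
      by (simp add: norm_mult ennreal_mult)
  qed auto
  also have "\<dots> \<le> ennreal C * l2sq (weighted_halfplane r) u"
    using C by (simp add: kernel_bound_def l2sq_weighted_halfplane)
  finally show ?thesis .
qed

lemma square_integrable_leray_op:
  assumes C: "kernel_bound \<gamma> r C" and u: "square_integrable (weighted_halfplane r) u"
  shows "square_integrable (weighted_halfplane r) (leray_op \<gamma> k u)"
proof -
  have [measurable]: "u \<in> borel_measurable halfplane"
    using square_integrable_measurable[OF u] by simp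
  have "ennreal C * l2sq (weighted_halfplane r) u < \<infinity>"
    using u by (simp add: square_integrable_iff_l2sq ennreal_mult_less_top)
  then show ?thesis
    using leray_op_bounded[OF C, of u k] by (auto simp: square_integrable_iff_l2sq)
qed

text \<open>The reproducing identity under the integral sign. For almost every \<open>z\<close> the order of integration
  can be exchanged, because the positive operator with kernel \<open>|K|\<close> maps \<open>L\<^sup>2\<close> to itself and can
  therefore be applied twice.\<close>

lemma leray_op_idempotent:
  assumes \<gamma>: "\<gamma> > 1" and C: "kernel_bound \<gamma> r C" and u: "square_integrable (weighted_halfplane r) u"
  shows "AE z in halfplane. leray_op \<gamma> k (leray_op \<gamma> k u) z = leray_op \<gamma> k u z"
proof -
  interpret sigma_finite_measure halfplane by (rule sigma_finite_halfplane)
  interpret P: pair_sigma_finite halfplane halfplane ..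
  have [measurable]: "u \<in> borel_measurable halfplane"
    using square_integrable_measurable[OF u] by simp
  define G where "G \<zeta> = abs_leray \<gamma> k (\<lambda>w. ennreal (cmod (u w))) \<zeta>" for \<zeta>
  have [measurable]: "G \<in> borel_measurable halfplane" unfolding G_def by measurable
  have "(\<integral>\<^sup>+\<zeta>. (G \<zeta>)\<^sup>2 * ennreal (snd \<zeta> powr r) \<partial>halfplane) \<le> ennreal C * l2sq (weighted_halfplane r) u"
    using C by (simp add: kernel_bound_def l2sq_weighted_halfplane G_def)
  also have "\<dots> < \<infinity>" using u by (simp add: square_integrable_iff_l2sq ennreal_mult_less_top)
  finally have "AE z in halfplane. (abs_leray \<gamma> k G z) < \<infinity>"
    by (intro kernel_bound_AE_finite[OF C]) auto
  then show ?thesis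
  proof (rule AE_mp, intro AE_I2 impI)
    fix z assume z: "z \<in> space halfplane"
      and fin: "(abs_leray \<gamma> k G z) < \<infinity>"
    have mz [measurable]: "(\<lambda>_. z) \<in> M \<rightarrow>\<^sub>M halfplane" for M :: "'b measure" using z by (rule measurable_const)
    have int: "integrable (halfplane \<Otimes>\<^sub>M halfplane) (case_prod (\<lambda>\<zeta> w. leray_kernel \<gamma> k z \<zeta>
        * (leray_kernel \<gamma> k \<zeta> w * u w)))"
    proof (rule integrableI_bounded)
      show "case_prod (\<lambda>\<zeta> w. leray_kernel \<gamma> k z \<zeta> * (leray_kernel \<gamma> k \<zeta> w * u w))
          \<in> borel_measurable (halfplane \<Otimes>\<^sub>M halfplane)"
        by measurable
      have "(\<integral>\<^sup>+x. ennreal (norm (case_prod (\<lambda>\<zeta> w. leray_kernel \<gamma> k z \<zeta> * (leray_kernel \<gamma> k \<zeta> w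
          * u w)) x)) \<partial>(halfplane \<Otimes>\<^sub>M halfplane))
        = (\<integral>\<^sup>+\<zeta>. \<integral>\<^sup>+w. ennreal (cmod (leray_kernel \<gamma> k z \<zeta>)) * (ennreal (cmod (leray_kernel \<gamma> k \<zeta> w))
            * ennreal (cmod (u w))) \<partial>halfplane \<partial>halfplane)"
        by (subst nn_integral_fst[symmetric]) (auto simp: norm_mult ennreal_mult)
      also have "\<dots> = (abs_leray \<gamma> k G z)"
      proof (intro nn_integral_cong)
        fix \<zeta> assume \<zeta>: "\<zeta> \<in> space halfplane"
        have [measurable]: "(\<lambda>_. \<zeta>) \<in> halfplane \<rightarrow>\<^sub>M halfplane" using \<zeta> by (rule measurable_const)
        show "(\<integral>\<^sup>+w. ennreal (cmod (leray_kernel \<gamma> k z \<zeta>)) * (ennreal (cmod (leray_kernel \<gamma> k \<zeta> w))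
            * ennreal (cmod (u w))) \<partial>halfplane)
          = ennreal (cmod (leray_kernel \<gamma> k z \<zeta>)) * G \<zeta>"
          unfolding G_def by (intro nn_integral_cmult) measurable
      qed
      finally show "(\<integral>\<^sup>+x. ennreal (norm (case_prod (\<lambda>\<zeta> w. leray_kernel \<gamma> k z \<zeta> * (leray_kernel \<gamma> k \<zeta> w
          * u w)) x)) \<partial>(halfplane \<Otimes>\<^sub>M halfplane)) < \<infinity>"
        using fin by simp
    qed
    have "leray_op \<gamma> k (leray_op \<gamma> k u) z
        = (LINT \<zeta>|halfplane. LINT w|halfplane. leray_kernel \<gamma> k z \<zeta> * (leray_kernel \<gamma> k \<zeta> w * u w))"
      unfolding leray_op_def by simp
    also have "\<dots> = (LINT w|halfplane. LINT \<zeta>|halfplane. leray_kernel \<gamma> k z \<zeta> * (leray_kernel \<gamma> k \<zeta> w * u w))"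
      by (rule P.Fubini_integral[OF int, symmetric])
    also have "\<dots> = (LINT w|halfplane. leray_kernel \<gamma> k z w * u w)"
    proof (rule integral_cong_AE)
      show "(\<lambda>w. LINT \<zeta>|halfplane. leray_kernel \<gamma> k z \<zeta> * (leray_kernel \<gamma> k \<zeta> w * u w))
          \<in> borel_measurable halfplane"
        "(\<lambda>w. leray_kernel \<gamma> k z w * u w) \<in> borel_measurable halfplane" by measurable
      show "AE w in halfplane. (LINT \<zeta>|halfplane. leray_kernel \<gamma> k z \<zeta> * (leray_kernel \<gamma> k \<zeta> w * u w))
          = leray_kernel \<gamma> k z w * u w"
        using P.AE_integrable_snd[OF int]
      proof (rule AE_mp, intro AE_I2 impI)
        fix w assume w: "w \<in> space halfplane"
          and "integrable halfplane (\<lambda>\<zeta>. leray_kernel \<gamma> k z \<zeta> * (leray_kernel \<gamma> k \<zeta> w * u w))"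
        then have i: "integrable halfplane (\<lambda>\<zeta>. leray_kernel \<gamma> k z \<zeta> * leray_kernel \<gamma> k \<zeta> w * u w)"
          by (simp add: mult.assoc)
        show "(LINT \<zeta>|halfplane. leray_kernel \<gamma> k z \<zeta> * (leray_kernel \<gamma> k \<zeta> w * u w))
            = leray_kernel \<gamma> k z w * u w"
        proof (cases "u w = 0")
          case False
          have "integrable halfplane (\<lambda>\<zeta>. leray_kernel \<gamma> k z \<zeta> * leray_kernel \<gamma> k \<zeta> w * u w * (1 / u w))"
            using i by - (rule integrable_mult_left)
          then have "integrable halfplane (\<lambda>\<zeta>. leray_kernel \<gamma> k z \<zeta> * leray_kernel \<gamma> k \<zeta> w)"
            using False by simp
          from leray_kernel_reproducing[OF \<gamma> z w this]
          have "(LINT \<zeta>|halfplane. leray_kernel \<gamma> k z \<zeta> * leray_kernel \<gamma> k \<zeta> w * u w)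
              = leray_kernel \<gamma> k z w * u w"
            by simp
          then show ?thesis by (simp add: mult.assoc)
        qed simp
      qed
    qed
    finally show "leray_op \<gamma> k (leray_op \<gamma> k u) z = leray_op \<gamma> k u z"
      unfolding leray_op_def .
  qed
qed

section \<open>Fourier series on the circle\<close>

definition circle :: "real measure" where
  "circle = restrict_space lborel {0..<2 * pi}"

lemma space_circle [simp]: "space circle = {0..<2 * pi}"
  by (simp add: circle_def space_restrict_space)

lemma borel_measurable_circleI: "f \<in> borel_measurable borel \<Longrightarrow> f \<in> borel_measurable circle"
  unfolding circle_def by (intro measurable_restrict_space1) simp

lemma measurable_cis [measurable]: "cis \<in> borel_measurable borel"
  by (intro borel_measurable_continuous_onI continuous_intros)

lemma finite_measure_circle: "finite_measure circle"
proof (rule finite_measureI)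
  have "emeasure circle (space circle) \<le> emeasure lborel {0..2 * pi}"
    unfolding circle_def by (subst emeasure_restrict_space) (auto simp: space_restrict_space intro!:
        emeasure_mono)
  then show "emeasure circle (space circle) \<noteq> \<infinity>"
    by (auto simp: top_unique)
qed

lemma sigma_finite_circle: "sigma_finite_measure circle"
  using finite_measure_circle by (rule finite_measure.axioms)

lemma integrable_circle_bounded:
  fixes f :: "real \<Rightarrow> complex"
  assumes "f \<in> borel_measurable circle" "\<And>x. x \<in> {0..<2*pi} \<Longrightarrow> cmod (f x) \<le> B"
  shows "integrable circle f"
  by (rule finite_measure.integrable_const_bound[OF finite_measure_circle, where B = B])
     (use assms in auto)

lemma circle_integral_cis:
  "(LINT \<theta>|circle. cis (of_int n * \<theta>)) = (if n = 0 then 2 * of_real pi else 0)"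
proof (cases "n = 0")
  case True
  have "measure lborel {0..<2 * pi} = 2 * pi" by simp
  then show ?thesis
    using True unfolding circle_def by (simp add: measure_restrict_space measure_def[symmetric]
        scaleR_conv_of_real)
next
  case False
  define F where "F \<theta> = cis (of_int n * \<theta>) / (\<i> * of_int n)" for \<theta>
  have dF: "(F has_vector_derivative cis (of_int n * \<theta>)) (at \<theta> within A)" for \<theta> A
  proof -
    have "((\<lambda>\<theta>. cis (of_int n * \<theta>)) has_vector_derivative of_int n *\<^sub>R (\<i> * cis (of_int n
        * \<theta>))) (at \<theta> within A)"
      by (auto intro!: derivative_eq_intros simp: has_vector_derivative_complex_iff
          has_real_derivative_iff_has_vector_derivative[symmetric])
    then have "(F has_vector_derivative (of_int n *\<^sub>R (\<i> * cis (of_int n * \<theta>))) / (\<i>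
        * of_int n)) (at \<theta> within A)"
      unfolding F_def divide_inverse by (intro has_vector_derivative_mult_left)
    then show ?thesis using False by (simp add: scaleR_conv_of_real)
  qed
  have "(LINT \<theta>|circle. cis (of_int n * \<theta>)) = (LINT \<theta>|lborel. indicator {0..<2 * pi} \<theta> *\<^sub>R cis (of_int n * \<theta>))"
    unfolding circle_def by (subst integral_restrict_space) auto
  also have "\<dots> = (LINT \<theta>|lborel. indicator {0..2 * pi} \<theta> *\<^sub>R cis (of_int n * \<theta>))"
  proof (intro integral_cong_AE)
    have "AE \<theta> in lborel. \<theta> \<noteq> 2 * pi" by (rule AE_lborel_singleton)
    then show "AE \<theta> in lborel. indicator {0..<2 * pi} \<theta> *\<^sub>R cis (of_int n * \<theta>)
        = indicator {0..2 * pi} \<theta> *\<^sub>R cis (of_int n * \<theta>)"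
      by (rule AE_mp) (auto intro!: AE_I2 simp: indicator_def)
  qed measurable
  also have "\<dots> = F (2 * pi) - F 0"
    by (rule integral_FTC_atLeastAtMost) (auto intro!: dF continuous_intros)
  also have "\<dots> = 0"
    using cis_multiple_2pi[of "of_int n"] by (simp add: F_def mult_ac)
  finally show ?thesis using False by simp
qed

lemma parseval_finite:
  fixes a :: "int \<Rightarrow> complex"
  assumes "finite S"
  shows "(\<integral>\<^sup>+\<theta>. ennreal ((cmod (\<Sum>k\<in>S. a k * cis (of_int k * \<theta>)))\<^sup>2) \<partial>circle)
      = ennreal (2 * pi * (\<Sum>k\<in>S. (cmod (a k))\<^sup>2))"
    and "(LINT \<theta>|circle. (\<Sum>k\<in>S. a k * cis (of_int k * \<theta>)) * cis (- of_int j * \<theta>))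
        = (if j \<in> S then 2 * of_real pi * a j else 0)"
proof -
  define h where "h \<theta> = (\<Sum>k\<in>S. a k * cis (of_int k * \<theta>))" for \<theta>
  have [measurable]: "(\<lambda>\<theta>. cis (of_int k * \<theta>)) \<in> borel_measurable circle"
    "(\<lambda>\<theta>. cis (- of_int k * \<theta>)) \<in> borel_measurable circle"
    "(\<lambda>\<theta>. cis (- (of_int k * \<theta>))) \<in> borel_measurable circle" for k
    by (intro borel_measurable_circleI; measurable)+
  have c: "integrable circle (\<lambda>\<theta>. cis (of_int n * \<theta>))" for n
    by (rule integrable_circle_bounded[where B = 1]) auto
  have coeff: "(LINT \<theta>|circle. h \<theta> * cis (- of_int j * \<theta>)) = (if j \<in> S then 2 * of_real pi * a j else 0)" for j
  proof -
    have "h \<theta> * cis (- of_int j * \<theta>) = (\<Sum>k\<in>S. a k * cis (of_int (k - j) * \<theta>))" for \<theta>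
      unfolding h_def sum_distrib_right
      by (intro sum.cong refl) (simp add: mult.assoc cis_mult algebra_simps)
    then have "(LINT \<theta>|circle. h \<theta> * cis (- of_int j * \<theta>))
        = (\<Sum>k\<in>S. a k * (LINT \<theta>|circle. cis (of_int (k - j) * \<theta>)))"
      by (simp add: Bochner_Integration.integral_sum c del: of_int_diff)
    also have "\<dots> = (\<Sum>k\<in>S. if k = j then 2 * of_real pi * a j else 0)"
      unfolding circle_integral_cis by (intro sum.cong) auto
    finally show ?thesis using assms by simp
  qed
  then show "(LINT \<theta>|circle. (\<Sum>k\<in>S. a k * cis (of_int k * \<theta>)) * cis (- of_int j * \<theta>))
      = (if j \<in> S then 2 * of_real pi * a j else 0)"
    by (simp add: h_def)
  have hb: "cmod (h \<theta>) \<le> (\<Sum>k\<in>S. cmod (a k))" for \<theta>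
    unfolding h_def by (rule order_trans[OF norm_sum]) (simp add: norm_mult)
  have hm [measurable]: "h \<in> borel_measurable circle" unfolding h_def by measurable
  have "complex_of_real ((cmod (h \<theta>))\<^sup>2) = (\<Sum>j\<in>S. cnj (a j) * (h \<theta> * cis (- of_int j * \<theta>)))" for \<theta>
    unfolding complex_norm_square by (subst (2) h_def) (simp add: sum_distrib_left cis_cnj mult_ac)
  then have "(LINT \<theta>|circle. complex_of_real ((cmod (h \<theta>))\<^sup>2))
      = (LINT \<theta>|circle. (\<Sum>j\<in>S. cnj (a j) * (h \<theta> * cis (- of_int j * \<theta>))))"
    by (simp only:)
  also have "\<dots> = (\<Sum>j\<in>S. cnj (a j) * (LINT \<theta>|circle. h \<theta> * cis (- of_int j * \<theta>)))"
    by (subst Bochner_Integration.integral_sum)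
      (auto intro!: integrable_mult_right integrable_circle_bounded[where B
          = "\<Sum>k\<in>S. cmod (a k)"] simp: norm_mult hb)
  also have "\<dots> = complex_of_real (2 * pi * (\<Sum>k\<in>S. (cmod (a k))\<^sup>2))"
    unfolding coeff of_real_mult of_real_sum complex_norm_square
    by (simp add: sum_distrib_left mult_ac)
  finally have I: "(LINT \<theta>|circle. (cmod (h \<theta>))\<^sup>2) = 2 * pi * (\<Sum>k\<in>S. (cmod (a k))\<^sup>2)"
    unfolding integral_complex_of_real of_real_eq_iff .
  have "integrable circle (\<lambda>\<theta>. (cmod (h \<theta>))\<^sup>2)"
    by (rule finite_measure.integrable_const_bound[OF finite_measure_circle, where B = "(\<Sum>k\<in>S. cmod (a k))\<^sup>2"])
       (auto intro!: power_mono hb)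
  from nn_integral_eq_integral[OF this] show "(\<integral>\<^sup>+\<theta>. ennreal ((cmod (\<Sum>k\<in>S. a k * cis (of_int k
      * \<theta>)))\<^sup>2) \<partial>circle) = ennreal (2 * pi * (\<Sum>k\<in>S. (cmod (a k))\<^sup>2))"
    unfolding I by (simp add: h_def)
qed

lemma square_integrable_circle_integrable:
  fixes g :: "real \<Rightarrow> complex"
  assumes [measurable]: "g \<in> borel_measurable circle" and fin: "(\<integral>\<^sup>+\<theta>. ennreal ((cmod (g \<theta>))\<^sup>2) \<partial>circle) < \<infinity>"
  shows "integrable circle g"
proof (rule Bochner_Integration.integrable_bound)
  have "integrable circle (\<lambda>x. (cmod (g x))\<^sup>2)"
    using fin by (intro integrableI_bounded) auto
  then show "integrable circle (\<lambda>x. 1 + (cmod (g x))\<^sup>2)"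
    using finite_measure.integrable_const[OF finite_measure_circle, of "1::real"]
    by (intro Bochner_Integration.integrable_add)
  show "AE x in circle. norm (g x) \<le> norm (1 + (cmod (g x))\<^sup>2)"
  proof (rule AE_I2)
    fix x
    have "2 * cmod (g x) \<le> 1 + (cmod (g x))\<^sup>2"
      using sum_squares_bound[of 1 "cmod (g x)"] by simp
    then show "norm (g x) \<le> norm (1 + (cmod (g x))\<^sup>2)"
      using zero_le_power2[of "cmod (g x)"] by (simp only: real_norm_def abs_of_nonneg)
  qed
qed fact

text \<open>Expand \<open>0 \<le> \<parallel>g - h\<parallel>\<^sup>2\<close>, where \<open>h\<close> is the partial Fourier sum of \<open>g\<close> over \<open>S\<close>.\<close>

lemma bessel_inequality:
  fixes g :: "real \<Rightarrow> complex"
  assumes gm[measurable]: "g \<in> borel_measurable circle" and fin: "(\<integral>\<^sup>+\<theta>. ennreal ((cmod (g \<theta>))\<^sup>2) \<partial>circle) < \<infinity>"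
    and S: "finite S"
  defines "c k \<equiv> 1 / (2 * of_real pi) * (LINT \<theta>|circle. g \<theta> * cis (- of_int k * \<theta>))"
  shows "ennreal (2 * pi * (\<Sum>k\<in>S. (cmod (c k))\<^sup>2)) \<le> (\<integral>\<^sup>+\<theta>. ennreal ((cmod (g \<theta>))\<^sup>2) \<partial>circle)"
proof -
  define h where "h \<theta> = (\<Sum>k\<in>S. c k * cis (of_int k * \<theta>))" for \<theta>
  have [measurable]: "(\<lambda>\<theta>. cis (of_int k * \<theta>)) \<in> borel_measurable circle"
    "(\<lambda>\<theta>. cis (- of_int k * \<theta>)) \<in> borel_measurable circle"
    "(\<lambda>\<theta>. cis (- (of_int k * \<theta>))) \<in> borel_measurable circle" for k
    by (intro borel_measurable_circleI; measurable)+
  have hm [measurable]: "h \<in> borel_measurable circle" unfolding h_def by measurable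
  have hb: "cmod (h \<theta>) \<le> (\<Sum>k\<in>S. cmod (c k))" for \<theta>
    unfolding h_def by (rule order_trans[OF norm_sum]) (simp add: norm_mult)
  have gi: "integrable circle g" using gm fin by (rule square_integrable_circle_integrable)
  have g2: "integrable circle (\<lambda>x. (cmod (g x))\<^sup>2)"
    using fin by (intro integrableI_bounded) auto
  have h2: "integrable circle (\<lambda>\<theta>. (cmod (h \<theta>))\<^sup>2)"
    by (rule finite_measure.integrable_const_bound[OF finite_measure_circle, where B = "(\<Sum>k\<in>S. cmod (c k))\<^sup>2"])
       (auto intro!: power_mono hb)
  have gc: "integrable circle (\<lambda>\<theta>. g \<theta> * cis (of_int k * \<theta>))" for k
    by (rule Bochner_Integration.integrable_bound[OF gi]) (auto simp: norm_mult)
  define s where "s = 2 * pi * (\<Sum>k\<in>S. (cmod (c k))\<^sup>2)"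
  have s0: "0 \<le> s" unfolding s_def by (intro mult_nonneg_nonneg sum_nonneg) auto
  have Ih: "(LINT \<theta>|circle. (cmod (h \<theta>))\<^sup>2) = s"
  proof -
    have "ennreal (LINT \<theta>|circle. (cmod (h \<theta>))\<^sup>2) = ennreal s"
      using nn_integral_eq_integral[OF h2] parseval_finite(1)[OF S, of c] by (simp add: h_def s_def)
    then show ?thesis using s0 by (subst (asm) ennreal_inj) auto
  qed
  have gh: "g \<theta> * cnj (h \<theta>) = (\<Sum>k\<in>S. cnj (c k) * (g \<theta> * cis (- of_int k * \<theta>)))" for \<theta>
    by (simp add: h_def sum_distrib_left cis_cnj mult_ac)
  have gc': "integrable circle (\<lambda>\<theta>. g \<theta> * cis (- of_int k * \<theta>))" for k
    using gc[of "- k"] by simp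
  have igh: "integrable circle (\<lambda>\<theta>. g \<theta> * cnj (h \<theta>))"
    unfolding gh by (intro Bochner_Integration.integrable_sum integrable_mult_right gc')
  have "(LINT \<theta>|circle. g \<theta> * cnj (h \<theta>)) = (\<Sum>k\<in>S. cnj (c k) * (LINT \<theta>|circle. g \<theta> * cis (- of_int k * \<theta>)))"
    unfolding gh by (subst Bochner_Integration.integral_sum) (intro integrable_mult_right gc', simp)
  also have "\<dots> = (\<Sum>k\<in>S. cnj (c k) * (2 * of_real pi * c k))"
    by (simp add: c_def)
  also have "\<dots> = complex_of_real s"
    unfolding s_def of_real_mult of_real_sum complex_norm_square
    by (simp add: sum_distrib_left mult_ac)
  finally have "Re (LINT \<theta>|circle. g \<theta> * cnj (h \<theta>)) = s" by simp
  then have Igh: "(LINT \<theta>|circle. Re (g \<theta> * cnj (h \<theta>))) = s"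
    using integral_Re[OF igh] by (simp del: times_complex.sel)
  have "0 \<le> (LINT \<theta>|circle. (cmod (g \<theta> - h \<theta>))\<^sup>2)"
    by (intro Bochner_Integration.integral_nonneg) auto
  also have "(\<lambda>\<theta>. (cmod (g \<theta> - h \<theta>))\<^sup>2) = (\<lambda>\<theta>. (cmod (g \<theta>))\<^sup>2 - 2 * Re (g \<theta> * cnj (h \<theta>)) + (cmod (h \<theta>))\<^sup>2)"
    by (intro ext, simp only: cmod_power2) (simp add: power2_eq_square algebra_simps)
  also have "(LINT \<theta>|circle. (cmod (g \<theta>))\<^sup>2 - 2 * Re (g \<theta> * cnj (h \<theta>)) + (cmod (h \<theta>))\<^sup>2)
      = (LINT \<theta>|circle. (cmod (g \<theta>))\<^sup>2) - 2 * s + s"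
    using g2 h2 integrable_Re[OF igh] by (simp add: Ih Igh del: times_complex.sel)
  finally have "s \<le> (LINT \<theta>|circle. (cmod (g \<theta>))\<^sup>2)" by simp
  then have "ennreal s \<le> ennreal (LINT \<theta>|circle. (cmod (g \<theta>))\<^sup>2)" by (rule ennreal_leI)
  also have "\<dots> = (\<integral>\<^sup>+\<theta>. ennreal ((cmod (g \<theta>))\<^sup>2) \<partial>circle)"
    using nn_integral_eq_integral[OF g2] by simp
  finally show ?thesis by (simp add: s_def)
qed

section \<open>Polar coordinates on the hypersurface\<close>

definition polar_point :: "real \<Rightarrow> real \<times> real \<Rightarrow> real \<Rightarrow> complex \<times> complex" where
  "polar_point \<gamma> x \<theta> = hparam \<gamma> (fst x, snd x, \<theta>)"

lemma measurable_hparam_borel [measurable (raw)]: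
  assumes [measurable]: "f \<in> borel_measurable M" "g \<in> borel_measurable M" "h \<in> borel_measurable M"
  shows "(\<lambda>x. hparam \<gamma> (f x, g x, h x)) \<in> borel_measurable M"
proof -
  have "(\<lambda>x. (complex_of_real (g x) * cis (h x), Complex (f x) (g x powr \<gamma>))) \<in> borel_measurable M"
    by (intro borel_measurable_Pair) measurable
  then show ?thesis by (simp add: hparam_def)
qed

lemma hparam_in_hypersurface: "\<alpha> > 0 \<Longrightarrow> hparam \<gamma> (s, \<alpha>, \<theta>) \<in> hypersurface \<gamma>"
  by (simp add: hparam_def hypersurface_def norm_mult)

lemma measurable_snd_circle [measurable (raw)]:
  "f \<in> M \<rightarrow>\<^sub>M N \<Otimes>\<^sub>M circle \<Longrightarrow> (\<lambda>x. snd (f x)) \<in> borel_measurable M"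
  using measurable_compose[OF measurable_compose[OF _ measurable_snd, of f M N circle]
      borel_measurable_circleI[of "\<lambda>x. x"]]
  by simp

lemma measurable_polar_point:
  "(\<lambda>p. polar_point \<gamma> (fst p) (snd p)) \<in> halfplane \<Otimes>\<^sub>M circle \<rightarrow>\<^sub>M restrict_space borel (hypersurface \<gamma>)"
proof (rule measurable_restrict_space2)
  show "(\<lambda>p. polar_point \<gamma> (fst p) (snd p)) \<in> space (halfplane \<Otimes>\<^sub>M circle) \<rightarrow> hypersurface \<gamma>"
    by (auto simp: polar_point_def space_pair_measure hparam_in_hypersurface)
  show "(\<lambda>p. polar_point \<gamma> (fst p) (snd p)) \<in> borel_measurable (halfplane \<Otimes>\<^sub>M circle)"
    unfolding polar_point_def by measurable
qed

lemma borel_measurable_hmeasure [simp]: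
  "borel_measurable (hmeasure \<gamma> r) = borel_measurable (restrict_space borel (hypersurface \<gamma>))"
  by (simp add: hmeasure_def measurable_def)

abbreviation hmeasurable :: "real \<Rightarrow> (complex \<times> complex \<Rightarrow> 'a::topological_space) \<Rightarrow> bool" where
  "hmeasurable \<gamma> f \<equiv> f \<in> borel_measurable (restrict_space borel (hypersurface \<gamma>))"

abbreviation fibre_sq :: "real \<Rightarrow> (complex \<times> complex \<Rightarrow> complex) \<Rightarrow> real \<times> real \<Rightarrow> ennreal" where
  "fibre_sq \<gamma> f x \<equiv> (\<integral>\<^sup>+\<theta>. ennreal ((cmod (f (polar_point \<gamma> x \<theta>)))\<^sup>2) \<partial>circle)"

lemma measurable_on_polar_point:
  assumes "g \<in> restrict_space borel (hypersurface \<gamma>) \<rightarrow>\<^sub>M N"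
  shows "(\<lambda>p. g (polar_point \<gamma> (fst p) (snd p))) \<in> halfplane \<Otimes>\<^sub>M circle \<rightarrow>\<^sub>M N"
  using measurable_compose[OF measurable_polar_point assms] .

lemma measurable_on_polar_circle:
  assumes "g \<in> restrict_space borel (hypersurface \<gamma>) \<rightarrow>\<^sub>M N" "x \<in> space halfplane"
  shows "(\<lambda>\<theta>. g (polar_point \<gamma> x \<theta>)) \<in> circle \<rightarrow>\<^sub>M N"
  using measurable_Pair2[OF measurable_on_polar_point[OF assms(1)] assms(2)] by simp

text \<open>The defining parametrization, with the angle integrated first; every norm on the hypersurface is
  computed in this way.\<close>

lemma nn_integral_hmeasure:
  fixes g :: "complex \<times> complex \<Rightarrow> ennreal"
  assumes g: "hmeasurable \<gamma> g"
  shows "(\<integral>\<^sup>+z. g z \<partial>hmeasure \<gamma> r) = (\<integral>\<^sup>+x. (\<integral>\<^sup>+\<theta>. g (polar_point \<gamma> x \<theta>) \<partial>circle) \<partial>weighted_halfplane r)"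
proof -
  interpret C: sigma_finite_measure circle by (rule sigma_finite_circle)
  interpret R: sigma_finite_measure rays by (rule sigma_finite_rays)
  define \<Omega> :: "(real \<times> real \<times> real) set" where "\<Omega> = UNIV \<times> {0<..} \<times> {0..<2*pi}"
  have \<Omega>[measurable]: "\<Omega> \<in> sets borel"
    unfolding \<Omega>_def by (intro borel_Times) auto
  define R where "R = restrict_space (lborel :: (real \<times> real \<times> real) measure) \<Omega>"
  have fR: "f \<in> borel_measurable borel \<Longrightarrow> f \<in> borel_measurable R" for f :: "_ \<Rightarrow> 'b::topological_space"
    unfolding R_def by (intro measurable_restrict_space1) simp
  have m1[measurable]: "(\<lambda>x. fst x) \<in> borel_measurable (borel :: (real \<times> real \<times> real) measure)"
    "(\<lambda>x. fst (snd x)) \<in> borel_measurable (borel :: (real \<times> real \<times> real) measure)"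
    "(\<lambda>x. snd (snd x)) \<in> borel_measurable (borel :: (real \<times> real \<times> real) measure)"
    by (intro borel_measurable_continuous_onI continuous_intros)+
  have hp: "hparam \<gamma> \<in> R \<rightarrow>\<^sub>M restrict_space borel (hypersurface \<gamma>)"
  proof (rule measurable_restrict_space2)
    show "hparam \<gamma> \<in> space R \<rightarrow> hypersurface \<gamma>"
      by (auto simp: R_def space_restrict_space \<Omega>_def intro!: hparam_in_hypersurface)
    have "(\<lambda>x. hparam \<gamma> (fst x, fst (snd x), snd (snd x))) \<in> borel_measurable R"
      by (rule fR) measurable
    then show "hparam \<gamma> \<in> borel_measurable R" by simp
  qed
  have w: "(\<lambda>(s, \<alpha>, \<theta>). ennreal (\<alpha> powr r)) \<in> borel_measurable R"
    by (rule fR) (simp add: case_prod_unfold, measurable)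
  have gh: "(\<lambda>x. g (hparam \<gamma> x)) \<in> borel_measurable R"
    by (rule measurable_compose[OF hp g])
  have "(\<lambda>x. ennreal (fst (snd x) powr r) * g (hparam \<gamma> x)) \<in> borel_measurable R"
    using w gh by (intro borel_measurable_times_ennreal) (auto simp: case_prod_unfold)
  then have "(\<lambda>x. ennreal (fst (snd x) powr r) * g (hparam \<gamma> x) * indicator \<Omega> x) \<in> borel_measurable lborel"
    unfolding R_def by (subst (asm) borel_measurable_restrict_space_iff_ennreal) auto
  then have M: "(\<lambda>x. ennreal (fst (snd x) powr r) * g (hparam \<gamma> x) * indicator \<Omega> x)
      \<in> borel_measurable (lborel \<Otimes>\<^sub>M lborel)"
    by (simp add: lborel_prod)
  have "(\<lambda>p. g (polar_point \<gamma> (fst p) (snd p))) \<in> borel_measurable (halfplane \<Otimes>\<^sub>M circle)"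
    by (rule measurable_on_polar_point[OF g])
  then have inner_m[measurable]: "(\<lambda>x. \<integral>\<^sup>+\<theta>. g (polar_point \<gamma> x \<theta>) \<partial>circle) \<in> borel_measurable halfplane"
    by (intro C.borel_measurable_nn_integral) (simp add: case_prod_unfold)
  have "(\<integral>\<^sup>+z. g z \<partial>hmeasure \<gamma> r) = (\<integral>\<^sup>+x. g (hparam \<gamma> x) \<partial>density R (\<lambda>(s, \<alpha>, \<theta>). ennreal (\<alpha> powr r)))"
    unfolding hmeasure_def \<Omega>_def[symmetric] R_def[symmetric]
    by (rule nn_integral_distr) (use g hp in \<open>auto simp: measurable_def\<close>)
  also have "\<dots> = (\<integral>\<^sup>+x. ennreal (fst (snd x) powr r) * g (hparam \<gamma> x) \<partial>R)"
    using nn_integral_density[OF w gh] by (simp add: case_prod_unfold)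
  also have "\<dots> = (\<integral>\<^sup>+x. ennreal (fst (snd x) powr r) * g (hparam \<gamma> x) * indicator \<Omega> x \<partial>lborel)"
    unfolding R_def by (subst nn_integral_restrict_space) auto
  also have "\<dots> = (\<integral>\<^sup>+s. \<integral>\<^sup>+y. ennreal (fst y powr r) * g (hparam \<gamma> (s, y))
      * indicator \<Omega> (s, y) \<partial>lborel \<partial>lborel)"
    using lborel.nn_integral_fst[OF M] by (simp add: lborel_prod)
  also have "\<dots> = (\<integral>\<^sup>+s. \<integral>\<^sup>+\<alpha>. \<integral>\<^sup>+\<theta>. ennreal (\<alpha> powr r) * g (hparam \<gamma> (s, \<alpha>, \<theta>))
      * indicator \<Omega> (s, \<alpha>, \<theta>) \<partial>lborel \<partial>lborel \<partial>lborel)"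
  proof (intro nn_integral_cong)
    fix s :: real
    have "(\<lambda>y. ennreal (fst y powr r) * g (hparam \<gamma> (s, y)) * indicator \<Omega> (s, y))
        \<in> borel_measurable (lborel \<Otimes>\<^sub>M lborel)"
      using measurable_Pair2[OF M, of s] by (simp add: lborel_prod)
    from lborel.nn_integral_fst[OF this]
    show "(\<integral>\<^sup>+y. ennreal (fst y powr r) * g (hparam \<gamma> (s, y)) * indicator \<Omega> (s, y) \<partial>lborel)
      = (\<integral>\<^sup>+\<alpha>. \<integral>\<^sup>+\<theta>. ennreal (\<alpha> powr r) * g (hparam \<gamma> (s, \<alpha>, \<theta>)) * indicator \<Omega> (s, \<alpha>, \<theta>) \<partial>lborel \<partial>lborel)"
      by (simp add: lborel_prod)
  qed
  also have "\<dots> = (\<integral>\<^sup>+s. \<integral>\<^sup>+\<alpha>. (\<integral>\<^sup>+\<theta>. g (polar_point \<gamma> (s, \<alpha>) \<theta>) \<partial>circle) * ennreal (\<alpha> powr r) \<partial>rays \<partial>lborel)"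
    unfolding nn_integral_rays
  proof (intro nn_integral_cong)
    fix s \<alpha> :: real
    show "(\<integral>\<^sup>+\<theta>. ennreal (\<alpha> powr r) * g (hparam \<gamma> (s, \<alpha>, \<theta>)) * indicator \<Omega> (s, \<alpha>, \<theta>) \<partial>lborel)
       = (\<integral>\<^sup>+\<theta>. g (polar_point \<gamma> (s, \<alpha>) \<theta>) \<partial>circle) * ennreal (\<alpha> powr r) * indicator {0<..} \<alpha>"
    proof (cases "\<alpha> > 0")
      case True
      then have "(\<lambda>\<theta>. g (polar_point \<gamma> (s, \<alpha>) \<theta>)) \<in> borel_measurable circle"
        by (intro measurable_on_polar_circle[OF g]) simp
      then have m: "(\<lambda>\<theta>. g (polar_point \<gamma> (s, \<alpha>) \<theta>) * indicator {0..<2*pi} \<theta>) \<in> borel_measurable lborel"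
        unfolding circle_def by (subst (asm) borel_measurable_restrict_space_iff_ennreal) auto
      have "(\<integral>\<^sup>+\<theta>. ennreal (\<alpha> powr r) * g (hparam \<gamma> (s, \<alpha>, \<theta>)) * indicator \<Omega> (s, \<alpha>, \<theta>) \<partial>lborel)
         = (\<integral>\<^sup>+\<theta>. ennreal (\<alpha> powr r) * (g (polar_point \<gamma> (s, \<alpha>) \<theta>) * indicator {0..<2*pi} \<theta>) \<partial>lborel)"
        using True by (intro nn_integral_cong) (auto simp: \<Omega>_def indicator_def polar_point_def)
      also have "\<dots> = ennreal (\<alpha> powr r) * (\<integral>\<^sup>+\<theta>. g (polar_point \<gamma> (s, \<alpha>) \<theta>) * indicator {0..<2*pi} \<theta> \<partial>lborel)"
        by (rule nn_integral_cmult[OF m])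
      also have "(\<integral>\<^sup>+\<theta>. g (polar_point \<gamma> (s, \<alpha>) \<theta>) * indicator {0..<2*pi} \<theta> \<partial>lborel)
          = (\<integral>\<^sup>+\<theta>. g (polar_point \<gamma> (s, \<alpha>) \<theta>) \<partial>circle)"
        unfolding circle_def by (subst nn_integral_restrict_space) auto
      finally show ?thesis using True by (simp add: mult.commute)
    qed (simp add: \<Omega>_def)
  qed
  also have "\<dots> = (\<integral>\<^sup>+x. (\<integral>\<^sup>+\<theta>. g (polar_point \<gamma> x \<theta>) \<partial>circle) * ennreal (snd x powr r) \<partial>halfplane)"
  proof -
    have "(\<lambda>x. (\<integral>\<^sup>+\<theta>. g (polar_point \<gamma> x \<theta>) \<partial>circle) * ennreal (snd x powr r))
        \<in> borel_measurable (lborel \<Otimes>\<^sub>M rays)"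
      using inner_m by (simp add: halfplane_def[symmetric])
    from R.nn_integral_fst[OF this] show ?thesis by (simp add: halfplane_def)
  qed
  also have "\<dots> = (\<integral>\<^sup>+x. (\<integral>\<^sup>+\<theta>. g (polar_point \<gamma> x \<theta>) \<partial>circle) \<partial>weighted_halfplane r)"
    by (rule nn_integral_weighted_halfplane[symmetric]) fact
  finally show ?thesis .
qed

lemma l2sq_hmeasure:
  assumes "hmeasurable \<gamma> f"
  shows "l2sq (hmeasure \<gamma> r) f
    = (\<integral>\<^sup>+x. fibre_sq \<gamma> f x \<partial>weighted_halfplane r)"
  unfolding l2sq_def using assms by (intro nn_integral_hmeasure) measurable

text \<open>Comparing norms instead of null sets avoids images of null sets under the parametrization.\<close>

lemma AE_hmeasure_eqI:
  fixes f g :: "complex \<times> complex \<Rightarrow> complex"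
  assumes [measurable]: "hmeasurable \<gamma> f"
    "hmeasurable \<gamma> g"
    and ae: "AE x in halfplane. \<forall>\<theta>\<in>{0..<2*pi}. f (polar_point \<gamma> x \<theta>) = g (polar_point \<gamma> x \<theta>)"
  shows "AE z in hmeasure \<gamma> r. f z = g z"
proof -
  have "l2sq (hmeasure \<gamma> r) (\<lambda>z. f z - g z)
      = (\<integral>\<^sup>+x. (\<integral>\<^sup>+\<theta>. ennreal ((cmod (f (polar_point \<gamma> x \<theta>) - g (polar_point \<gamma> x \<theta>)))\<^sup>2) \<partial>circle)
          \<partial>weighted_halfplane r)"
    by (rule l2sq_hmeasure) measurable
  also have "\<dots> = (\<integral>\<^sup>+x. 0 \<partial>weighted_halfplane r)"
  proof (rule nn_integral_cong_AE, unfold AE_weighted_halfplane, rule AE_mp[OF ae], intro AE_I2 impI)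
    fix x assume "\<forall>\<theta>\<in>{0..<2*pi}. f (polar_point \<gamma> x \<theta>) = g (polar_point \<gamma> x \<theta>)"
    then have "(\<integral>\<^sup>+\<theta>. ennreal ((cmod (f (polar_point \<gamma> x \<theta>) - g (polar_point \<gamma> x \<theta>)))\<^sup>2) \<partial>circle)
        = (\<integral>\<^sup>+\<theta>. 0 \<partial>circle)"
      by (intro nn_integral_cong) auto
    then show "(\<integral>\<^sup>+\<theta>. ennreal ((cmod (f (polar_point \<gamma> x \<theta>) - g (polar_point \<gamma> x \<theta>)))\<^sup>2) \<partial>circle) = 0"
      by simp
  qed
  finally have "l2sq (hmeasure \<gamma> r) (\<lambda>z. f z - g z) = 0" by simp
  then have "AE z in hmeasure \<gamma> r. f z - g z = 0"
    by (intro l2sq_eq_0) auto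
  then show ?thesis by simp
qed

definition angular_coeff :: "real \<Rightarrow> int \<Rightarrow> (complex \<times> complex \<Rightarrow> complex) \<Rightarrow> real \<times> real \<Rightarrow> complex" where
  "angular_coeff \<gamma> k f x = fourier_coeff \<gamma> k f (fst x) (snd x)"

lemma angular_coeff_eq:
  "angular_coeff \<gamma> k f x = 1 / (2 * of_real pi) * (LINT \<theta>|circle. f (polar_point \<gamma> x \<theta>) * cis (- of_int k * \<theta>))"
  unfolding angular_coeff_def fourier_coeff_def polar_point_def circle_def set_lebesgue_integral_def
  by (subst integral_restrict_space) auto

lemma measurable_angular_coeff [measurable (raw)]:
  assumes f: "hmeasurable \<gamma> f"
  shows "angular_coeff \<gamma> k f \<in> borel_measurable halfplane"
proof -
  interpret C: sigma_finite_measure circle by (rule sigma_finite_circle)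
  note [measurable] = measurable_on_polar_point[OF f]
  have "(\<lambda>p. f (polar_point \<gamma> (fst p) (snd p)) * cis (- of_int k * snd p))
      \<in> borel_measurable (halfplane \<Otimes>\<^sub>M circle)"
    by measurable
  then have "(\<lambda>x. LINT \<theta>|circle. f (polar_point \<gamma> x \<theta>) * cis (- of_int k * \<theta>)) \<in> borel_measurable halfplane"
    by (intro C.borel_measurable_lebesgue_integral) (simp add: case_prod_unfold)
  then show ?thesis
    unfolding angular_coeff_eq[abs_def] by measurable
qed

lemma AE_square_integrable_circle:
  assumes f: "square_integrable (hmeasure \<gamma> r) f"
  shows "AE x in halfplane. fibre_sq \<gamma> f x < \<infinity>"
proof -
  interpret C: sigma_finite_measure circle by (rule sigma_finite_circle)
  have fm: "hmeasurable \<gamma> f"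
    using square_integrable_measurable[OF f] by simp
  note [measurable] = measurable_on_polar_point[OF fm]
  have "(\<lambda>x. \<integral>\<^sup>+\<theta>. ennreal ((cmod (f (polar_point \<gamma> x \<theta>)))\<^sup>2) \<partial>circle) \<in> borel_measurable halfplane"
    by (intro C.borel_measurable_nn_integral) (simp add: case_prod_unfold)
  then have "AE x in weighted_halfplane r. fibre_sq \<gamma> f x \<noteq> \<infinity>"
    using f by (intro nn_integral_PInf_AE) (auto simp: l2sq_hmeasure[OF fm, symmetric]
        square_integrable_iff_l2sq)
  then show ?thesis by (simp add: AE_weighted_halfplane less_top)
qed

lemma AE_integrable_circle:
  assumes f: "square_integrable (hmeasure \<gamma> r) f"
  shows "AE x in halfplane. \<forall>k. integrable circle (\<lambda>\<theta>. f (polar_point \<gamma> x \<theta>) * cis (- of_int k * \<theta>))"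
  using AE_square_integrable_circle[OF f]
proof (rule AE_mp, intro AE_I2 impI allI)
  fix x k assume x: "x \<in> space halfplane" and fin: "fibre_sq \<gamma> f x < \<infinity>"
  have "hmeasurable \<gamma> f"
    using square_integrable_measurable[OF f] by simp
  then have m[measurable]: "(\<lambda>\<theta>. f (polar_point \<gamma> x \<theta>)) \<in> borel_measurable circle"
    using x by (rule measurable_on_polar_circle)
  have [measurable]: "(\<lambda>\<theta>. cis (- (of_int k * \<theta>))) \<in> borel_measurable circle"
    by (intro borel_measurable_circleI; measurable)
  have "integrable circle (\<lambda>\<theta>. f (polar_point \<gamma> x \<theta>))"
    using m fin by (rule square_integrable_circle_integrable)
  then show "integrable circle (\<lambda>\<theta>. f (polar_point \<gamma> x \<theta>) * cis (- of_int k * \<theta>))"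
    by (rule Bochner_Integration.integrable_bound) (auto simp: norm_mult)
qed

lemma angular_coeff_bessel:
  assumes f: "square_integrable (hmeasure \<gamma> r) f" and S: "finite S"
  shows "ennreal (2 * pi) * (\<Sum>k\<in>S. l2sq (weighted_halfplane r) (angular_coeff \<gamma> k f)) \<le> l2sq (hmeasure \<gamma> r) f"
proof -
  have fm: "hmeasurable \<gamma> f"
    using square_integrable_measurable[OF f] by simp
  note [measurable] = measurable_angular_coeff[OF fm]
  have "ennreal (2 * pi) * (\<Sum>k\<in>S. l2sq (weighted_halfplane r) (angular_coeff \<gamma> k f))
     = (\<integral>\<^sup>+x. ennreal (2 * pi * (\<Sum>k\<in>S. (cmod (angular_coeff \<gamma> k f x))\<^sup>2)) \<partial>weighted_halfplane r)"
  proof -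
    have "ennreal (2 * pi * (\<Sum>k\<in>S. (cmod (angular_coeff \<gamma> k f x))\<^sup>2))
       = ennreal (2 * pi) * (\<Sum>k\<in>S. ennreal ((cmod (angular_coeff \<gamma> k f x))\<^sup>2))" for x
      by (subst ennreal_mult) (auto intro!: sum_nonneg)
    then show ?thesis
      unfolding l2sq_def by (simp add: nn_integral_cmult nn_integral_sum del: sum_ennreal)
  qed
  also have "\<dots> \<le> (\<integral>\<^sup>+x. fibre_sq \<gamma> f x \<partial>weighted_halfplane r)"
  proof (rule nn_integral_mono_AE, unfold AE_weighted_halfplane, rule AE_mp[OF
      AE_square_integrable_circle[OF f]], intro AE_I2 impI)
    fix x assume x: "x \<in> space halfplane" and fin: "fibre_sq \<gamma> f x < \<infinity>"
    show "ennreal (2 * pi * (\<Sum>k\<in>S. (cmod (angular_coeff \<gamma> k f x))\<^sup>2)) \<le> fibre_sq \<gamma> f x"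
      unfolding angular_coeff_eq
      using measurable_on_polar_circle[OF fm x] fin S by (rule bessel_inequality)
  qed
  also have "\<dots> = l2sq (hmeasure \<gamma> r) f"
    by (rule l2sq_hmeasure[OF fm, symmetric])
  finally show ?thesis .
qed

lemma square_integrable_angular_coeff:
  assumes f: "square_integrable (hmeasure \<gamma> r) f"
  shows "square_integrable (weighted_halfplane r) (angular_coeff \<gamma> k f)"
    and "ennreal (2 * pi) * l2sq (weighted_halfplane r) (angular_coeff \<gamma> k f) \<le> l2sq (hmeasure \<gamma> r) f"
proof -
  have fm: "hmeasurable \<gamma> f"
    using square_integrable_measurable[OF f] by simp
  show le: "ennreal (2 * pi) * l2sq (weighted_halfplane r) (angular_coeff \<gamma> k f) \<le> l2sq (hmeasure \<gamma> r) f"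
    using angular_coeff_bessel[OF f, of "{k}"] by simp
  also have "\<dots> < \<infinity>" using f by (simp add: square_integrable_iff_l2sq)
  finally have "l2sq (weighted_halfplane r) (angular_coeff \<gamma> k f) < \<infinity>"
    by (auto simp: ennreal_mult_less_top)
  then show "square_integrable (weighted_halfplane r) (angular_coeff \<gamma> k f)"
    using measurable_angular_coeff[OF fm] by (simp add: square_integrable_iff_l2sq)
qed

lemma angular_coeff_add:
  assumes "square_integrable (hmeasure \<gamma> r) f" "square_integrable (hmeasure \<gamma> r) g"
  shows "AE x in halfplane. angular_coeff \<gamma> k (\<lambda>z. f z + g z) x = angular_coeff \<gamma> k f x + angular_coeff \<gamma> k g x"
  using AE_integrable_circle[OF assms(1)] AE_integrable_circle[OF assms(2)]
  unfolding angular_coeff_eq by eventually_elim (simp add: distrib_left distrib_right)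

lemma angular_coeff_cmult:
  "angular_coeff \<gamma> k (\<lambda>z. c * f z) x = c * angular_coeff \<gamma> k f x"
  unfolding angular_coeff_eq by (simp add: mult.assoc)

section \<open>The Leray transform on the admissible range\<close>

lemma polar_point_coords:
  assumes "x \<in> space halfplane" "\<theta> \<in> {0..<2*pi}"
  shows "Re (snd (polar_point \<gamma> x \<theta>)) = fst x" "cmod (fst (polar_point \<gamma> x \<theta>)) = snd x"
    "Arg2pi (fst (polar_point \<gamma> x \<theta>)) = \<theta>"
proof -
  have pos: "snd x > 0" using assms(1) by auto
  show "Re (snd (polar_point \<gamma> x \<theta>)) = fst x" "cmod (fst (polar_point \<gamma> x \<theta>)) = snd x"
    using pos by (simp_all add: polar_point_def hparam_def norm_mult)
  have "complex_of_real (snd x) * cis \<theta> = of_real (snd x) * exp (\<i> * of_real \<theta>)"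
    by (simp add: cis_conv_exp)
  then have "Arg2pi (complex_of_real (snd x) * cis \<theta>) = \<theta>"
    using pos assms(2) by (intro Arg2pi_unique[of "snd x"]) auto
  then show "Arg2pi (fst (polar_point \<gamma> x \<theta>)) = \<theta>"
    by (simp add: polar_point_def hparam_def)
qed

text \<open>The iterated integral in the order in which the terms of the transform are defined. Where the
  integrand is integrable over the half plane it agrees with the operator \<^const>\<open>leray_op\<close>, which is
  easier to handle.\<close>

definition leray_radial :: "real \<Rightarrow> nat \<Rightarrow> (real \<times> real \<Rightarrow> complex) \<Rightarrow> real \<times> real \<Rightarrow> complex" where
  "leray_radial \<gamma> k u z = (LINT \<alpha>|rays. LINT s|lborel. leray_kernel \<gamma> k z (s, \<alpha>) * u (s, \<alpha>))"

lemma leray_radial_eq_leray_op: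
  assumes "integrable halfplane (\<lambda>\<zeta>. leray_kernel \<gamma> k z \<zeta> * u \<zeta>)"
  shows "leray_radial \<gamma> k u z = leray_op \<gamma> k u z"
proof -
  interpret pair_sigma_finite "lborel :: real measure" rays
    by (rule pair_sigma_finite_lborel_rays)
  have "integrable (lborel \<Otimes>\<^sub>M rays) (case_prod (\<lambda>s \<alpha>. leray_kernel \<gamma> k z (s, \<alpha>) * u (s, \<alpha>)))"
    using assms by (simp add: halfplane_def case_prod_unfold)
  from integral_snd[OF this] show ?thesis
    by (simp add: leray_radial_def leray_op_def halfplane_def case_prod_unfold)
qed

lemma leray_term_eq_radial:
  "leray_term \<gamma> k f z = cis (real k * Arg2pi (fst z)) *
     leray_radial \<gamma> k (angular_coeff \<gamma> (int k) f) (Re (snd z), cmod (fst z))"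
proof -
  have ray: "(LINT \<alpha>:{0<..}|lborel. F \<alpha>) = (LINT \<alpha>|rays. F \<alpha>)" for F :: "real \<Rightarrow> complex"
    unfolding rays_def set_lebesgue_integral_def by (subst integral_restrict_space) auto
  show ?thesis
    unfolding leray_term_def leray_radial_def leray_kernel_def angular_coeff_def ray
    by (simp add: mult_ac flip: integral_mult_right_zero)
qed

lemma leray_term_polar_point:
  assumes "x \<in> space halfplane" "\<theta> \<in> {0..<2*pi}"
  shows "leray_term \<gamma> k f (polar_point \<gamma> x \<theta>) = cis (real k * \<theta>)
      * leray_radial \<gamma> k (angular_coeff \<gamma> (int k) f) x"
  unfolding leray_term_eq_radial polar_point_coords[OF assms] by simp

text \<open>In contrast to \<^const>\<open>Arg2pi\<close>, the right-hand side is visibly measurable.\<close>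

lemma cis_Arg2pi_power: "cis (real k * Arg2pi w) = (if w = 0 then 1 else (sgn w) ^ k)"
proof (cases "w = 0")
  case False
  have "w = of_real (cmod w) * cis (Arg2pi w)"
    using Arg2pi[of w] by (simp add: cis_conv_exp is_Arg_def)
  then have "cis (Arg2pi w) = sgn w"
    using False by (metis nonzero_mult_div_cancel_left norm_eq_zero of_real_eq_0_iff sgn_eq)
  then show ?thesis using False by (simp add: Complex.DeMoivre[symmetric])
qed (simp add: Arg2pi_0)

lemma measurable_leray_term:
  assumes f: "hmeasurable \<gamma> f"
  shows "hmeasurable \<gamma> (leray_term \<gamma> k f)"
proof (rule measurable_restrict_space1)
  interpret R: sigma_finite_measure rays by (rule sigma_finite_rays)
  have u: "angular_coeff \<gamma> (int k) f \<in> borel_measurable (lborel \<Otimes>\<^sub>M rays)"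
    using measurable_angular_coeff[OF f] by (simp add: halfplane_def)
  have [measurable]: "(\<lambda>\<alpha>. \<alpha>) \<in> borel_measurable rays"
    by (rule borel_measurable_raysI) simp
  have [measurable]: "(\<lambda>z. fst z) \<in> borel_measurable (borel :: (complex \<times> complex) measure)"
    "(\<lambda>z. snd z) \<in> borel_measurable (borel :: (complex \<times> complex) measure)"
    by (intro borel_measurable_continuous_onI continuous_intros)+
  have "(\<lambda>z. leray_radial \<gamma> k (angular_coeff \<gamma> (int k) f) (Re (snd z), cmod (fst z))) \<in> borel_measurable borel"
  proof -
    have [measurable]: "(\<lambda>p. angular_coeff \<gamma> (int k) f (snd p, snd (fst p)))
        \<in> borel_measurable (((borel :: (complex \<times> complex) measure) \<Otimes>\<^sub>M rays) \<Otimes>\<^sub>M lborel)"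
      by (rule measurable_compose[OF _ u]) measurable
    have [measurable]: "(\<lambda>p. snd (fst p)) \<in> borel_measurable (((borel :: (complex \<times> complex) measure) \<Otimes>\<^sub>M
        rays) \<Otimes>\<^sub>M lborel)"
      by (rule measurable_compose[of _ _ rays "\<lambda>\<alpha>. \<alpha>"]) measurable
    show ?thesis
      unfolding leray_radial_def
      by (intro R.borel_measurable_lebesgue_integral, unfold case_prod_unfold,
          intro lborel.borel_measurable_lebesgue_integral, unfold case_prod_unfold,
          intro borel_measurable_times measurable_leray_kernel_Pair) measurable
  qed
  then show "leray_term \<gamma> k f \<in> borel_measurable borel"
    unfolding leray_term_eq_radial[abs_def] cis_Arg2pi_power by measurable
qed

text \<open>Parseval's identity on almost every circle, for functions with finitely many angular frequencies.\<close>

lemma angular_sum: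
  fixes V :: "nat \<Rightarrow> real \<times> real \<Rightarrow> complex"
  assumes F: "hmeasurable \<gamma> F"
    and V[measurable]: "\<And>k. V k \<in> borel_measurable halfplane"
    and S: "finite S"
    and ae: "AE x in halfplane. \<forall>\<theta>\<in>{0..<2*pi}. F (polar_point \<gamma> x \<theta>) = (\<Sum>k\<in>S. cis (real k * \<theta>) * V k x)"
  shows "l2sq (hmeasure \<gamma> r) F = ennreal (2 * pi) * (\<Sum>k\<in>S. l2sq (weighted_halfplane r) (V k))"
    and "k \<in> S \<Longrightarrow> AE x in halfplane. angular_coeff \<gamma> (int k) F x = V k x"
proof -
  have int: "(\<Sum>k\<in>S. cis (real k * \<theta>) * V k x) = (\<Sum>j\<in>int ` S. V (nat j) x * cis (of_int j * \<theta>))" for x \<theta>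
    by (subst sum.reindex) (auto simp: mult.commute)
  have "l2sq (hmeasure \<gamma> r) F = (\<integral>\<^sup>+x. ennreal (2 * pi) * (\<Sum>k\<in>S. ennreal ((cmod (V k x))\<^sup>2))
      \<partial>weighted_halfplane r)"
    unfolding l2sq_hmeasure[OF F]
  proof (rule nn_integral_cong_AE, unfold AE_weighted_halfplane, rule AE_mp[OF ae], intro AE_I2 impI)
    fix x assume x: "\<forall>\<theta>\<in>{0..<2*pi}. F (polar_point \<gamma> x \<theta>) = (\<Sum>k\<in>S. cis (real k * \<theta>) * V k x)"
    have "fibre_sq \<gamma> F x
       = (\<integral>\<^sup>+\<theta>. ennreal ((cmod (\<Sum>j\<in>int ` S. V (nat j) x * cis (of_int j * \<theta>)))\<^sup>2) \<partial>circle)"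
      using x by (intro nn_integral_cong) (simp add: int)
    also have "\<dots> = ennreal (2 * pi * (\<Sum>j\<in>int ` S. (cmod (V (nat j) x))\<^sup>2))"
      using S by (intro parseval_finite) auto
    also have "\<dots> = ennreal (2 * pi) * (\<Sum>k\<in>S. ennreal ((cmod (V k x))\<^sup>2))"
      by (subst sum.reindex) (auto simp: ennreal_mult sum_nonneg)
    finally show "fibre_sq \<gamma> F x = \<dots>" .
  qed
  also have "\<dots> = ennreal (2 * pi) * (\<Sum>k\<in>S. l2sq (weighted_halfplane r) (V k))"
    unfolding l2sq_def by (simp add: nn_integral_cmult nn_integral_sum del: sum_ennreal)
  finally show "l2sq (hmeasure \<gamma> r) F = ennreal (2 * pi) * (\<Sum>k\<in>S. l2sq (weighted_halfplane r) (V k))" .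
  show "AE x in halfplane. angular_coeff \<gamma> (int k) F x = V k x" if k: "k \<in> S"
  proof (rule AE_mp[OF ae], intro AE_I2 impI)
    fix x assume x: "\<forall>\<theta>\<in>{0..<2*pi}. F (polar_point \<gamma> x \<theta>) = (\<Sum>k\<in>S. cis (real k * \<theta>) * V k x)"
    have "(LINT \<theta>|circle. F (polar_point \<gamma> x \<theta>) * cis (- of_int (int k) * \<theta>))
       = (LINT \<theta>|circle. (\<Sum>j\<in>int ` S. V (nat j) x * cis (of_int j * \<theta>)) * cis (- of_int (int k) * \<theta>))"
      using x by (intro Bochner_Integration.integral_cong refl) (simp add: int)
    also have "\<dots> = 2 * of_real pi * V k x"
      using k S by (subst parseval_finite) auto
    finally show "angular_coeff \<gamma> (int k) F x = V k x"
      unfolding angular_coeff_eq by simp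
  qed
qed

text \<open>Within this locale the range of \<open>r\<close> enters only through the uniform bound on the kernels.\<close>

locale bounded_leray_kernel =
  fixes \<gamma> r C :: real
  assumes \<gamma>: "\<gamma> > 1" and C: "kernel_bound \<gamma> r C"
begin

abbreviation "sqint \<equiv> square_integrable (hmeasure \<gamma> r)"
abbreviation "hnorm \<equiv> l2sq (hmeasure \<gamma> r)"
abbreviation "wnorm \<equiv> l2sq (weighted_halfplane r)"

definition leray_coeff :: "nat \<Rightarrow> (complex \<times> complex \<Rightarrow> complex) \<Rightarrow> real \<times> real \<Rightarrow> complex" where
  "leray_coeff k f = leray_op \<gamma> k (angular_coeff \<gamma> (int k) f)"

lemma sqint_measurable: "sqint f \<Longrightarrow> hmeasurable \<gamma> f"
  using square_integrable_measurable by fastforce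

lemma measurable_leray_coeff: "sqint f \<Longrightarrow> leray_coeff k f \<in> borel_measurable halfplane"
  unfolding leray_coeff_def by (intro measurable_leray_op measurable_angular_coeff sqint_measurable)

lemma AE_integrable_angular_coeff:
  "sqint f \<Longrightarrow> AE x in halfplane. \<forall>k. integrable halfplane (\<lambda>\<zeta>. leray_kernel \<gamma> k x \<zeta>
      * angular_coeff \<gamma> (int k) f \<zeta>)"
  unfolding AE_all_countable by (intro allI AE_integrable_leray_kernel[OF C] square_integrable_angular_coeff(1))

lemma AE_leray_term:
  assumes f: "sqint f"
  shows "AE x in halfplane. \<forall>k. \<forall>\<theta>\<in>{0..<2*pi}. leray_term \<gamma> k f (polar_point \<gamma> x \<theta>)
      = cis (real k * \<theta>) * leray_coeff k f x"
  using AE_integrable_angular_coeff[OF f]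
proof (rule AE_mp, intro AE_I2 impI allI ballI)
  fix x k \<theta> assume "x \<in> space halfplane" "\<theta> \<in> {0..<2*pi}"
    and "\<forall>k. integrable halfplane (\<lambda>\<zeta>. leray_kernel \<gamma> k x \<zeta> * angular_coeff \<gamma> (int k) f \<zeta>)"
  then show "leray_term \<gamma> k f (polar_point \<gamma> x \<theta>) = cis (real k * \<theta>) * leray_coeff k f x"
    by (simp add: leray_term_polar_point leray_radial_eq_leray_op leray_coeff_def)
qed

lemma measurable_leray_sum:
  "sqint f \<Longrightarrow> (\<lambda>z. \<Sum>k\<in>S. leray_term \<gamma> k f z) \<in> borel_measurable (restrict_space borel (hypersurface \<gamma>))"
  by (intro borel_measurable_sum measurable_leray_term sqint_measurable)

lemma leray_sum:
  assumes f: "sqint f" and S: "finite S"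
  shows "hnorm (\<lambda>z. \<Sum>k\<in>S. leray_term \<gamma> k f z) = ennreal (2 * pi) * (\<Sum>k\<in>S. wnorm (leray_coeff k f))"
    and "k \<in> S \<Longrightarrow> AE x in halfplane. angular_coeff \<gamma> (int k) (\<lambda>z. \<Sum>k\<in>S. leray_term \<gamma> k f z) x
        = leray_coeff k f x"
proof -
  have "AE x in halfplane. \<forall>\<theta>\<in>{0..<2*pi}. (\<Sum>k\<in>S. leray_term \<gamma> k f (polar_point \<gamma> x \<theta>))
      = (\<Sum>k\<in>S. cis (real k * \<theta>) * leray_coeff k f x)"
    using AE_leray_term[OF f] by (rule AE_mp) (auto intro!: AE_I2)
  note * = angular_sum[OF measurable_leray_sum[OF f] measurable_leray_coeff[OF f] S this]
  show "hnorm (\<lambda>z. \<Sum>k\<in>S. leray_term \<gamma> k f z) = ennreal (2 * pi) * (\<Sum>k\<in>S. wnorm (leray_coeff k f))"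
    by (rule *(1))
  show "k \<in> S \<Longrightarrow> AE x in halfplane. angular_coeff \<gamma> (int k) (\<lambda>z. \<Sum>k\<in>S. leray_term \<gamma> k f z) x = leray_coeff k f x"
    by (rule *(2))
qed

lemma wnorm_leray_coeff:
  assumes "sqint f"
  shows "wnorm (leray_coeff k f) \<le> ennreal C * wnorm (angular_coeff \<gamma> (int k) f)"
  unfolding leray_coeff_def
  by (intro leray_op_bounded[OF C] measurable_angular_coeff sqint_measurable assms)

lemma leray_sum_le:
  assumes f: "sqint f" and S: "finite S"
  shows "hnorm (\<lambda>z. \<Sum>k\<in>S. leray_term \<gamma> k f z) \<le> ennreal C * (ennreal (2 * pi)
      * (\<Sum>k\<in>S. wnorm (angular_coeff \<gamma> (int k) f)))"
proof -
  have "(\<Sum>k\<in>S. wnorm (leray_coeff k f)) \<le> ennreal C * (\<Sum>k\<in>S. wnorm (angular_coeff \<gamma> (int k) f))"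
    unfolding sum_distrib_left by (intro sum_mono wnorm_leray_coeff f)
  then show ?thesis
    unfolding leray_sum(1)[OF f S] by (subst mult.left_commute) (intro mult_left_mono, auto)
qed

lemma bessel:
  assumes f: "sqint f" and S: "finite S"
  shows "ennreal (2 * pi) * (\<Sum>k\<in>S. wnorm (angular_coeff \<gamma> (int k) f)) \<le> hnorm f"
  using angular_coeff_bessel[OF f, of "int ` S"] S by (simp add: sum.reindex)

lemma leray_sum_bounded:
  assumes f: "sqint f" and S: "finite S"
  shows "hnorm (\<lambda>z. \<Sum>k\<in>S. leray_term \<gamma> k f z) \<le> ennreal C * hnorm f"
  by (rule order_trans[OF leray_sum_le[OF f S]]) (intro mult_left_mono bessel f S, simp)

lemma sqint_leray_sum:
  assumes f: "sqint f" and S: "finite S"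
  shows "sqint (\<lambda>z. \<Sum>k\<in>S. leray_term \<gamma> k f z)"
proof -
  have "ennreal C * hnorm f < \<infinity>" using f by (simp add: square_integrable_iff_l2sq ennreal_mult_less_top)
  then show ?thesis
    using le_less_trans[OF leray_sum_bounded[OF f S]] measurable_leray_sum[OF f]
    by (simp add: square_integrable_iff_l2sq)
qed

lemma sqint_leray_term:
  assumes f: "sqint f"
  shows "sqint (leray_term \<gamma> k f)"
  using sqint_leray_sum[OF f, of "{k}"] by simp

lemma is_leray_transform_iff:
  assumes f: "sqint f"
  shows "is_leray_transform \<gamma> r f g \<longleftrightarrow> sqint g \<and> (\<lambda>n. hnorm (\<lambda>z. (\<Sum>k<n. leray_term \<gamma> k f z) - g z)) \<longlonglongrightarrow> 0"
  unfolding is_leray_transform_def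
  using sqint_leray_term[OF f] l2norm_tendsto_0_iff[of "hmeasure \<gamma> r" "\<lambda>n z. (\<Sum>k<n. leray_term \<gamma> k f z) - g z"]
    square_integrable_diff[OF sqint_leray_sum[OF f]] by auto

text \<open>The terms are orthogonal and each is bounded by a multiple of the corresponding Fourier coefficient,
  uniformly in \<open>k\<close>; so Bessel's inequality for \<open>f\<close> makes the partial sums a Cauchy sequence.\<close>

lemma leray_transform_exists:
  assumes f: "sqint f"
  shows "\<exists>g. is_leray_transform \<gamma> r f g"
proof -
  define a where "a k = enn2real (ennreal C * (ennreal (2 * pi) * wnorm (angular_coeff \<gamma> (int k) f)))" for k
  have fin: "ennreal C * (ennreal (2 * pi) * wnorm (angular_coeff \<gamma> (int k) f)) < \<infinity>" for k
    using square_integrable_angular_coeff(1)[OF f] by (simp add: square_integrable_iff_l2sq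
        ennreal_mult_less_top)
  have a: "ennreal (a k) = ennreal C * (ennreal (2 * pi) * wnorm (angular_coeff \<gamma> (int k) f))" for k
    unfolding a_def using fin[of k] by (simp add: less_top)
  have a0: "a k \<ge> 0" for k by (simp add: a_def)
  have asum: "ennreal (sum a S) = ennreal C * (ennreal (2 * pi)
      * (\<Sum>k\<in>S. wnorm (angular_coeff \<gamma> (int k) f)))" for S
    by (simp add: sum_ennreal[symmetric] a0 a sum_distrib_left)
  have Cf: "ennreal C * hnorm f < \<infinity>" using f by (simp add: square_integrable_iff_l2sq ennreal_mult_less_top)
  have "sum a {..<n} \<le> enn2real (ennreal C * hnorm f)" for n
  proof -
    have "ennreal (sum a {..<n}) \<le> ennreal C * hnorm f"
      unfolding asum by (intro mult_left_mono bessel f) auto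
    then have "enn2real (ennreal (sum a {..<n})) \<le> enn2real (ennreal C * hnorm f)"
      using Cf by (intro enn2real_mono) auto
    then show ?thesis by (simp add: sum_nonneg a0)
  qed
  then have summ: "summable a" by (intro summableI_nonneg_bounded a0)
  define s where "s n z = (\<Sum>k<n. leray_term \<gamma> k f z)" for n z
  have sm: "s n \<in> borel_measurable (hmeasure \<gamma> r)" for n
    unfolding s_def using measurable_leray_sum[OF f] by simp
  have diff: "hnorm (\<lambda>z. s m z - s n z) \<le> ennreal (sum a {n..<m})" if "n \<le> m" for m n
  proof -
    have "s m z - s n z = (\<Sum>k\<in>{n..<m}. leray_term \<gamma> k f z)" for z
      unfolding s_def using sum_diff_nat_ivl[of 0 n m "\<lambda>k. leray_term \<gamma> k f z"] that
          by (simp add: lessThan_atLeast0)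
    then show ?thesis using leray_sum_le[OF f, of "{n..<m}"] by (simp add: asum)
  qed
  have "\<exists>g \<in> borel_measurable (hmeasure \<gamma> r). (\<lambda>n. hnorm (\<lambda>z. s n z - g z)) \<longlonglongrightarrow> 0"
  proof (rule l2sq_complete[OF sm])
    fix e :: real assume "e > 0"
    then obtain N where N: "\<And>m n. m \<ge> N \<Longrightarrow> norm (sum a {m..<n}) < e"
      using summ unfolding summable_Cauchy by blast
    have le: "hnorm (\<lambda>z. s m z - s n z) \<le> ennreal e" if "n \<ge> N" "n \<le> m" for m n
      by (rule order_trans[OF diff[OF that(2)]]) (use N[OF that(1), of m] in \<open>intro ennreal_leI, simp\<close>)
    have "hnorm (\<lambda>z. s m z - s n z) \<le> ennreal e" if "m \<ge> N" "n \<ge> N" for m n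
      using le[of n m] le[of m n] that l2sq_diff_commute[of "hmeasure \<gamma> r" "s m" "s n"] by (cases "n \<le> m") auto
    then show "\<exists>N. \<forall>m\<ge>N. \<forall>n\<ge>N. hnorm (\<lambda>z. s m z - s n z) \<le> ennreal e" by blast
  qed
  then obtain g where g: "g \<in> borel_measurable (hmeasure \<gamma> r)" "(\<lambda>n. hnorm (\<lambda>z. s n z - g z)) \<longlonglongrightarrow> 0"
    by blast
  have "sqint g"
  proof -
    have "eventually (\<lambda>n. hnorm (\<lambda>z. s n z - g z) < 1) sequentially"
      using g(2) by (rule order_tendstoD) simp
    then obtain n where n: "hnorm (\<lambda>z. s n z - g z) < 1"
      by (auto simp: eventually_sequentially)
    then have "sqint (\<lambda>z. s n z - g z)"
      using g(1) sm less_trans[OF n, of \<infinity>] by (auto simp: square_integrable_iff_l2sq)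
    moreover have "sqint (s n)" unfolding s_def by (intro sqint_leray_sum f) simp
    ultimately show ?thesis
      using square_integrable_diff[of _ "s n" "\<lambda>z. s n z - g z"] by simp
  qed
  then show ?thesis
    using g(2) is_leray_transform_iff[OF f] unfolding s_def by blast
qed

lemma leray_transform_bounded:
  assumes f: "sqint f" and g: "is_leray_transform \<gamma> r f g"
  shows "hnorm g \<le> ennreal (2 * C) * hnorm f"
proof -
  have g': "sqint g" "(\<lambda>n. hnorm (\<lambda>z. (\<Sum>k<n. leray_term \<gamma> k f z) - g z)) \<longlonglongrightarrow> 0"
    using g is_leray_transform_iff[OF f] by auto
  have C2: "ennreal (2 * C) = 2 * ennreal C" using C by (simp add: kernel_bound_def ennreal_mult)
  have "hnorm g \<le> 2 * (ennreal C * hnorm f) + 2 * hnorm (\<lambda>z. (\<Sum>k<n. leray_term \<gamma> k f z) - g z)" for n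
  proof -
    have "hnorm g = hnorm (\<lambda>z. (\<Sum>k<n. leray_term \<gamma> k f z) - ((\<Sum>k<n. leray_term \<gamma> k f z) - g z))" by simp
    also have "\<dots> \<le> 2 * hnorm (\<lambda>z. \<Sum>k<n. leray_term \<gamma> k f z) + 2 * hnorm (\<lambda>z. (\<Sum>k<n. leray_term \<gamma> k f z) - g z)"
      using measurable_leray_sum[OF f] sqint_measurable[OF g'(1)]
      by (intro l2sq_diff_le) (auto intro!: borel_measurable_diff)
    also have "\<dots> \<le> 2 * (ennreal C * hnorm f) + 2 * hnorm (\<lambda>z. (\<Sum>k<n. leray_term \<gamma> k f z) - g z)"
      by (intro add_right_mono mult_left_mono leray_sum_bounded f) auto
    finally show ?thesis .
  qed
  moreover have "(\<lambda>n. 2 * (ennreal C * hnorm f) + 2 * hnorm (\<lambda>z. (\<Sum>k<n. leray_term \<gamma> k f z) - g z))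
      \<longlonglongrightarrow> 2 * (ennreal C * hnorm f) + 2 * 0"
    by (intro tendsto_add tendsto_const ennreal_tendsto_cmult g'(2)) simp
  ultimately have "hnorm g \<le> 2 * (ennreal C * hnorm f) + 2 * 0"
    by (intro LIMSEQ_le_const) auto
  then show ?thesis by (simp add: C2 mult.assoc)
qed

lemma leray_transform_unique:
  assumes f: "sqint f" and g: "is_leray_transform \<gamma> r f g"
    and h: "h \<in> borel_measurable (hmeasure \<gamma> r)"
    and s: "\<And>n. s n \<in> borel_measurable (hmeasure \<gamma> r)" "\<And>n. AE z in hmeasure \<gamma> r. s n z
        = (\<Sum>k<n. leray_term \<gamma> k f z)"
    and lim: "(\<lambda>n. hnorm (\<lambda>z. s n z - h z)) \<longlonglongrightarrow> 0"
  shows "AE z in hmeasure \<gamma> r. g z = h z"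
proof -
  have g': "sqint g" "(\<lambda>n. hnorm (\<lambda>z. (\<Sum>k<n. leray_term \<gamma> k f z) - g z)) \<longlonglongrightarrow> 0"
    using g is_leray_transform_iff[OF f] by auto
  have "hnorm (\<lambda>z. (\<Sum>k<n. leray_term \<gamma> k f z) - g z) = hnorm (\<lambda>z. s n z - g z)" for n
    by (rule l2sq_cong_AE) (use s(2)[of n] in eventually_elim, simp)
  then have "(\<lambda>n. hnorm (\<lambda>z. s n z - g z)) \<longlonglongrightarrow> 0" using g'(2) by simp
  then show ?thesis
    using lim s(1) h square_integrable_measurable[OF g'(1)] by (intro l2sq_limit_unique[of s])
qed

lemma leray_coeff_eq_imp:
  assumes f: "sqint f" and g: "sqint g" and h: "sqint h"
    and eq: "\<And>k. AE x in halfplane. leray_coeff k f x = a * leray_coeff k g x + b * leray_coeff k h x"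
  shows "AE z in hmeasure \<gamma> r. \<forall>k. leray_term \<gamma> k f z = a * leray_term \<gamma> k g z + b * leray_term \<gamma> k h z"
  unfolding AE_all_countable
proof (intro allI AE_hmeasure_eqI)
  fix k
  show "hmeasurable \<gamma> (leray_term \<gamma> k f)"
    by (intro measurable_leray_term sqint_measurable f)
  show "hmeasurable \<gamma> (\<lambda>z. a * leray_term \<gamma> k g z + b * leray_term \<gamma> k h z)"
    by (intro borel_measurable_add borel_measurable_times borel_measurable_const measurable_leray_term
        sqint_measurable g h)
  show "AE x in halfplane. \<forall>\<theta>\<in>{0..<2*pi}. leray_term \<gamma> k f (polar_point \<gamma> x \<theta>)
      = a * leray_term \<gamma> k g (polar_point \<gamma> x \<theta>) + b * leray_term \<gamma> k h (polar_point \<gamma> x \<theta>)"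
    using AE_leray_term[OF f] AE_leray_term[OF g] AE_leray_term[OF h] eq[of k]
    by eventually_elim (simp add: algebra_simps)
qed

text \<open>The transform is determined by its Fourier coefficients, so a linear relation between these passes
  to the transforms. Additivity, homogeneity and idempotence are all instances.\<close>

lemma leray_transform_combination:
  assumes f: "sqint f" and g: "sqint g" and h: "sqint h"
    and eq: "\<And>k. AE x in halfplane. leray_coeff k f x = a * leray_coeff k g x + b * leray_coeff k h x"
    and F: "is_leray_transform \<gamma> r f F" and G: "is_leray_transform \<gamma> r g G" and H: "is_leray_transform \<gamma> r h H"
  shows "AE z in hmeasure \<gamma> r. F z = a * G z + b * H z"
proof (rule leray_transform_unique[OF f F])
  let ?s = "\<lambda>n z. a * (\<Sum>k<n. leray_term \<gamma> k g z) + b * (\<Sum>k<n. leray_term \<gamma> k h z)"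
  have G': "sqint G" "(\<lambda>n. hnorm (\<lambda>z. (\<Sum>k<n. leray_term \<gamma> k g z) - G z)) \<longlonglongrightarrow> 0"
    and H': "sqint H" "(\<lambda>n. hnorm (\<lambda>z. (\<Sum>k<n. leray_term \<gamma> k h z) - H z)) \<longlonglongrightarrow> 0"
    using G H is_leray_transform_iff[OF g] is_leray_transform_iff[OF h] by auto
  note m = sqint_measurable[OF G'(1)] sqint_measurable[OF H'(1)] measurable_leray_sum[OF g]
      measurable_leray_sum[OF h]
  show "(\<lambda>z. a * G z + b * H z) \<in> borel_measurable (hmeasure \<gamma> r)"
    using m by simp
  show "?s n \<in> borel_measurable (hmeasure \<gamma> r)" for n
    using m by simp
  show "AE z in hmeasure \<gamma> r. ?s n z = (\<Sum>k<n. leray_term \<gamma> k f z)" for n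
    using leray_coeff_eq_imp[OF f g h eq] by eventually_elim (simp add: sum.distrib sum_distrib_left)
  show "(\<lambda>n. hnorm (\<lambda>z. ?s n z - (a * G z + b * H z))) \<longlonglongrightarrow> 0"
  proof (rule tendsto_sandwich[OF _ _ tendsto_const])
    let ?u = "\<lambda>n. 2 * (ennreal ((cmod a)\<^sup>2) * hnorm (\<lambda>z. (\<Sum>k<n. leray_term \<gamma> k g z) - G z))
        + 2 * (ennreal ((cmod b)\<^sup>2) * hnorm (\<lambda>z. (\<Sum>k<n. leray_term \<gamma> k h z) - H z))"
    show "\<forall>\<^sub>F n in sequentially. hnorm (\<lambda>z. ?s n z - (a * G z + b * H z)) \<le> ?u n"
    proof (intro always_eventually allI)
      fix n
      have d: "(\<lambda>z. (\<Sum>k<n. leray_term \<gamma> k g z) - G z) \<in> borel_measurable (hmeasure \<gamma> r)"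
        "(\<lambda>z. (\<Sum>k<n. leray_term \<gamma> k h z) - H z) \<in> borel_measurable (hmeasure \<gamma> r)"
        using m by (auto intro!: borel_measurable_diff)
      have "hnorm (\<lambda>z. ?s n z - (a * G z + b * H z))
          = hnorm (\<lambda>z. a * ((\<Sum>k<n. leray_term \<gamma> k g z) - G z) + b * ((\<Sum>k<n. leray_term \<gamma> k h z) - H z))"
        by (simp add: algebra_simps)
      also have "\<dots> \<le> 2 * hnorm (\<lambda>z. a * ((\<Sum>k<n. leray_term \<gamma> k g z) - G z)) + 2 * hnorm (\<lambda>z. b
          * ((\<Sum>k<n. leray_term \<gamma> k h z) - H z))"
        using d by (intro l2sq_add_le borel_measurable_times borel_measurable_const)
      also have "\<dots> = ?u n"
        using d by (simp only: l2sq_cmult)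
      finally show "hnorm (\<lambda>z. ?s n z - (a * G z + b * H z)) \<le> ?u n" .
    qed
    have "?u \<longlonglongrightarrow> 2 * (ennreal ((cmod a)\<^sup>2) * 0) + 2 * (ennreal ((cmod b)\<^sup>2) * 0)"
      by (intro tendsto_add ennreal_tendsto_cmult G'(2) H'(2)) auto
    then show "?u \<longlonglongrightarrow> 0" by simp
  qed auto
qed

lemma leray_coeff_add:
  assumes f: "sqint f" and g: "sqint g"
  shows "AE x in halfplane. leray_coeff k (\<lambda>z. f z + g z) x = leray_coeff k f x + leray_coeff k g x"
proof -
  note m = measurable_angular_coeff[OF sqint_measurable]
  have fg: "sqint (\<lambda>z. f z + g z)" using f g by (rule square_integrable_add)
  have sp: "AE x in halfplane. x \<in> space halfplane" by (rule AE_space)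
  show ?thesis
    using AE_integrable_angular_coeff[OF f] AE_integrable_angular_coeff[OF g] sp
  proof eventually_elim
    case (elim x)
    have "leray_coeff k (\<lambda>z. f z + g z) x = leray_op \<gamma> k (\<lambda>y. angular_coeff \<gamma> (int k) f y
        + angular_coeff \<gamma> (int k) g y) x"
      unfolding leray_coeff_def
      by (intro leray_op_cong_AE elim m fg borel_measurable_add f g angular_coeff_add[OF f g])
    also have "\<dots> = leray_coeff k f x + leray_coeff k g x"
      unfolding leray_coeff_def using elim by (intro leray_op_add) auto
    finally show ?case .
  qed
qed

lemma leray_coeff_cmult: "leray_coeff k (\<lambda>z. c * f z) x = c * leray_coeff k f x"
  unfolding leray_coeff_def angular_coeff_cmult[abs_def] by (rule leray_op_cmult)

text \<open>By Bessel's inequality a Fourier coefficient depends continuously on the function, and from the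
  \<open>k\<close>-th on the partial sums have the asserted coefficient.\<close>

lemma angular_coeff_leray_transform:
  assumes f: "sqint f" and g: "is_leray_transform \<gamma> r f g"
  shows "AE x in halfplane. angular_coeff \<gamma> (int k) g x = leray_coeff k f x"
proof -
  have g': "sqint g" "(\<lambda>n. hnorm (\<lambda>z. (\<Sum>k<n. leray_term \<gamma> k f z) - g z)) \<longlonglongrightarrow> 0"
    using g is_leray_transform_iff[OF f] by auto
  have m: "angular_coeff \<gamma> (int k) g \<in> borel_measurable halfplane"
    by (intro measurable_angular_coeff sqint_measurable g')
  have le: "ennreal (2 * pi) * wnorm (\<lambda>x. leray_coeff k f x - angular_coeff \<gamma> (int k) g x)
      \<le> hnorm (\<lambda>z. (\<Sum>k<n. leray_term \<gamma> k f z) - g z)" if n: "n > k" for n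
  proof -
    let ?s = "\<lambda>z. \<Sum>k<n. leray_term \<gamma> k f z"
    have s: "sqint ?s" by (intro sqint_leray_sum f) simp
    have mg: "sqint (\<lambda>z. - 1 * g z)" by (rule square_integrable_cmult[OF g'(1)])
    have d: "sqint (\<lambda>z. ?s z - g z)" by (rule square_integrable_diff[OF s g'(1)])
    have "AE x in halfplane. angular_coeff \<gamma> (int k) (\<lambda>z. ?s z - g z) x
        = leray_coeff k f x - angular_coeff \<gamma> (int k) g x"
      using leray_sum(2)[OF f finite_lessThan lessThan_iff[THEN
          iffD2, OF n]] angular_coeff_add[OF s mg, of "int k"]
      by eventually_elim (simp add: angular_coeff_cmult[of _ _ "-1", simplified])
    then have "wnorm (\<lambda>x. leray_coeff k f x - angular_coeff \<gamma> (int k) g x)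
        = wnorm (angular_coeff \<gamma> (int k) (\<lambda>z. ?s z - g z))"
      by (intro l2sq_cong_AE) (auto simp: AE_weighted_halfplane)
    then show ?thesis
      using square_integrable_angular_coeff(2)[OF d, of "int k"] by simp
  qed
  have "ennreal (2 * pi) * wnorm (\<lambda>x. leray_coeff k f x - angular_coeff \<gamma> (int k) g x) \<le> 0"
    by (rule LIMSEQ_le_const[OF g'(2)]) (use le in \<open>auto intro!: exI[of _ "Suc k"]\<close>)
  then have "wnorm (\<lambda>x. leray_coeff k f x - angular_coeff \<gamma> (int k) g x) = 0"
    by auto
  then have "AE x in weighted_halfplane r. leray_coeff k f x - angular_coeff \<gamma> (int k) g x = 0"
    using m measurable_leray_coeff[OF f] by (intro l2sq_eq_0) auto
  then show ?thesis unfolding AE_weighted_halfplane by eventually_elim simp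
qed

lemma leray_coeff_leray_transform:
  assumes f: "sqint f" and g: "is_leray_transform \<gamma> r f g"
  shows "AE x in halfplane. leray_coeff k g x = leray_coeff k f x"
proof -
  have g': "sqint g" using g is_leray_transform_iff[OF f] by auto
  have "AE x in halfplane. leray_op \<gamma> k (leray_op \<gamma> k (angular_coeff \<gamma> (int k) f)) x
      = leray_op \<gamma> k (angular_coeff \<gamma> (int k) f) x"
    by (intro leray_op_idempotent[OF \<gamma> C] square_integrable_angular_coeff f)
  then show ?thesis
    using AE_space
  proof eventually_elim
    case (elim x)
    have "leray_coeff k g x = leray_op \<gamma> k (leray_coeff k f) x"
      unfolding leray_coeff_def[of k g]
      by (intro leray_op_cong_AE elim measurable_angular_coeff sqint_measurable g' measurable_leray_coeff f
          angular_coeff_leray_transform[OF f g])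
    then show ?case using elim by (simp add: leray_coeff_def)
  qed
qed

text \<open>For square-integrable \<open>f\<close> the integrals that define the terms converge almost everywhere, so the
  extension of the transform to \<open>L\<^sup>2\<close> is given by the same formula; only a representative is chosen.\<close>

definition leray_L2 :: "(complex \<times> complex \<Rightarrow> complex) \<Rightarrow> complex \<times> complex \<Rightarrow> complex" where
  "leray_L2 f = (SOME g. is_leray_transform \<gamma> r f g)"

lemma leray_L2: "sqint f \<Longrightarrow> is_leray_transform \<gamma> r f (leray_L2 f)"
  unfolding leray_L2_def by (rule someI_ex[OF leray_transform_exists])

lemma sqint_leray_L2: "sqint f \<Longrightarrow> sqint (leray_L2 f)"
  using leray_L2 is_leray_transform_iff by blast

lemma leray_L2_norm: "sqint f \<Longrightarrow> l2norm (hmeasure \<gamma> r) (leray_L2 f) \<le> sqrt (2 * C) * l2norm (hmeasure \<gamma> r) f"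
  using C leray_transform_bounded[OF _ leray_L2]
  by (intro l2norm_le sqint_leray_L2) (auto simp: kernel_bound_def)

lemma bounded_linear_leray_L2: "bounded_linear_L2 (hmeasure \<gamma> r) leray_L2"
  unfolding bounded_linear_L2_def
proof (intro conjI allI impI)
  fix f g assume f: "sqint f" and g: "sqint g"
  show "AE x in hmeasure \<gamma> r. leray_L2 (\<lambda>y. f y + g y) x = leray_L2 f x + leray_L2 g x"
    using leray_transform_combination[OF square_integrable_add[OF f g] f g, of 1 1] leray_coeff_add[OF f g]
      leray_L2[OF square_integrable_add[OF f g]] leray_L2[OF f] leray_L2[OF g] by simp
next
  fix c f assume f: "sqint f"
  show "AE x in hmeasure \<gamma> r. leray_L2 (\<lambda>y. c * f y) x = c * leray_L2 f x"
    using leray_transform_combination[OF square_integrable_cmult[OF f, of c] f f, of c 0]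
      leray_L2[OF square_integrable_cmult[OF f, of c]] leray_L2[OF f] by (simp add: leray_coeff_cmult)
next
  show "\<exists>D. \<forall>f. sqint f \<longrightarrow> l2norm (hmeasure \<gamma> r) (leray_L2 f) \<le> D * l2norm (hmeasure \<gamma> r) f"
    using leray_L2_norm by blast
qed (rule sqint_leray_L2)

lemma leray_L2_idempotent:
  assumes f: "sqint f"
  shows "AE z in hmeasure \<gamma> r. leray_L2 (leray_L2 f) z = leray_L2 f z"
  using leray_transform_combination[OF sqint_leray_L2[OF f] f f _ leray_L2[OF sqint_leray_L2[OF f]]
      leray_L2[OF f] leray_L2[OF f], of 1 0]
    leray_coeff_leray_transform[OF f leray_L2[OF f]] by simp

end

lemma nn_integral_weighted_box:
  fixes g :: "real \<Rightarrow> real"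
  assumes [measurable]: "g \<in> borel_measurable borel" and "0 < a" "c \<le> d"
  shows "(\<integral>\<^sup>+x. ennreal (g (snd x)) * indicator ({c..d} \<times> {a..b}) x \<partial>weighted_halfplane r)
    = ennreal (d - c) * (\<integral>\<^sup>+\<alpha>. ennreal (g \<alpha>) * ennreal (\<alpha> powr r) * indicator {a..b} \<alpha> \<partial>lborel)"
proof -
  have ind: "indicator ({c..d} \<times> {a..b}) x = (indicator {c..d} (fst x)
      * indicator {a..b} (snd x) :: ennreal)" for x :: "real \<times> real"
    by (cases x) (auto simp: indicator_def)
  have "(\<integral>\<^sup>+x. ennreal (g (snd x)) * indicator ({c..d} \<times> {a..b}) x \<partial>weighted_halfplane r)
     = (\<integral>\<^sup>+\<alpha>. \<integral>\<^sup>+s. ennreal (g \<alpha>) * ennreal (\<alpha> powr r) * indicator {a..b} \<alpha> * indicator {c..d} s \<partial>lborel \<partial>rays)"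
    unfolding ind
    by (subst nn_integral_weighted_halfplane, measurable, subst nn_integral_halfplane, measurable)
       (simp add: mult_ac)
  also have "\<dots> = (\<integral>\<^sup>+\<alpha>. ennreal (g \<alpha>) * ennreal (\<alpha> powr r) * indicator {a..b} \<alpha> * ennreal (d - c) \<partial>rays)"
    using assms by (simp add: nn_integral_cmult)
  also have "\<dots> = (\<integral>\<^sup>+\<alpha>. ennreal (d - c) * (ennreal (g \<alpha>) * ennreal (\<alpha> powr r) * indicator {a..b} \<alpha>) \<partial>lborel)"
    unfolding nn_integral_rays using assms(2) by (intro nn_integral_cong) (auto simp: indicator_def mult_ac)
  also have "\<dots> = ennreal (d - c) * (\<integral>\<^sup>+\<alpha>. ennreal (g \<alpha>) * ennreal (\<alpha> powr r) * indicator {a..b} \<alpha> \<partial>lborel)"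
    by (intro nn_integral_cmult) measurable
  finally show ?thesis .
qed

lemma nn_integral_powr_Icc_finite:
  fixes a b p :: real
  assumes "0 < a"
  shows "(\<integral>\<^sup>+\<alpha>. ennreal (\<alpha> powr p) * indicator {a..b} \<alpha> \<partial>lborel) < \<infinity>"
proof -
  have "(\<integral>\<^sup>+\<alpha>. ennreal (\<alpha> powr p) * indicator {a..b} \<alpha> \<partial>lborel)
      \<le> (\<integral>\<^sup>+\<alpha>. ennreal (a powr p + b powr p) * indicator {a..b} \<alpha> \<partial>lborel)"
  proof (intro nn_integral_mono)
    fix \<alpha> :: real
    have "\<alpha> powr p \<le> a powr p + b powr p" if "a \<le> \<alpha>" "\<alpha> \<le> b"
      using powr_le_endpoints[OF assms] that by simp
    then show "ennreal (\<alpha> powr p) * indicator {a..b} \<alpha> \<le> ennreal (a powr p + b powr p) * indicator {a..b} \<alpha>"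
      by (auto simp: indicator_def simp del: ennreal_plus intro!: ennreal_leI)
  qed
  also have "\<dots> < \<infinity>"
    by (simp add: nn_integral_cmult ennreal_mult_less_top emeasure_lborel_Icc_eq del: ennreal_plus)
  finally show ?thesis .
qed

lemma square_integrable_test_function:
  assumes f: "test_function \<gamma> f"
  shows "square_integrable (hmeasure \<gamma> r) f"
proof -
  from f have fm: "hmeasurable \<gamma> f"
    by (simp add: test_function_def)
  from f obtain B where B: "\<And>z. z \<in> hypersurface \<gamma> \<Longrightarrow> cmod (f z) \<le> B"
    by (auto simp: test_function_def bounded_iff)
  from f obtain K where K: "compact K" "K \<subseteq> hypersurface \<gamma> - {\<zeta>. fst \<zeta> = 0}"
    "\<And>z. z \<in> hypersurface \<gamma> - K \<Longrightarrow> f z = 0"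
    by (auto simp: test_function_def)
  obtain R where R: "\<And>z. z \<in> K \<Longrightarrow> norm z \<le> R"
    using compact_imp_bounded[OF K(1)] by (auto simp: bounded_iff)
  obtain e where e: "e > 0" "\<And>z. z \<in> K \<Longrightarrow> e \<le> cmod (fst z)"
  proof (cases "K = {}")
    case False
    have "continuous_on K (\<lambda>z. cmod (fst z))" by (intro continuous_intros)
    from continuous_attains_inf[OF K(1) False this] obtain z0 where
      z0: "z0 \<in> K" "\<And>z. z \<in> K \<Longrightarrow> cmod (fst z0) \<le> cmod (fst z)" by blast
    have "cmod (fst z0) > 0" using z0(1) K(2) by auto
    then show ?thesis using z0(2) that by blast
  qed (use that[of 1] in auto)
  define S where "S = max R 1"
  have box: "x \<in> {-S..S} \<times> {e..S}" if "x \<in> space halfplane" "\<theta> \<in> {0..<2*pi}" "f (polar_point \<gamma> x \<theta>) \<noteq> 0" for x \<theta>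
  proof -
    let ?z = "polar_point \<gamma> x \<theta>"
    have "?z \<in> hypersurface \<gamma>" using that(1) by (auto simp: polar_point_def intro!: hparam_in_hypersurface)
    then have z: "?z \<in> K" using K(3) that(3) by blast
    have "\<bar>Re (snd ?z)\<bar> \<le> S" "cmod (fst ?z) \<le> S"
      using R[OF z] abs_Re_le_cmod[of "snd ?z"] norm_snd_le[of "snd ?z" "fst ?z"] norm_fst_le[of "fst ?z"
          "snd ?z"]
      unfolding S_def prod.collapse by auto
    then show ?thesis
      using e(2)[OF z] polar_point_coords[OF that(1,2), of \<gamma>] by (cases x) auto
  qed
  have "l2sq (hmeasure \<gamma> r) f \<le> (\<integral>\<^sup>+x. ennreal (B\<^sup>2 * (2 * pi))
      * indicator ({-S..S} \<times> {e..S}) x \<partial>weighted_halfplane r)"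
    unfolding l2sq_hmeasure[OF fm]
  proof (intro nn_integral_mono)
    fix x assume x: "x \<in> space (weighted_halfplane r)"
    have "fibre_sq \<gamma> f x
        \<le> (\<integral>\<^sup>+\<theta>. ennreal (B\<^sup>2) * indicator ({-S..S} \<times> {e..S}) x \<partial>circle)"
    proof (intro nn_integral_mono)
      fix \<theta> assume \<theta>: "\<theta> \<in> space circle"
      show "ennreal ((cmod (f (polar_point \<gamma> x \<theta>)))\<^sup>2) \<le> ennreal (B\<^sup>2) * indicator ({-S..S} \<times> {e..S}) x"
      proof (cases "f (polar_point \<gamma> x \<theta>) = 0")
        case False
        have "cmod (f (polar_point \<gamma> x \<theta>)) \<le> B"
          using x by (intro B) (auto simp: polar_point_def intro!: hparam_in_hypersurface)
        then have "(cmod (f (polar_point \<gamma> x \<theta>)))\<^sup>2 \<le> B\<^sup>2" by (intro power_mono) auto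
        then show ?thesis using box[of x \<theta>] x \<theta> False by (auto intro!: ennreal_leI)
      qed simp
    qed
    also have "\<dots> = ennreal (B\<^sup>2) * indicator ({-S..S} \<times> {e..S}) x * ennreal (2 * pi)"
      by (simp add: circle_def emeasure_restrict_space space_restrict_space)
    finally show "fibre_sq \<gamma> f x \<le> ennreal (B\<^sup>2 * (2 * pi)) * indicator ({-S..S} \<times> {e..S}) x"
      by (simp add: ennreal_mult mult_ac)
  qed
  also have "\<dots> = ennreal (2 * S) * (\<integral>\<^sup>+\<alpha>. ennreal (B\<^sup>2 * (2 * pi)) * ennreal (\<alpha> powr r)
      * indicator {e..S} \<alpha> \<partial>lborel)"
    using nn_integral_weighted_box[where g = "\<lambda>_. B\<^sup>2 * (2 * pi)" and a = e and b = S and c = "-S" and d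
        = S and r = r] e by (simp add: S_def)
  also have "\<dots> < \<infinity>"
  proof -
    have "(\<integral>\<^sup>+\<alpha>. ennreal (B\<^sup>2 * (2 * pi)) * ennreal (\<alpha> powr r) * indicator {e..S} \<alpha> \<partial>lborel)
        = ennreal (B\<^sup>2 * (2 * pi)) * (\<integral>\<^sup>+\<alpha>. ennreal (\<alpha> powr r) * indicator {e..S} \<alpha> \<partial>lborel)"
      unfolding mult.assoc by (intro nn_integral_cmult) measurable
    then show ?thesis
      using nn_integral_powr_Icc_finite[OF e(1), of r S] by (simp add: ennreal_mult_less_top)
  qed
  finally show ?thesis using fm by (simp add: square_integrable_iff_l2sq)
qed

theorem leray_projection_in_range:
  assumes \<gamma>: "\<gamma> > 1" and r: "-1 < r" "r < 2 * \<gamma> - 1"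
  shows "leray_bounded_projection \<gamma> r"
proof -
  obtain C where "kernel_bound \<gamma> r C"
    using ex_kernel_bound[OF \<gamma> r] by blast
  then interpret bounded_leray_kernel \<gamma> r C by unfold_locales (use \<gamma> in auto)
  have "leray_bounded \<gamma> r"
    unfolding leray_bounded_def using leray_L2 leray_L2_norm square_integrable_test_function by blast
  moreover have "is_leray_extension \<gamma> r leray_L2"
    unfolding is_leray_extension_def using bounded_linear_leray_L2 leray_L2
        square_integrable_test_function by blast
  ultimately show ?thesis
    unfolding leray_bounded_projection_def using leray_L2_idempotent by blast
qed

section \<open>Failure outside the range\<close>

text \<open>Functions that do not depend on the angle, so that only the term \<open>k = 0\<close> of the transform survives.\<close>

definition bump :: "real \<Rightarrow> real \<Rightarrow> real \<Rightarrow> complex \<times> complex \<Rightarrow> complex" where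
  "bump a b q z = of_real (indicator {0..1} (Re (snd z)) * indicator {a..b} (cmod (fst z))
      * cmod (fst z) powr q)"

definition radial_bump :: "real \<Rightarrow> real \<Rightarrow> real \<Rightarrow> real \<times> real \<Rightarrow> complex" where
  "radial_bump a b q x = of_real (indicator {0..1} (fst x) * indicator {a..b} (snd x) * snd x powr q)"

lemma measurable_bump: "hmeasurable \<gamma> (bump a b q)"
proof (rule measurable_restrict_space1)
  have [measurable]: "(\<lambda>z. fst z) \<in> borel_measurable (borel :: (complex \<times> complex) measure)"
    "(\<lambda>z. snd z) \<in> borel_measurable (borel :: (complex \<times> complex) measure)"
    by (intro borel_measurable_continuous_onI continuous_intros)+
  show "bump a b q \<in> borel_measurable borel"
    unfolding bump_def[abs_def] by measurable
qed

lemma bump_polar_point: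
  assumes "x \<in> space halfplane" "\<theta> \<in> {0..<2*pi}"
  shows "bump a b q (polar_point \<gamma> x \<theta>) = radial_bump a b q x"
  unfolding bump_def radial_bump_def polar_point_coords[OF assms] ..

lemma test_function_bump:
  assumes a: "0 < a"
  shows "test_function \<gamma> (bump a b q)"
  unfolding test_function_def
proof (intro conjI)
  show "hmeasurable \<gamma> (bump a b q)"
    by (rule measurable_bump)
  have "cmod (bump a b q z) \<le> a powr q + b powr q" for z
  proof (cases "cmod (fst z) \<in> {a..b}")
    case True
    have "cmod (fst z) powr q \<le> a powr q + b powr q"
      by (rule powr_le_endpoints[OF a True])
    then show ?thesis by (auto simp: bump_def indicator_def norm_mult)
  qed (simp add: bump_def)
  then show "bounded (bump a b q ` hypersurface \<gamma>)"
    unfolding bounded_iff by blast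
  define K where "K = hparam \<gamma> ` ({0..1} \<times> {a..b} \<times> {0..2*pi})"
  show "\<exists>K. compact K \<and> K \<subseteq> hypersurface \<gamma> - {\<zeta>. fst \<zeta> = 0} \<and> (\<forall>\<zeta>\<in>hypersurface \<gamma> - K. bump a b q \<zeta> = 0)"
  proof (intro exI[of _ K] conjI ballI)
    have "continuous_on ({0..1} \<times> {a..b} \<times> {0..2*pi})
        (\<lambda>x. (complex_of_real (fst (snd x)) * cis (snd (snd x)), of_real (fst x) + \<i>
            * of_real (fst (snd x) powr \<gamma>)))"
      using a by (intro continuous_intros) auto
    moreover have "hparam \<gamma> = (\<lambda>x. (complex_of_real (fst (snd x)) * cis (snd (snd x)), of_real (fst x) + \<i>
        * of_real (fst (snd x) powr \<gamma>)))"
      by (auto simp: hparam_def complex_eq_iff)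
    ultimately show "compact K"
      unfolding K_def by (intro compact_continuous_image compact_Times) auto
    show "K \<subseteq> hypersurface \<gamma> - {\<zeta>. fst \<zeta> = 0}"
      using a unfolding K_def by (auto intro!: hparam_in_hypersurface simp: hparam_def hypersurface_def
          norm_mult)
    fix z assume z: "z \<in> hypersurface \<gamma> - K"
    show "bump a b q z = 0"
    proof (rule ccontr)
      assume "bump a b q z \<noteq> 0"
      then have *: "Re (snd z) \<in> {0..1}" "cmod (fst z) \<in> {a..b}"
        by (auto simp: bump_def indicator_def split: if_splits)
      have "z = hparam \<gamma> (Re (snd z), cmod (fst z), Arg2pi (fst z))"
        using z Arg2pi[of "fst z"]
        by (auto simp: hparam_def hypersurface_def is_Arg_def cis_conv_exp complex_eq_iff prod_eq_iff)
      then have "z \<in> K"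
        unfolding K_def using * Arg2pi[of "fst z"] by (intro image_eqI) auto
      then show False using z by simp
    qed
  qed
qed

lemma angular_coeff_bump:
  assumes x: "x \<in> space halfplane"
  shows "angular_coeff \<gamma> k (bump a b q) x = (if k = 0 then radial_bump a b q x else 0)"
proof -
  have "(LINT \<theta>|circle. bump a b q (polar_point \<gamma> x \<theta>) * cis (- of_int k * \<theta>))
     = (LINT \<theta>|circle. radial_bump a b q x * cis (of_int (- k) * \<theta>))"
    using x by (intro Bochner_Integration.integral_cong refl) (simp add: bump_polar_point)
  also have "\<dots> = radial_bump a b q x * (if k = 0 then 2 * of_real pi else 0)"
    by (simp only: integral_mult_right_zero circle_integral_cis neg_equal_0_iff_equal)
  finally show ?thesis by (simp add: angular_coeff_eq)
qed

lemma leray_radial_cong: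
  assumes "\<And>x. x \<in> space halfplane \<Longrightarrow> u x = v x"
  shows "leray_radial \<gamma> k u z = leray_radial \<gamma> k v z"
  unfolding leray_radial_def using assms by (intro Bochner_Integration.integral_cong refl) auto

lemma leray_term_bump:
  assumes x: "x \<in> space halfplane" and \<theta>: "\<theta> \<in> {0..<2*pi}"
  shows "leray_term \<gamma> k (bump a b q) (polar_point \<gamma> x \<theta>) = (if k
      = 0 then leray_radial \<gamma> 0 (radial_bump a b q) x else 0)"
proof -
  have "leray_radial \<gamma> k (angular_coeff \<gamma> (int k) (bump a b q)) x
      = leray_radial \<gamma> k (\<lambda>x. if k = 0 then radial_bump a b q x else 0) x"
    by (rule leray_radial_cong) (simp add: angular_coeff_bump)
  then show ?thesis
    unfolding leray_term_polar_point[OF x \<theta>] by (auto simp: leray_radial_def)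
qed

lemma l2sq_radial:
  assumes f: "hmeasurable \<gamma> f"
    and "\<And>x \<theta>. x \<in> space halfplane \<Longrightarrow> \<theta> \<in> {0..<2*pi} \<Longrightarrow> f (polar_point \<gamma> x \<theta>) = u x"
  shows "l2sq (hmeasure \<gamma> r) f = (\<integral>\<^sup>+x. ennreal (2 * pi) * ennreal ((cmod (u x))\<^sup>2) \<partial>weighted_halfplane r)"
  unfolding l2sq_hmeasure[OF f]
proof (intro nn_integral_cong)
  fix x assume "x \<in> space (weighted_halfplane r)"
  then have "fibre_sq \<gamma> f x = (\<integral>\<^sup>+\<theta>. ennreal ((cmod (u x))\<^sup>2) \<partial>circle)"
    using assms(2) by (intro nn_integral_cong) auto
  also have "\<dots> = ennreal (2 * pi) * ennreal ((cmod (u x))\<^sup>2)"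
    by (simp add: circle_def emeasure_restrict_space space_restrict_space mult.commute)
  finally show "fibre_sq \<gamma> f x = \<dots>" .
qed

lemma l2sq_leray_transform_bump:
  assumes "0 < a" and g: "is_leray_transform \<gamma> r (bump a b q) g"
  shows "l2sq (hmeasure \<gamma> r) g = l2sq (hmeasure \<gamma> r) (leray_term \<gamma> 0 (bump a b q))"
proof -
  let ?L = "\<lambda>k. leray_term \<gamma> k (bump a b q)"
  have g': "square_integrable (hmeasure \<gamma> r) g" "\<And>k. square_integrable (hmeasure \<gamma> r) (?L k)"
    "(\<lambda>n. l2norm (hmeasure \<gamma> r) (\<lambda>z. (\<Sum>k<n. ?L k z) - g z)) \<longlonglongrightarrow> 0"
    using g by (auto simp: is_leray_transform_def)
  have Lm: "?L k \<in> borel_measurable (restrict_space borel (hypersurface \<gamma>))" for k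
    by (intro measurable_leray_term measurable_bump)
  have sq: "square_integrable (hmeasure \<gamma> r) (\<lambda>z. (\<Sum>k<n. ?L k z) - g z)" for n
    by (intro square_integrable_diff square_integrable_sum g')
  have "AE z in hmeasure \<gamma> r. (\<Sum>k<n. ?L k z) = ?L 0 z" if "n > 0" for n
  proof (rule AE_hmeasure_eqI)
    show "AE x in halfplane. \<forall>\<theta>\<in>{0..<2*pi}. (\<Sum>k<n. ?L k (polar_point \<gamma> x \<theta>)) = ?L 0 (polar_point \<gamma> x \<theta>)"
      using that by (intro AE_I2) (auto simp: leray_term_bump)
  qed (use Lm in \<open>auto intro!: borel_measurable_sum\<close>)
  then have "l2sq (hmeasure \<gamma> r) (\<lambda>z. (\<Sum>k<n. ?L k z) - g z)
      = l2sq (hmeasure \<gamma> r) (\<lambda>z. ?L 0 z - g z)" if "n > 0" for n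
    using that by (intro l2sq_cong_AE) fastforce
  then have "eventually (\<lambda>n. l2sq (hmeasure \<gamma> r) (\<lambda>z. (\<Sum>k<n. ?L k z) - g z)
      = l2sq (hmeasure \<gamma> r) (\<lambda>z. ?L 0 z - g z)) sequentially"
    by (intro eventually_sequentiallyI[of 1]) auto
  moreover have "(\<lambda>n. l2sq (hmeasure \<gamma> r) (\<lambda>z. (\<Sum>k<n. ?L k z) - g z)) \<longlonglongrightarrow> 0"
    using g'(3) l2norm_tendsto_0_iff[OF sq] by simp
  ultimately have "(\<lambda>n::nat. l2sq (hmeasure \<gamma> r) (\<lambda>z. ?L 0 z - g z)) \<longlonglongrightarrow> 0"
    by (rule Lim_transform_eventually[rotated])
  then have "l2sq (hmeasure \<gamma> r) (\<lambda>z. ?L 0 z - g z) = 0"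
    by (simp add: LIMSEQ_const_iff)
  then have "AE z in hmeasure \<gamma> r. ?L 0 z - g z = 0"
    using Lm square_integrable_measurable[OF g'(1)] by (intro l2sq_eq_0) auto
  then show ?thesis by (intro l2sq_cong_AE) auto
qed

definition powr_integral :: "real \<Rightarrow> real \<Rightarrow> real \<Rightarrow> ennreal" where
  "powr_integral a b p = (\<integral>\<^sup>+\<alpha>. ennreal (\<alpha> powr p) * indicator {a..b} \<alpha> \<partial>lborel)"

lemma nn_integral_box_powr_integral:
  assumes "0 < a" "0 \<le> m"
  shows "(\<integral>\<^sup>+x. ennreal m * indicator ({0..1} \<times> {a..b}) x \<partial>weighted_halfplane p)
      = ennreal m * powr_integral a b p"
proof -
  have "(\<integral>\<^sup>+\<alpha>. ennreal m * ennreal (\<alpha> powr p) * indicator {a..b} \<alpha> \<partial>lborel) = ennreal m * powr_integral a b p"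
    unfolding powr_integral_def mult.assoc by (intro nn_integral_cmult) measurable
  then show ?thesis
    using nn_integral_weighted_box[where g = "\<lambda>_. m" and a = a and b = b and c = 0 and d = 1 and r
        = p] assms by simp
qed

text \<open>There is no cancellation: with \<open>Re A \<ge> 2\<close> and \<open>|Im A| \<le> 1\<close> the real part of \<open>A\<^sup>-\<^sup>2\<close> is at least
  \<open>1 / (4 (Re A)\<^sup>2)\<close>.\<close>

lemma leray_radial_lower_bound:
  assumes \<gamma>: "\<gamma> > 1" and a: "0 < a" and z: "z \<in> space halfplane" "fst z \<in> {0..1}"
    and lo: "\<And>\<alpha>. \<alpha> \<in> {a..b} \<Longrightarrow> 2 \<le> (\<gamma> - 1) * \<alpha> powr \<gamma> + snd z powr \<gamma>"
    and hi: "\<And>\<alpha>. \<alpha> \<in> {a..b} \<Longrightarrow> (\<gamma> - 1) * \<alpha> powr \<gamma> + snd z powr \<gamma> \<le> U"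
  shows "ennreal (\<gamma>\<^sup>2 / (8 * pi * U\<^sup>2)) * powr_integral a b (\<gamma> - 1 + q)
      \<le> ennreal (cmod (leray_radial \<gamma> 0 (radial_bump a b q) z))"
proof -
  define m where "m = \<gamma>\<^sup>2 / (8 * pi * U\<^sup>2)"
  define p where "p = \<gamma> - 1 + q"
  define Q :: "(real \<times> real) set" where "Q = {0..1} \<times> {a..b}"
  let ?K = "\<lambda>\<zeta>. leray_kernel \<gamma> 0 z \<zeta> * radial_bump a b q \<zeta>"
  have mz [measurable]: "(\<lambda>_. z) \<in> halfplane \<rightarrow>\<^sub>M halfplane" using z(1) by (rule measurable_const)
  have m0: "m \<ge> 0" by (simp add: m_def)
  have K0: "?K \<zeta> = 0" if "\<zeta> \<notin> Q" for \<zeta>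
    using that by (cases \<zeta>) (auto simp: radial_bump_def Q_def indicator_def)
  have K1: "m * snd \<zeta> powr p \<le> Re (?K \<zeta>)" "cmod (?K \<zeta>) \<le> \<gamma>\<^sup>2 * snd \<zeta> powr p" if \<zeta>: "\<zeta> \<in> Q" for \<zeta>
  proof -
    obtain s \<alpha> where \<zeta>': "\<zeta> = (s, \<alpha>)" "s \<in> {0..1}" "\<alpha> \<in> {a..b}" using \<zeta> by (auto simp: Q_def)
    define A where "A = (\<gamma> - 1) * \<alpha> powr \<gamma> + snd z powr \<gamma>"
    define t where "t = s - fst z"
    have A: "2 \<le> A" "A \<le> U" using lo hi \<zeta>'(3) by (auto simp: A_def)
    have t: "\<bar>t\<bar> \<le> 1" using \<zeta>'(2) z(2) by (auto simp: t_def)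
    have K: "?K \<zeta> = of_real (\<gamma>\<^sup>2 / (2 * pi) * \<alpha> powr p) * (1 / (Complex A t)\<^sup>2)"
      using \<zeta>' by (simp add: leray_kernel_def leray_A_def radial_bump_def A_def t_def p_def powr_add
          power2_eq_square)
    have t2: "t\<^sup>2 \<le> A\<^sup>2 / 4"
    proof -
      have "t\<^sup>2 \<le> 1" using t by (simp add: abs_square_le_1)
      moreover have "2\<^sup>2 \<le> A\<^sup>2" using A by (intro power_mono) auto
      ultimately show ?thesis by simp
    qed
    have inv: "Re (1 / (Complex A t)\<^sup>2) = (A\<^sup>2 - t\<^sup>2) / (A\<^sup>2 + t\<^sup>2)\<^sup>2"
    proof -
      have "(Complex A t)\<^sup>2 = Complex (A\<^sup>2 - t\<^sup>2) (2 * A * t)"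
        by (simp add: power2_eq_square complex_eq_iff)
      moreover have "(A\<^sup>2 - t\<^sup>2)\<^sup>2 + (2 * A * t)\<^sup>2 = (A\<^sup>2 + t\<^sup>2)\<^sup>2"
        by (simp add: power2_eq_square algebra_simps)
      ultimately show ?thesis by (simp add: Re_divide)
    qed
    have "1 / (4 * U\<^sup>2) \<le> 1 / (4 * A\<^sup>2)"
      using A by (intro divide_left_mono mult_left_mono power_mono) auto
    also have "\<dots> = (A\<^sup>2 / 2) / (2 * (A\<^sup>2 * A\<^sup>2))" using A by (simp add: field_simps)
    also have "\<dots> \<le> (A\<^sup>2 - t\<^sup>2) / (A\<^sup>2 + t\<^sup>2)\<^sup>2"
    proof (intro frac_le)
      show "A\<^sup>2 / 2 \<le> A\<^sup>2 - t\<^sup>2" using t2 zero_le_power2[of A] by linarith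
      have "(A\<^sup>2 + t\<^sup>2)\<^sup>2 \<le> (5 / 4 * A\<^sup>2)\<^sup>2" using t2 by (intro power_mono) auto
      also have "\<dots> = 25 / 16 * (A\<^sup>2 * A\<^sup>2)" by (simp add: power2_eq_square)
      also have "\<dots> \<le> 2 * (A\<^sup>2 * A\<^sup>2)" by (intro mult_right_mono) auto
      finally show "(A\<^sup>2 + t\<^sup>2)\<^sup>2 \<le> 2 * (A\<^sup>2 * A\<^sup>2)" .
      show "0 \<le> A\<^sup>2 - t\<^sup>2" using t2 zero_le_power2[of A] by linarith
      have "0 < A\<^sup>2" using A(1) by (intro zero_less_power) linarith
      then show "0 < (A\<^sup>2 + t\<^sup>2)\<^sup>2" by (rule zero_less_power[OF add_pos_nonneg]) simp
    qed
    finally have R: "1 / (4 * U\<^sup>2) \<le> Re (1 / (Complex A t)\<^sup>2)" unfolding inv .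
    have "m * \<alpha> powr p = \<gamma>\<^sup>2 / (2 * pi) * \<alpha> powr p * (1 / (4 * U\<^sup>2))"
      by (simp add: m_def)
    also have "\<dots> \<le> \<gamma>\<^sup>2 / (2 * pi) * \<alpha> powr p * Re (1 / (Complex A t)\<^sup>2)"
      by (intro mult_left_mono R) simp
    also have "\<dots> = Re (?K \<zeta>)" unfolding K by (simp only: Re_complex_of_real times_complex.sel
        Im_complex_of_real)
    finally show "m * snd \<zeta> powr p \<le> Re (?K \<zeta>)" using \<zeta>' by simp
    have "1 \<le> cmod (Complex A t)" using A complex_Re_le_cmod[of "Complex A t"] by simp
    then have "1 \<le> (cmod (Complex A t))\<^sup>2" by simp
    then have "cmod (1 / (Complex A t)\<^sup>2) \<le> 1"
      unfolding norm_divide norm_power norm_one by (subst divide_le_eq_1_pos) linarith+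
    moreover have "\<gamma>\<^sup>2 / (2 * pi) \<le> \<gamma>\<^sup>2 / 1"
      using pi_gt3 by (intro divide_left_mono) auto
    ultimately have "\<gamma>\<^sup>2 / (2 * pi) * \<alpha> powr p * cmod (1 / (Complex A t)\<^sup>2) \<le> \<gamma>\<^sup>2 * \<alpha> powr p * 1"
      by (intro mult_mono) auto
    then show "cmod (?K \<zeta>) \<le> \<gamma>\<^sup>2 * snd \<zeta> powr p"
      unfolding K norm_mult[of "complex_of_real _"] norm_of_real using \<zeta>'(1) by simp
  qed
  have box: "(\<integral>\<^sup>+\<zeta>. ennreal (c * snd \<zeta> powr p) * indicator Q \<zeta> \<partial>halfplane)
      = ennreal c * powr_integral a b p" if "c \<ge> 0" for c
  proof -
    have "ennreal c * powr_integral a b p = (\<integral>\<^sup>+\<zeta>. ennreal c * indicator Q \<zeta>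
        * ennreal (snd \<zeta> powr p) \<partial>halfplane)"
      unfolding nn_integral_box_powr_integral[OF a that, symmetric] Q_def
    proof (rule nn_integral_weighted_halfplane)
      have "indicator ({0..1} \<times> {a..b}) \<zeta> = (indicator {0..1} (fst \<zeta>)
          * indicator {a..b} (snd \<zeta>) :: ennreal)" for \<zeta> :: "real \<times> real"
        by (cases \<zeta>) (auto simp: indicator_def)
      then show "(\<lambda>\<zeta>. ennreal c * indicator ({0..1} \<times> {a..b}) \<zeta>) \<in> borel_measurable halfplane"
        by simp measurable
    qed
    also have "\<dots> = (\<integral>\<^sup>+\<zeta>. ennreal (c * snd \<zeta> powr p) * indicator Q \<zeta> \<partial>halfplane)"
      using that by (intro nn_integral_cong) (simp add: ennreal_mult mult_ac)
    finally show ?thesis by simp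
  qed
  have [measurable]: "radial_bump a b q \<in> borel_measurable halfplane"
    unfolding radial_bump_def[abs_def] by measurable
  have int: "integrable halfplane ?K"
  proof (rule integrableI_bounded)
    have "(\<integral>\<^sup>+\<zeta>. ennreal (cmod (?K \<zeta>)) \<partial>halfplane)
        \<le> (\<integral>\<^sup>+\<zeta>. ennreal (\<gamma>\<^sup>2 * snd \<zeta> powr p) * indicator Q \<zeta> \<partial>halfplane)"
    proof (intro nn_integral_mono)
      fix \<zeta>
      show "ennreal (cmod (?K \<zeta>)) \<le> ennreal (\<gamma>\<^sup>2 * snd \<zeta> powr p) * indicator Q \<zeta>"
        using K1(2)[of \<zeta>] K0[of \<zeta>] by (cases "\<zeta> \<in> Q") (auto intro!: ennreal_leI simp del: mult_eq_0_iff
            norm_mult)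
    qed
    also have "\<dots> < \<infinity>"
      using nn_integral_powr_Icc_finite[OF a, of p b] box[of "\<gamma>\<^sup>2"]
          by (simp add: powr_integral_def ennreal_mult_less_top)
    finally show "(\<integral>\<^sup>+\<zeta>. ennreal (norm (?K \<zeta>)) \<partial>halfplane) < \<infinity>" .
  qed measurable
  have Re0: "Re (?K \<zeta>) \<ge> 0" for \<zeta>
  proof (cases "\<zeta> \<in> Q")
    case True
    have "0 \<le> m * snd \<zeta> powr p" using m0 by simp
    then show ?thesis using K1(1)[OF True] by linarith
  qed (simp add: K0 del: times_complex.sel)
  have "ennreal m * powr_integral a b p = (\<integral>\<^sup>+\<zeta>. ennreal (m * snd \<zeta> powr p) * indicator Q \<zeta> \<partial>halfplane)"
    using box[OF m0] by simp
  also have "\<dots> \<le> (\<integral>\<^sup>+\<zeta>. ennreal (Re (?K \<zeta>)) \<partial>halfplane)"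
  proof (intro nn_integral_mono)
    fix \<zeta>
    show "ennreal (m * snd \<zeta> powr p) * indicator Q \<zeta> \<le> ennreal (Re (?K \<zeta>))"
      using K1(1)[of \<zeta>] by (cases "\<zeta> \<in> Q") (auto intro!: ennreal_leI simp del: times_complex.sel)
  qed
  also have "\<dots> = ennreal (LINT \<zeta>|halfplane. Re (?K \<zeta>))"
    by (intro nn_integral_eq_integral integrable_Re int AE_I2 Re0)
  also have "(LINT \<zeta>|halfplane. Re (?K \<zeta>)) = Re (leray_radial \<gamma> 0 (radial_bump a b q) z)"
    unfolding leray_radial_eq_leray_op[OF int] leray_op_def by (rule integral_Re[OF int])
  also have "ennreal \<dots> \<le> ennreal (cmod (leray_radial \<gamma> 0 (radial_bump a b q) z))"
    by (intro ennreal_leI complex_Re_le_cmod)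
  finally show ?thesis unfolding m_def p_def .
qed

lemma leray_term_bump_lower_bound:
  assumes a': "0 < a'" and c: "0 \<le> c"
    and bound: "\<And>x. x \<in> {0..1} \<times> {a'..b'} \<Longrightarrow> c \<le> cmod (leray_radial \<gamma> 0 (radial_bump a b q) x)"
  shows "ennreal (2 * pi * c\<^sup>2) * powr_integral a' b' r \<le> l2sq (hmeasure \<gamma> r) (leray_term \<gamma> 0 (bump a b q))"
proof -
  have "ennreal (2 * pi * c\<^sup>2) * powr_integral a' b' r
      = (\<integral>\<^sup>+x. ennreal (2 * pi * c\<^sup>2) * indicator ({0..1} \<times> {a'..b'}) x \<partial>weighted_halfplane r)"
    using a' by (intro nn_integral_box_powr_integral[symmetric]) auto
  also have "\<dots> \<le> (\<integral>\<^sup>+x. ennreal (2 * pi) * ennreal ((cmod (leray_radial \<gamma> 0 (radial_bump a b q) x))\<^sup>2)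
      \<partial>weighted_halfplane r)"
  proof (intro nn_integral_mono)
    fix x
    show "ennreal (2 * pi * c\<^sup>2) * indicator ({0..1} \<times> {a'..b'}) x
        \<le> ennreal (2 * pi) * ennreal ((cmod (leray_radial \<gamma> 0 (radial_bump a b q) x))\<^sup>2)"
    proof (cases "x \<in> {0..1} \<times> {a'..b'}")
      case True
      have "c\<^sup>2 \<le> (cmod (leray_radial \<gamma> 0 (radial_bump a b q) x))\<^sup>2"
        using bound[OF True] c by (intro power_mono)
      then show ?thesis using True by (simp add: ennreal_mult mult_left_mono ennreal_leI)
    qed simp
  qed
  also have "\<dots> = l2sq (hmeasure \<gamma> r) (leray_term \<gamma> 0 (bump a b q))"
    by (rule l2sq_radial[symmetric, OF measurable_leray_term[OF measurable_bump]]) (simp add: leray_term_bump)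
  finally show ?thesis .
qed

text \<open>For \<open>e \<rightarrow> 0\<close> this is the divergence at the origin behind both ends of the range.\<close>

lemma powr_integral_ge_ln:
  assumes "0 < e" "e \<le> 1" "p \<le> -1"
  shows "ennreal (- ln e) \<le> powr_integral e 1 p"
proof -
  have "((\<lambda>x. 1 / x) has_integral (ln 1 - ln e)) {e..1}"
    using assms by (intro fundamental_theorem_of_calculus)
      (auto intro!: derivative_eq_intros simp: has_real_derivative_iff_has_vector_derivative[symmetric]
          divide_inverse)
  then have "(\<integral>\<^sup>+x. ennreal (1 / x) * indicator {e..1} x \<partial>lborel) = ennreal (- ln e)"
    using assms by (subst nn_integral_has_integral_lebesgue'[of "{e..1}"]) auto
  then have "ennreal (- ln e) = (\<integral>\<^sup>+x. ennreal (1 / x) * indicator {e..1} x \<partial>lborel)" by simp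
  also have "\<dots> \<le> powr_integral e 1 p"
    unfolding powr_integral_def
  proof (intro nn_integral_mono)
    fix x :: real
    have "1 / x \<le> x powr p" if "e \<le> x" "x \<le> 1"
    proof -
      have "x powr (-1) \<le> x powr p" using that assms by (intro powr_mono') auto
      then show ?thesis using that assms by (simp add: powr_minus_divide)
    qed
    then show "ennreal (1 / x) * indicator {e..1} x \<le> ennreal (x powr p) * indicator {e..1} x"
      by (auto simp: indicator_def intro!: ennreal_leI)
  qed
  finally show ?thesis .
qed

lemma powr_integral_eq_ennreal:
  assumes "0 < a" "a < b"
  obtains j where "0 < j" "powr_integral a b p = ennreal j"
proof -
  have fin: "powr_integral a b p < \<infinity>"
    unfolding powr_integral_def using assms by (intro nn_integral_powr_Icc_finite)
  have "powr_integral a b p \<noteq> 0"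
  proof
    assume "powr_integral a b p = 0"
    then have "AE x in lborel. ennreal (x powr p) * indicator {a..b} x = 0"
      unfolding powr_integral_def by (subst (asm) nn_integral_0_iff_AE) auto
    then have "AE x in lborel. x \<notin> {a..b}"
      by eventually_elim (use assms in \<open>auto simp: indicator_def split: if_splits\<close>)
    then have "emeasure lborel {a..b} = 0"
      by (subst (asm) AE_iff_measurable[of "{a..b}"]) auto
    then show False using assms by simp
  qed
  then show ?thesis
    using that[of "enn2real (powr_integral a b p)"] fin by (auto simp: less_top enn2real_positive_iff
        zero_less_iff_neq_zero)
qed

text \<open>A fixed bump has a transform that stays away from \<open>0\<close> as \<open>\<alpha>\<^sub>z \<rightarrow> 0\<close>, while \<open>\<alpha>\<^sup>r\<close> is not integrable
  at the origin; so the transform is not square-integrable.\<close>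

lemma not_leray_bounded_low:
  assumes \<gamma>: "\<gamma> > 1" and r: "r \<le> -1"
  shows "\<not> leray_bounded \<gamma> r"
proof
  assume "leray_bounded \<gamma> r"
  \<comment> \<open>far enough from the origin for \<open>Re A \<ge> 2\<close>, whatever \<open>\<alpha>\<^sub>z\<close> is\<close>
  define a where "a = max 1 (2 / (\<gamma> - 1))"
  have a: "a \<ge> 1" "2 \<le> (\<gamma> - 1) * a" using \<gamma> by (auto simp: a_def max_def field_simps)
  define U where "U = (\<gamma> - 1) * (a + 1) powr \<gamma> + 1"
  have U: "U > 0" using \<gamma> by (simp add: U_def add_nonneg_pos)
  obtain j where j: "0 < j" "powr_integral a (a + 1) (\<gamma> - 1 + 0) = ennreal j"
    using powr_integral_eq_ennreal[of a "a + 1"] a by (metis less_add_one less_le_trans zero_less_one)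
  define c where "c = \<gamma>\<^sup>2 / (8 * pi * U\<^sup>2) * j"
  have c: "c > 0" using U j \<gamma> by (simp add: c_def)
  obtain g where g: "is_leray_transform \<gamma> r (bump a (a + 1) 0) g"
    using \<open>leray_bounded \<gamma> r\<close> test_function_bump[of a] a unfolding leray_bounded_def by force
  let ?N = "l2sq (hmeasure \<gamma> r) (leray_term \<gamma> 0 (bump a (a + 1) 0))"
  have fin: "?N < \<infinity>"
    using g by (simp add: is_leray_transform_def square_integrable_iff_l2sq)
  have "ennreal (2 * pi * c\<^sup>2) * ennreal (- ln e) \<le> ?N" if e: "0 < e" "e \<le> 1" for e
  proof -
    have "ennreal (2 * pi * c\<^sup>2) * powr_integral e 1 r \<le> ?N"
    proof (rule leray_term_bump_lower_bound[OF e(1)])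
      fix x :: "real \<times> real" assume x: "x \<in> {0..1} \<times> {e..1}"
      have "ennreal c = ennreal (\<gamma>\<^sup>2 / (8 * pi * U\<^sup>2)) * powr_integral a (a + 1) (\<gamma> - 1 + 0)"
        unfolding j c_def using j by (intro ennreal_mult) auto
      also have "\<dots> \<le> ennreal (cmod (leray_radial \<gamma> 0 (radial_bump a (a + 1) 0) x))"
      proof (rule leray_radial_lower_bound[OF \<gamma>])
        fix \<alpha> assume \<alpha>: "\<alpha> \<in> {a..a + 1}"
        have "2 \<le> (\<gamma> - 1) * a" by fact
        also have "\<dots> \<le> (\<gamma> - 1) * \<alpha> powr \<gamma>"
        proof (intro mult_left_mono)
          have "a \<le> \<alpha> powr 1" using \<alpha> a by simp
          also have "\<dots> \<le> \<alpha> powr \<gamma>" using \<alpha> a \<gamma> by (intro powr_mono) auto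
          finally show "a \<le> \<alpha> powr \<gamma>" .
        qed (use \<gamma> in auto)
        finally show "2 \<le> (\<gamma> - 1) * \<alpha> powr \<gamma> + snd x powr \<gamma>" by (simp add: add_increasing2)
        have "\<alpha> powr \<gamma> \<le> (a + 1) powr \<gamma>" using \<alpha> a \<gamma> by (intro powr_mono2) auto
        moreover have "snd x powr \<gamma> \<le> 1 powr \<gamma>" using x e \<gamma> by (intro powr_mono2) auto
        ultimately show "(\<gamma> - 1) * \<alpha> powr \<gamma> + snd x powr \<gamma> \<le> U"
          unfolding U_def using \<gamma> by (intro add_mono mult_left_mono) auto
      qed (use a x e in auto)
      finally show "c \<le> cmod (leray_radial \<gamma> 0 (radial_bump a (a + 1) 0) x)"
        by (simp add: ennreal_le_iff)
    qed (use c in auto)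
    then show ?thesis
      using powr_integral_ge_ln[OF e r] by (meson mult_left_mono order_trans zero_le)
  qed
  then have *: "2 * pi * c\<^sup>2 * y \<le> enn2real ?N" if "y \<ge> 0" for y
  proof -
    have "ennreal (2 * pi * c\<^sup>2 * y) \<le> ?N"
      using \<open>\<And>e. 0 < e \<Longrightarrow> e \<le> 1 \<Longrightarrow> ennreal (2 * pi * c\<^sup>2) * ennreal (- ln e) \<le> ?N\<close>[of "exp (- y)"] that
      by (simp add: ennreal_mult)
    then have "enn2real (ennreal (2 * pi * c\<^sup>2 * y)) \<le> enn2real ?N"
      using fin by (intro enn2real_mono) auto
    then show ?thesis using that by simp
  qed
  have "enn2real ?N + 1 \<le> enn2real ?N"
    using *[of "(enn2real ?N + 1) / (2 * pi * c\<^sup>2)"] c by simp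
  then show False by simp
qed

text \<open>The dual obstruction. The bump \<open>\<alpha>\<^bsup>\<gamma>-1-r\<^esup>\<close> on \<open>[e, 1]\<close> is chosen so that its squared norm and the
  value of its transform on a fixed box are both comparable to the integral \<open>j\<close> of
  \<open>\<alpha>\<^bsup>2\<gamma>-2-r\<^esup>\<close> over \<open>[e, 1]\<close>. Boundedness would give \<open>j\<^sup>2 \<le> const \<cdot> j\<close>, but \<open>j\<close> is unbounded as
  \<open>e \<rightarrow> 0\<close>.\<close>

lemma not_leray_bounded_high:
  assumes \<gamma>: "\<gamma> > 1" and r: "r \<ge> 2 * \<gamma> - 1"
  shows "\<not> leray_bounded \<gamma> r"
proof
  assume "leray_bounded \<gamma> r"
  then obtain D where D: "\<And>f. test_function \<gamma> f \<Longrightarrow>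
      \<exists>g. is_leray_transform \<gamma> r f g \<and> l2norm (hmeasure \<gamma> r) g \<le> D * l2norm (hmeasure \<gamma> r) f"
    unfolding leray_bounded_def by blast
  define U where "U = (\<gamma> - 1) + 3 powr \<gamma>"
  have U: "U > 0" using \<gamma> by (simp add: U_def add_pos_pos)
  define m where "m = \<gamma>\<^sup>2 / (8 * pi * U\<^sup>2)"
  have m: "m > 0" using U \<gamma> by (simp add: m_def)
  define q where "q = \<gamma> - 1 - r"
  define p where "p = 2 * \<gamma> - 2 - r"
  have pq: "\<gamma> - 1 + q = p" "2 * q + r = p" "p \<le> -1" using r by (auto simp: p_def q_def)
  obtain w where w: "0 < w" "powr_integral 2 3 r = ennreal w"
    using powr_integral_eq_ennreal[of 2 3] by auto
  have bound: "- ln e \<le> D\<^sup>2 / (m\<^sup>2 * w)" if e: "0 < e" "e < 1" for e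
  proof -
    obtain j where j: "0 < j" "powr_integral e 1 p = ennreal j"
      using powr_integral_eq_ennreal[OF e] by blast
    let ?f = "bump e 1 q"
    have f: "test_function \<gamma> ?f" using e by (intro test_function_bump)
    then obtain g where g: "is_leray_transform \<gamma> r ?f g" "l2norm (hmeasure \<gamma> r) g
        \<le> D * l2norm (hmeasure \<gamma> r) ?f"
      using D by blast
    have fnorm: "l2sq (hmeasure \<gamma> r) ?f = ennreal (2 * pi * j)"
    proof -
      have "l2sq (hmeasure \<gamma> r) ?f = (\<integral>\<^sup>+x. ennreal (2 * pi) * ennreal ((cmod (radial_bump e 1 q x))\<^sup>2)
          \<partial>weighted_halfplane r)"
        by (rule l2sq_radial[OF measurable_bump]) (simp add: bump_polar_point)
      also have "\<dots> = (\<integral>\<^sup>+x. ennreal (2 * pi * (snd x powr (2 * q)))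
          * indicator ({0..1} \<times> {e..1}) x \<partial>weighted_halfplane r)"
      proof (intro nn_integral_cong)
        fix x :: "real \<times> real"
        have "(snd x powr q)\<^sup>2 = snd x powr (2 * q)"
          by (simp add: power2_eq_square powr_add[symmetric])
        then show "ennreal (2 * pi) * ennreal ((cmod (radial_bump e 1 q x))\<^sup>2)
            = ennreal (2 * pi * (snd x powr (2 * q))) * indicator ({0..1} \<times> {e..1}) x"
          by (cases x) (auto simp: radial_bump_def indicator_def ennreal_mult norm_mult)
      qed
      also have "\<dots> = ennreal (1 - 0) * (\<integral>\<^sup>+\<alpha>. ennreal (2 * pi * (\<alpha> powr (2 * q))) * ennreal (\<alpha> powr r)
          * indicator {e..1} \<alpha> \<partial>lborel)"
        using e by (intro nn_integral_weighted_box) auto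
      also have "\<dots> = (\<integral>\<^sup>+\<alpha>. ennreal (2 * pi) * (ennreal (\<alpha> powr p) * indicator {e..1} \<alpha>) \<partial>lborel)"
        using pq(2) by (simp add: ennreal_mult mult.assoc) (simp add: ennreal_mult[symmetric]
            powr_add[symmetric] flip: mult.assoc)
      also have "\<dots> = ennreal (2 * pi) * powr_integral e 1 p"
        unfolding powr_integral_def by (intro nn_integral_cmult) measurable
      finally show ?thesis using j by (simp add: ennreal_mult)
    qed
    have "ennreal (2 * pi * (m * j)\<^sup>2) * powr_integral 2 3 r \<le> l2sq (hmeasure \<gamma> r) (leray_term \<gamma> 0 ?f)"
    proof (rule leray_term_bump_lower_bound)
      fix x :: "real \<times> real" assume x: "x \<in> {0..1} \<times> {2..3}"
      have "ennreal (m * j) = ennreal m * powr_integral e 1 (\<gamma> - 1 + q)"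
        unfolding pq j using j m by (intro ennreal_mult) auto
      also have "\<dots> \<le> ennreal (cmod (leray_radial \<gamma> 0 (radial_bump e 1 q) x))"
        unfolding m_def
      proof (rule leray_radial_lower_bound[OF \<gamma>])
        fix \<alpha> assume \<alpha>: "\<alpha> \<in> {e..1}"
        have "2 \<le> snd x powr 1" using x by auto
        also have "\<dots> \<le> snd x powr \<gamma>" using x \<gamma> by (intro powr_mono) auto
        finally show "2 \<le> (\<gamma> - 1) * \<alpha> powr \<gamma> + snd x powr \<gamma>" using \<gamma> by (simp add: add_increasing)
        have "\<alpha> powr \<gamma> \<le> 1 powr \<gamma>" using \<alpha> e \<gamma> by (intro powr_mono2) auto
        moreover have "snd x powr \<gamma> \<le> 3 powr \<gamma>" using x \<gamma> by (intro powr_mono2) auto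
        moreover have "(\<gamma> - 1) * \<alpha> powr \<gamma> \<le> (\<gamma> - 1) * 1" using calculation \<gamma> by (intro mult_left_mono) auto
        ultimately show "(\<gamma> - 1) * \<alpha> powr \<gamma> + snd x powr \<gamma> \<le> U"
          unfolding U_def by simp
      qed (use x e in auto)
      finally show "m * j \<le> cmod (leray_radial \<gamma> 0 (radial_bump e 1 q) x)"
        by (simp add: ennreal_le_iff)
    qed (use m j in auto)
    also have "\<dots> = l2sq (hmeasure \<gamma> r) g"
      using l2sq_leray_transform_bump[OF e(1) g(1)] by simp
    also have "\<dots> \<le> ennreal (D\<^sup>2) * l2sq (hmeasure \<gamma> r) ?f"
      using g square_integrable_test_function[OF f]
      by (intro l2sq_le_of_l2norm) (auto simp: is_leray_transform_def)
    finally have "ennreal (2 * pi * (m * j)\<^sup>2 * w) \<le> ennreal (D\<^sup>2 * (2 * pi * j))"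
      unfolding fnorm w using w j by (simp add: ennreal_mult)
    then have "2 * pi * (m * j)\<^sup>2 * w \<le> D\<^sup>2 * (2 * pi * j)"
      using j by (subst (asm) ennreal_le_iff) auto
    then have "(2 * pi * j) * (j * (m\<^sup>2 * w)) \<le> (2 * pi * j) * D\<^sup>2"
      by (simp add: power2_eq_square mult_ac)
    then have "j * (m\<^sup>2 * w) \<le> D\<^sup>2"
      using j by (subst (asm) mult_le_cancel_left_pos) auto
    then have "j \<le> D\<^sup>2 / (m\<^sup>2 * w)"
      using m w by (simp add: pos_le_divide_eq)
    moreover have "ennreal (- ln e) \<le> ennreal j"
      using powr_integral_ge_ln[of e p] e pq j by simp
    then have "- ln e \<le> j" using j by (simp add: ennreal_le_iff)
    ultimately show ?thesis by simp
  qed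
  define y where "y = D\<^sup>2 / (m\<^sup>2 * w) + 1"
  have y: "y > 0" using m w by (simp add: y_def add_nonneg_pos)
  have "- ln (exp (- y)) \<le> D\<^sup>2 / (m\<^sup>2 * w)" using y by (intro bound) auto
  then show False by (simp add: y_def)
qed

theorem theorem1p4:
  fixes \<gamma> r :: real
  assumes "\<gamma> > 1"
  shows "leray_bounded_projection \<gamma> r \<longleftrightarrow> r \<in> {-1 <..< 2 * \<gamma> - 1}"
proof
  assume "leray_bounded_projection \<gamma> r"
  then have "leray_bounded \<gamma> r" by (simp add: leray_bounded_projection_def)
  then show "r \<in> {-1 <..< 2 * \<gamma> - 1}"
    using not_leray_bounded_low[OF assms, of r] not_leray_bounded_high[OF assms, of r] by force
next
  assume "r \<in> {-1 <..< 2 * \<gamma> - 1}"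
  then show "leray_bounded_projection \<gamma> r"
    using leray_projection_in_range[OF assms] by simp
qed

end
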